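(* Let the magnetic permeability $\mu=\mu_0>0$ be constant and let the electric permittivity $\epsilon:\mathbb{R}^3\to\mathbb{R}$ satisfy $$\epsilon>0,\quad \epsilon\in \mathrm{L}^\infty_{\mathrm{loc}}(\mathbb{R}^3),\quad \epsilon^{-1}\in \mathrm{L}^\infty_{\mathrm{loc}}(\mathbb{R}^3).$$ Let $n$ be defined by $\epsilon=\epsilon_0n^2$ with $\epsilon_0>0$ constant, and let $\omega\in\mathbb{R}\setminus\{0\}$ and $\kappa\in\mathbb{R}$ be related by $\kappa^2=\epsilon_0\mu_0\omega^2$. Consider the two systems on $\mathbb{R}^3$ $$\text{(A)}\quad \nabla\times\mathbf{E}-i\omega\mu\mathbf{H}=0,\qquad \nabla\times\mathbf{H}+i\omega\epsilon\mathbf{E}=0;$$ $$\text{(B)}\quad \nabla\times\big(\tfrac{1}{n^2}\nabla\times\mathbf{H}\big)=\kappa^2\mathbf{H},\qquad \nabla\cdot\mathbf{H}=0.$$ (i) If $(\mathbf{E},\mathbf{H})\in \mathrm{L}^2_{\mathrm{loc}}(\mathbb{R}^3)^3\times \mathrm{L}^2_{\mathrm{loc}}(\mathbb{R}^3)^3$ is a solution of (A), then $\mathbf{H}$ is a solution of (B) and belongs to $\mathrm{H}^1_{\mathrm{loc}}(\mathbb{R}^3)^3$. (ii) On the other hand, if $\mathbf{H}$ and $\nabla\times\mathbf{H}$ belong to $\mathrm{L}^2_{\mathrm{loc}}(\mathbb{R}^3)^3$ and are such that (B) is satisfied, then $\mathbf{H}$ belongs to $\mathrm{H}^1_{\mathrm{loc}}(\mathbb{R}^3)^3$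 and, setting $\mathbf{E}=\frac{i}{\omega\epsilon}\nabla\times\mathbf{H}$, the pair $(\mathbf{E},\mathbf{H})$ is a solution of (A).
   Context: All differential equations are understood in the sense of distributions on $\mathbb{R}^3$; fields are complex-valued. *)

theory Defs imports "HOL-Analysis.Analysis" begin

definition partial_deriv :: "3 \<Rightarrow> (real^3 \<Rightarrow> complex) \<Rightarrow> real^3 \<Rightarrow> complex" where
  "partial_deriv j f x = frechet_derivative f (at x) (axis j 1)"

primrec Ck :: "nat \<Rightarrow> (real^3 \<Rightarrow> complex) \<Rightarrow> bool" where
  "Ck 0 f \<longleftrightarrow> continuous_on UNIV f"
| "Ck (Suc k) f \<longleftrightarrow> (\<forall>x. f differentiable (at x)) \<and> (\<forall>j. Ck k (partial_deriv j f))"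

definition test_function :: "(real^3 \<Rightarrow> complex) \<Rightarrow> bool" where
  "test_function \<phi> \<longleftrightarrow> (\<forall>k. Ck k \<phi>) \<and> compact (closure {x. \<phi> x \<noteq> 0})"

text \<open>Elements of the spaces below are representatives (Lebesgue measurable functions) of the
  usual almost-everywhere classes.\<close>

definition L1_loc :: "(real^3 \<Rightarrow> 'b::euclidean_space) \<Rightarrow> bool" where
  "L1_loc f \<longleftrightarrow> f \<in> borel_measurable lebesgue \<and>
     (\<forall>K. compact K \<longrightarrow> set_integrable lebesgue K f)"

definition L2_loc :: "(real^3 \<Rightarrow> 'b::euclidean_space) \<Rightarrow> bool" where
  "L2_loc f \<longleftrightarrow> f \<in> borel_measurable lebesgue \<and>
     (\<forall>K. compact K \<longrightarrow> set_integrable lebesgue K (\<lambda>x. (norm (f x))\<^sup>2))"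

definition Linfty_loc :: "(real^3 \<Rightarrow> 'b::euclidean_space) \<Rightarrow> bool" where
  "Linfty_loc f \<longleftrightarrow> f \<in> borel_measurable lebesgue \<and>
     (\<forall>K. compact K \<longrightarrow> (\<exists>B. AE x in lebesgue. x \<in> K \<longrightarrow> norm (f x) \<le> B))"

text \<open>A distribution with values in \<open>\<complex>\<^sup>3\<close> is represented by the functional it induces on test
  functions; its values off the test functions carry no meaning, so equations between distributions
  are always restricted to test functions. Only the regular distributions of locally integrable
  fields and their derivatives occur, so continuity of the functionals is automatic.\<close>

type_synonym distr = "(real^3 \<Rightarrow> complex) \<Rightarrow> complex^3"

definition distr_eq :: "distr \<Rightarrow> distr \<Rightarrow> bool" where
  "distr_eq S T \<longleftrightarrow> (\<forall>\<phi>. test_function \<phi> \<longrightarrow> S \<phi> = T \<phi>)"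

definition distr_of :: "(real^3 \<Rightarrow> complex^3) \<Rightarrow> distr" where
  "distr_of u \<phi> = (LINT x|lebesgue. \<phi> x *s u x)"

definition distr_deriv :: "3 \<Rightarrow> distr \<Rightarrow> distr" where
  "distr_deriv j T \<phi> = - T (partial_deriv j \<phi>)"

definition distr_curl :: "distr \<Rightarrow> distr" where
  "distr_curl T \<phi> = vector
     [distr_deriv 2 T \<phi> $ 3 - distr_deriv 3 T \<phi> $ 2,
      distr_deriv 3 T \<phi> $ 1 - distr_deriv 1 T \<phi> $ 3,
      distr_deriv 1 T \<phi> $ 2 - distr_deriv 2 T \<phi> $ 1]"

definition distr_div :: "distr \<Rightarrow> (real^3 \<Rightarrow> complex) \<Rightarrow> complex" where
  "distr_div T \<phi> = (\<Sum>j\<in>UNIV. distr_deriv j T \<phi> $ j)"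

text \<open>The distributional curl of \<open>u\<close> is (the regular distribution of) the locally integrable
  field \<open>v\<close>, which is then unique up to null sets.\<close>

definition has_curl :: "(real^3 \<Rightarrow> complex^3) \<Rightarrow> (real^3 \<Rightarrow> complex^3) \<Rightarrow> bool" where
  "has_curl u v \<longleftrightarrow> L1_loc u \<and> L1_loc v \<and> distr_eq (distr_curl (distr_of u)) (distr_of v)"

definition H1_loc :: "(real^3 \<Rightarrow> complex^3) \<Rightarrow> bool" where
  "H1_loc u \<longleftrightarrow> L2_loc u \<and>
     (\<forall>j. \<exists>v. L2_loc v \<and> distr_eq (distr_deriv j (distr_of u)) (distr_of v))"

text \<open>The local integrability conditions in the two systems say that every field occurring in the
  equations (products with coefficients included) defines a distribution. They are implied by
  \<open>E, H \<in> L\<^sup>2\<close> locally when the coefficients are locally bounded.\<close>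

definition solves_A ::
  "real \<Rightarrow> (real^3 \<Rightarrow> real) \<Rightarrow> (real^3 \<Rightarrow> real) \<Rightarrow>
   (real^3 \<Rightarrow> complex^3) \<Rightarrow> (real^3 \<Rightarrow> complex^3) \<Rightarrow> bool" where
  "solves_A \<omega> \<mu> \<epsilon> E H \<longleftrightarrow>
     L1_loc E \<and> L1_loc H \<and> L1_loc (\<lambda>x. \<mu> x *\<^sub>R H x) \<and> L1_loc (\<lambda>x. \<epsilon> x *\<^sub>R E x) \<and>
     distr_eq (\<lambda>\<phi>. distr_curl (distr_of E) \<phi>
                   - (\<i> * complex_of_real \<omega>) *s distr_of (\<lambda>x. \<mu> x *\<^sub>R H x) \<phi>) (\<lambda>\<phi>. 0) \<and>
     distr_eq (\<lambda>\<phi>. distr_curl (distr_of H) \<phi>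
                   + (\<i> * complex_of_real \<omega>) *s distr_of (\<lambda>x. \<epsilon> x *\<^sub>R E x) \<phi>) (\<lambda>\<phi>. 0)"

text \<open>The product of \<open>1 / n\<^sup>2\<close> with a general distribution is undefined, so the first equation
  presupposes that the curl of \<open>H\<close> is a locally integrable field.\<close>

definition solves_B ::
  "(real^3 \<Rightarrow> real) \<Rightarrow> real \<Rightarrow> (real^3 \<Rightarrow> complex^3) \<Rightarrow> bool" where
  "solves_B n \<kappa> H \<longleftrightarrow>
     (\<exists>C. has_curl H C \<and> L1_loc (\<lambda>x. (1 / (n x)\<^sup>2) *\<^sub>R C x) \<and>
          distr_eq (distr_curl (distr_of (\<lambda>x. (1 / (n x)\<^sup>2) *\<^sub>R C x)))
                   (\<lambda>\<phi>. \<kappa>\<^sup>2 *\<^sub>R distr_of H \<phi>)) \<and>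
     (\<forall>\<phi>. test_function \<phi> \<longrightarrow> distr_div (distr_of H) \<phi> = 0)"

end

theory Submission imports Defs begin

text \<open>
  The two systems are algebraically equivalent: eliminating \<open>E\<close> from (A) by \<open>E = (\<i> / (\<omega>\<epsilon>)) curl H\<close>
  produces the first equation of (B), and the second follows from \<open>div curl = 0\<close>. The latter rests on
  the symmetry of second derivatives of test functions (\<open>partial_deriv_commute\<close>). Two points are
  analytic rather than algebraic.

  The field \<open>curl_H\<close> given in part (ii) need not be the representative of the curl that witnesses (B).
  Both represent the same distribution, so they agree almost everywhere by the fundamental lemma of
  the calculus of variations (\<open>fundamental_lemma\<close>), and the product with \<open>1 / n\<^sup>2\<close> does not notice
  the difference.

  The regularity claim is that a locally square integrable field whose curl is locally square
  integrable and whose divergence vanishes is locally in \<open>H\<^sup>1\<close> (\<open>H1_loc_of_curl_div\<close>). For test fields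
  \<open>u\<close> the identity
  \<open>\<Sum>\<^sub>j\<^sub>k \<integral>|\<partial>\<^sub>j u\<^sub>k|\<^sup>2 = \<integral>|curl u|\<^sup>2 + \<integral>|div u|\<^sup>2\<close> holds, because the mixed products
  \<open>\<partial>\<^sub>j u\<^sub>k \<partial>\<^sub>k u\<^sub>j\<close> and \<open>\<partial>\<^sub>j u\<^sub>j \<partial>\<^sub>k u\<^sub>k\<close> (with a conjugate on the second factor) have equal integrals after two integrations by parts
  (\<open>gradient_energy_le_curl_div\<close>). Multiplying \<open>H\<close> by a cutoff \<open>\<eta>\<close> gives a compactly supported field
  \<open>G\<close> whose curl and divergence are still square integrable, the additional terms being products of
  derivatives of \<open>\<eta>\<close> with components of \<open>H\<close>. The mollifications \<open>\<rho>\<^sub>n * G\<close> are test fields with curl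
  \<open>\<rho>\<^sub>n * curl G\<close> and divergence \<open>\<rho>\<^sub>n * div G\<close>, and these converge in \<open>L\<^sup>2\<close>. Applied to differences
  \<open>(\<rho>\<^sub>m - \<rho>\<^sub>n) * G\<close>, the identity therefore shows that the gradients of \<open>\<rho>\<^sub>n * G\<close> form a Cauchy sequence
  in \<open>L\<^sup>2\<close>; the limit is the weak gradient of \<open>G\<close>
  (\<open>weak_derivatives_of_compactly_supported_field\<close>). The weak gradients for larger and larger cutoffs
  agree where both are relevant, again by the fundamental lemma, and glue to one locally square
  integrable field (\<open>glue_weak_derivatives\<close>).
\<close>



section \<open>Smooth functions\<close>

definition smooth :: "(real^3 \<Rightarrow> complex) \<Rightarrow> bool" where
  "smooth f \<longleftrightarrow> (\<forall>k. Ck k f)"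

lemma partial_deriv_eqI:
  assumes "(f has_derivative f') (at x)"
  shows "partial_deriv j f x = f' (axis j 1)"
  using frechet_derivative_at[OF assms] by (simp add: partial_deriv_def)

text \<open>Products need this: the derivatives of \<open>f * g\<close> contain \<open>f\<close> and \<open>g\<close> themselves, which are only
assumed to be one order smoother.\<close>

lemma Ck_SucD: "Ck (Suc k) f \<Longrightarrow> Ck k f"
proof (induction k arbitrary: f)
  case 0
  then show ?case
    by (auto simp: continuous_on_eq_continuous_at intro: differentiable_imp_continuous_within)
next
  case (Suc k)
  from Suc.prems have "f differentiable (at x)" and "Ck (Suc k) (partial_deriv j f)" for x j
    using Ck.simps(2)[of "Suc k" f] by blast+
  then show ?case
    using Suc.IH by simp
qed

lemma Ck_Suc_differentiable: "Ck (Suc k) f \<Longrightarrow> (f has_derivative frechet_derivative f (at x)) (at x)"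
  by (simp flip: frechet_derivative_works)

lemma Ck_const: "Ck k (\<lambda>x. c)"
proof (induction k arbitrary: c)
  case (Suc k)
  have "partial_deriv j (\<lambda>x. c) = (\<lambda>x. 0)" for j
    by (rule ext) (auto intro!: partial_deriv_eqI[THEN trans] derivative_eq_intros)
  then show ?case using Suc by auto
qed auto

lemma partial_deriv_add:
  assumes "f differentiable (at x)" "g differentiable (at x)"
  shows "partial_deriv j (\<lambda>x. f x + g x) x = partial_deriv j f x + partial_deriv j g x"
  using has_derivative_add[OF frechet_derivative_works[THEN iffD1, OF assms(1)] frechet_derivative_works[THEN iffD1, OF assms(2)]]
  by (simp add: partial_deriv_eqI) (simp add: partial_deriv_def)

lemma partial_deriv_diff:
  assumes "f differentiable (at x)" "g differentiable (at x)"
  shows "partial_deriv j (\<lambda>x. f x - g x) x = partial_deriv j f x - partial_deriv j g x"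
  using has_derivative_diff[OF frechet_derivative_works[THEN iffD1, OF assms(1)] frechet_derivative_works[THEN iffD1, OF assms(2)]]
  by (simp add: partial_deriv_eqI) (simp add: partial_deriv_def)

lemma partial_deriv_mult:
  assumes "f differentiable (at x)" "g differentiable (at x)"
  shows "partial_deriv j (\<lambda>x. f x * g x) x = f x * partial_deriv j g x + partial_deriv j f x * g x"
  using has_derivative_mult[OF frechet_derivative_works[THEN iffD1, OF assms(1)] frechet_derivative_works[THEN iffD1, OF assms(2)]]
  by (simp add: partial_deriv_eqI) (simp add: partial_deriv_def)

lemma partial_deriv_cnj:
  assumes "f differentiable (at x)"
  shows "partial_deriv j (\<lambda>x. cnj (f x)) x = cnj (partial_deriv j f x)"
  using bounded_linear.has_derivative[OF bounded_linear_cnj frechet_derivative_works[THEN iffD1, OF assms]]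
  by (simp add: partial_deriv_eqI) (simp add: partial_deriv_def)

lemma partial_deriv_reflect:
  assumes "f differentiable (at (a - x))"
  shows "partial_deriv j (\<lambda>x. f (a - x)) x = - partial_deriv j f (a - x)"
proof -
  let ?D = "frechet_derivative f (at (a - x))"
  have D: "(f has_derivative ?D) (at (a - x))"
    using assms by (simp flip: frechet_derivative_works)
  have "((\<lambda>x. a - x) has_derivative (\<lambda>h. - h)) (at x)"
    by (auto intro!: derivative_eq_intros)
  from has_derivative_compose[OF this D] have "((\<lambda>x. f (a - x)) has_derivative (\<lambda>h. ?D (- h))) (at x)"
    by simp
  from partial_deriv_eqI[OF this, of j] linear_neg[OF has_derivative_linear[OF D]]
  show ?thesis by (simp add: partial_deriv_def)
qed

lemma Ck_add: "Ck k f \<Longrightarrow> Ck k g \<Longrightarrow> Ck k (\<lambda>x. f x + g x)"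
proof (induction k arbitrary: f g)
  case 0
  then show ?case by (auto intro: continuous_intros)
next
  case (Suc k)
  then have "partial_deriv j (\<lambda>x. f x + g x) = (\<lambda>x. partial_deriv j f x + partial_deriv j g x)" for j
    by (auto simp: partial_deriv_add)
  with Suc show ?case by auto
qed

lemma Ck_mult: "Ck k f \<Longrightarrow> Ck k g \<Longrightarrow> Ck k (\<lambda>x. f x * g x)"
proof (induction k arbitrary: f g)
  case 0
  then show ?case by (auto intro: continuous_intros)
next
  case (Suc k)
  then have "partial_deriv j (\<lambda>x. f x * g x) = (\<lambda>x. f x * partial_deriv j g x + partial_deriv j f x * g x)" for j
    by (auto simp: partial_deriv_mult)
  with Suc show ?case using Ck_SucD[OF Suc.prems(1)] Ck_SucD[OF Suc.prems(2)]
    by (auto intro!: Ck_add Suc.IH)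
qed

lemma Ck_cnj: "Ck k f \<Longrightarrow> Ck k (\<lambda>x. cnj (f x))"
proof (induction k arbitrary: f)
  case 0
  then show ?case by (auto intro: continuous_intros)
next
  case (Suc k)
  then have "partial_deriv j (\<lambda>x. cnj (f x)) = (\<lambda>x. cnj (partial_deriv j f x))" for j
    by (auto simp: partial_deriv_cnj)
  moreover have "(\<lambda>x. cnj (f x)) differentiable (at x)" for x
    using bounded_linear.has_derivative[OF bounded_linear_cnj Ck_Suc_differentiable[OF Suc.prems]]
    by (auto simp: differentiable_def)
  ultimately show ?case using Suc by auto
qed

lemma Ck_reflect: "Ck k f \<Longrightarrow> Ck k (\<lambda>x. f (a - x))"
proof (induction k arbitrary: f)
  case 0
  then show ?case
    by (auto intro!: continuous_on_compose2[of UNIV f UNIV "\<lambda>x. a - x"] continuous_intros)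
next
  case (Suc k)
  then have "partial_deriv j (\<lambda>x. f (a - x)) = (\<lambda>x. (-1) * partial_deriv j f (a - x))" for j
    by (auto simp: partial_deriv_reflect)
  moreover have "(\<lambda>x. f (a - x)) differentiable (at x)" for x
  proof -
    have "(\<lambda>x. a - x) differentiable (at x)" by (auto intro!: derivative_intros)
    with Suc.prems show ?thesis
      using differentiable_chain_at[of "\<lambda>x. a - x" x f] by (auto simp: o_def)
  qed
  moreover have "Ck k (\<lambda>x. (-1) * partial_deriv j f (a - x))" for j
    using Suc by (intro Ck_mult Ck_const Suc.IH) auto
  ultimately show ?case by auto
qed

lemma Ck_coordinate: "Ck k (\<lambda>x. complex_of_real (x $ i))"
proof (cases k)
  case 0
  then show ?thesis by (auto intro!: continuous_intros)
next
  case (Suc m)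
  have D: "((\<lambda>x. complex_of_real (x $ i)) has_derivative (\<lambda>h. complex_of_real (h $ i))) (at x)" for x :: "real^3"
    by (rule bounded_linear_imp_has_derivative)
      (rule bounded_linear_compose[OF bounded_linear_of_real bounded_linear_vec_nth])
  then have "partial_deriv j (\<lambda>x. complex_of_real (x $ i)) = (\<lambda>x. complex_of_real (axis j 1 $ i))" for j
    by (intro ext partial_deriv_eqI)
  with D Suc show ?thesis by (auto simp: Ck_const differentiable_def)
qed

lemma smooth_differentiable: "smooth f \<Longrightarrow> f differentiable (at x)"
  unfolding smooth_def using Ck.simps(2) by blast

lemma smooth_has_derivative: "smooth f \<Longrightarrow> (f has_derivative frechet_derivative f (at x)) (at x)"
  by (simp add: smooth_differentiable flip: frechet_derivative_works)

lemma smooth_partial_deriv: "smooth f \<Longrightarrow> smooth (partial_deriv j f)"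
  unfolding smooth_def using Ck.simps(2) by blast

lemma smooth_continuous_on: "smooth f \<Longrightarrow> continuous_on S f"
  unfolding smooth_def using Ck.simps(1) continuous_on_subset by blast

lemma smooth_const: "smooth (\<lambda>x. c)"
  and smooth_add: "smooth f \<Longrightarrow> smooth g \<Longrightarrow> smooth (\<lambda>x. f x + g x)"
  and smooth_mult: "smooth f \<Longrightarrow> smooth g \<Longrightarrow> smooth (\<lambda>x. f x * g x)"
  and smooth_cnj: "smooth f \<Longrightarrow> smooth (\<lambda>x. cnj (f x))"
  and smooth_reflect: "smooth f \<Longrightarrow> smooth (\<lambda>x. f (a - x))"
  by (auto simp: smooth_def Ck_const Ck_add Ck_mult Ck_cnj Ck_reflect)

lemma has_derivative_eq_sum_partial_deriv:
  assumes "smooth f"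
  shows "(f has_derivative (\<lambda>h. \<Sum>j\<in>UNIV. h $ j *\<^sub>R partial_deriv j f x)) (at x)"
proof -
  let ?D = "frechet_derivative f (at x)"
  have D: "(f has_derivative ?D) (at x)" using assms by (rule smooth_has_derivative)
  have lin: "linear ?D" using D by (rule has_derivative_linear)
  have "?D h = (\<Sum>j\<in>UNIV. h $ j *\<^sub>R partial_deriv j f x)" for h
  proof -
    have "?D h = ?D (\<Sum>j\<in>UNIV. h $ j *\<^sub>R axis j 1)"
      using basis_expansion[of h] by (simp add: scalar_mult_eq_scaleR)
    also have "\<dots> = (\<Sum>j\<in>UNIV. h $ j *\<^sub>R ?D (axis j 1))"
      using lin by (simp add: linear_sum linear_cmul)
    finally show ?thesis by (simp add: partial_deriv_def)
  qed
  with D show ?thesis by (metis (no_types, lifting) ext)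
qed

lemma DERIV_along_axis:
  assumes "smooth f" "bounded_linear (L :: complex \<Rightarrow> real)"
  shows "((\<lambda>s. L (f (y + s *\<^sub>R axis j 1))) has_real_derivative
           L (partial_deriv j f (y + s *\<^sub>R axis j 1))) (at s)"
proof -
  let ?p = "y + s *\<^sub>R axis j 1"
  let ?D = "frechet_derivative f (at ?p)"
  have D: "(f has_derivative ?D) (at ?p)" using assms(1) by (rule smooth_has_derivative)
  have "((\<lambda>s. y + s *\<^sub>R axis j 1) has_derivative (\<lambda>t. t *\<^sub>R axis j 1)) (at s)"
    by (auto intro!: derivative_eq_intros)
  from bounded_linear.has_derivative[OF assms(2) has_derivative_compose[OF this D]]
  have "((\<lambda>s. L (f (y + s *\<^sub>R axis j 1))) has_derivative (\<lambda>t. L (?D (t *\<^sub>R axis j 1)))) (at s)" .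
  moreover have "L (?D (t *\<^sub>R axis j 1)) = L (partial_deriv j f ?p) * t" for t
    using linear_cmul[OF has_derivative_linear[OF D]]
      linear_cmul[OF bounded_linear.linear[OF assms(2)]]
    by (simp add: partial_deriv_def)
  ultimately show ?thesis by (simp add: has_field_derivative_def)
qed

text \<open>Along one axis the second difference is an increment of the function
\<open>\<sigma> \<mapsto> f (x + s e\<^sub>j + \<sigma> e\<^sub>i) - f (x + \<sigma> e\<^sub>i)\<close>, so two applications of the mean value theorem turn it
into a mixed derivative at an intermediate point. Complex values are handled through a real linear
functional \<open>L\<close>, since the mean value theorem fails for complex valued functions.\<close>

lemma second_difference_mean_value:
  assumes f: "smooth f" and L: "bounded_linear (L :: complex \<Rightarrow> real)" and s: "s > 0"
  obtains \<sigma> \<tau> where "0 < \<sigma>" "\<sigma> < s" "0 < \<tau>" "\<tau> < s"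
    "L (f (x + s *\<^sub>R axis i 1 + s *\<^sub>R axis j 1)) - L (f (x + s *\<^sub>R axis i 1))
       - L (f (x + s *\<^sub>R axis j 1)) + L (f x)
     = s\<^sup>2 * L (partial_deriv j (partial_deriv i f) (x + \<sigma> *\<^sub>R axis i 1 + \<tau> *\<^sub>R axis j 1))"
proof -
  let ?F = "\<lambda>\<sigma>. L (f (x + s *\<^sub>R axis j 1 + \<sigma> *\<^sub>R axis i 1)) - L (f (x + \<sigma> *\<^sub>R axis i 1))"
  let ?F' = "\<lambda>\<sigma>. L (partial_deriv i f (x + s *\<^sub>R axis j 1 + \<sigma> *\<^sub>R axis i 1))
                  - L (partial_deriv i f (x + \<sigma> *\<^sub>R axis i 1))"
  have "(?F has_real_derivative ?F' \<sigma>) (at \<sigma>)" for \<sigma>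
    by (intro DERIV_diff DERIV_along_axis f L)
  from MVT2[OF s this] obtain \<sigma> where \<sigma>: "0 < \<sigma>" "\<sigma> < s" "?F s - ?F 0 = s * ?F' \<sigma>"
    by auto
  let ?G = "\<lambda>\<tau>. L (partial_deriv i f (x + \<sigma> *\<^sub>R axis i 1 + \<tau> *\<^sub>R axis j 1))"
  have "(?G has_real_derivative
      L (partial_deriv j (partial_deriv i f) (x + \<sigma> *\<^sub>R axis i 1 + \<tau> *\<^sub>R axis j 1))) (at \<tau>)" for \<tau>
    by (intro DERIV_along_axis smooth_partial_deriv f L)
  from MVT2[OF s this] obtain \<tau> where \<tau>: "0 < \<tau>" "\<tau> < s"
    "?G s - ?G 0 = s * L (partial_deriv j (partial_deriv i f) (x + \<sigma> *\<^sub>R axis i 1 + \<tau> *\<^sub>R axis j 1))"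
    by auto
  have "?F s - ?F 0 = s * (?G s - ?G 0)" using \<sigma>(3) by (simp add: algebra_simps)
  with \<sigma> \<tau> show thesis
    by (intro that[of \<sigma> \<tau>]) (simp_all add: power2_eq_square algebra_simps)
qed

text \<open>The second difference is symmetric in \<open>i\<close> and \<open>j\<close>, whence both mixed derivatives take a common
value at points within distance \<open>2 s\<close> of \<open>x\<close>; continuity does the rest as \<open>s\<close> tends to \<open>0\<close>.\<close>

lemma partial_deriv_commute:
  assumes f: "smooth f"
  shows "partial_deriv i (partial_deriv j f) x = partial_deriv j (partial_deriv i f) x"
proof -
  have "L (partial_deriv j (partial_deriv i f) x) = L (partial_deriv i (partial_deriv j f) x)"
    if L: "bounded_linear (L :: complex \<Rightarrow> real)" for L
  proof -
    let ?a = "\<lambda>p. L (partial_deriv j (partial_deriv i f) p)"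
    let ?b = "\<lambda>p. L (partial_deriv i (partial_deriv j f) p)"
    have "\<exists>p q. dist p x \<le> 2 * s \<and> dist q x \<le> 2 * s \<and> ?a p = ?b q" if s: "s > 0" for s
    proof -
      obtain \<sigma> \<tau> where 1: "0 < \<sigma>" "\<sigma> < s" "0 < \<tau>" "\<tau> < s"
        "L (f (x + s *\<^sub>R axis i 1 + s *\<^sub>R axis j 1)) - L (f (x + s *\<^sub>R axis i 1))
           - L (f (x + s *\<^sub>R axis j 1)) + L (f x) = s\<^sup>2 * ?a (x + \<sigma> *\<^sub>R axis i 1 + \<tau> *\<^sub>R axis j 1)"
        using second_difference_mean_value[OF f L s] by metis
      obtain \<sigma>' \<tau>' where 2: "0 < \<sigma>'" "\<sigma>' < s" "0 < \<tau>'" "\<tau>' < s"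
        "L (f (x + s *\<^sub>R axis j 1 + s *\<^sub>R axis i 1)) - L (f (x + s *\<^sub>R axis j 1))
           - L (f (x + s *\<^sub>R axis i 1)) + L (f x) = s\<^sup>2 * ?b (x + \<sigma>' *\<^sub>R axis j 1 + \<tau>' *\<^sub>R axis i 1)"
        using second_difference_mean_value[OF f L s] by metis
      have near: "dist (x + a *\<^sub>R axis k 1 + b *\<^sub>R axis l 1) x \<le> 2 * s"
        if "0 < a" "a < s" "0 < b" "b < s" for a b and k l :: 3
      proof -
        have "norm (a *\<^sub>R axis k 1 + b *\<^sub>R axis l 1 :: real^3) \<le> a + b"
          using that norm_triangle_ineq[of "a *\<^sub>R axis k 1 :: real^3" "b *\<^sub>R axis l 1"]
          by (simp add: norm_axis_1)
        then show ?thesis using that by (simp add: dist_norm add.assoc)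
      qed
      have "s\<^sup>2 * ?a (x + \<sigma> *\<^sub>R axis i 1 + \<tau> *\<^sub>R axis j 1) = s\<^sup>2 * ?b (x + \<sigma>' *\<^sub>R axis j 1 + \<tau>' *\<^sub>R axis i 1)"
        using 1(5) 2(5) by (simp add: algebra_simps)
      with s have "?a (x + \<sigma> *\<^sub>R axis i 1 + \<tau> *\<^sub>R axis j 1) = ?b (x + \<sigma>' *\<^sub>R axis j 1 + \<tau>' *\<^sub>R axis i 1)"
        by simp
      with near 1 2 show ?thesis by blast
    qed
    then have "\<forall>n. \<exists>p q. dist p x \<le> 2 * inverse (real (Suc n)) \<and> dist q x \<le> 2 * inverse (real (Suc n)) \<and> ?a p = ?b q"
      by simp
    then obtain p q where pq: "\<And>n. dist (p n) x \<le> 2 * inverse (real (Suc n))"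
        "\<And>n. dist (q n) x \<le> 2 * inverse (real (Suc n))" "\<And>n. ?a (p n) = ?b (q n)"
      by metis
    have z: "(\<lambda>n. 2 * inverse (real (Suc n))) \<longlonglongrightarrow> 0"
      using tendsto_mult_right_zero[OF LIMSEQ_inverse_real_of_nat] by blast
    have "p \<longlonglongrightarrow> x" "q \<longlonglongrightarrow> x"
      unfolding tendsto_dist_iff[of p] tendsto_dist_iff[of q]
      by (rule tendsto_sandwich[OF _ _ tendsto_const z]; use pq in simp)+
    moreover have cont: "isCont (\<lambda>x. L (partial_deriv k (partial_deriv l f) x)) x" for k l
      using smooth_continuous_on[OF smooth_partial_deriv[OF smooth_partial_deriv[OF f]], of UNIV k l]
      by (intro bounded_linear.isCont[OF L]) (simp add: continuous_on_eq_continuous_at)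
    ultimately have "(\<lambda>n. ?a (p n)) \<longlonglongrightarrow> ?a x" "(\<lambda>n. ?b (q n)) \<longlonglongrightarrow> ?b x"
      using isCont_tendsto_compose[OF cont] by blast+
    with pq(3) show ?thesis using LIMSEQ_unique by simp
  qed
  from this[OF bounded_linear_Re] this[OF bounded_linear_Im] show ?thesis
    by (simp add: complex_eq_iff)
qed


section \<open>Test functions\<close>

definition supported_in :: "real \<Rightarrow> (real^3 \<Rightarrow> 'b::zero) \<Rightarrow> bool" where
  "supported_in R f \<longleftrightarrow> (\<forall>x. norm x > R \<longrightarrow> f x = 0)"

lemma test_function_iff: "test_function \<phi> \<longleftrightarrow> smooth \<phi> \<and> (\<exists>R. supported_in R \<phi>)"
proof -
  have "compact (closure {x. \<phi> x \<noteq> 0}) \<longleftrightarrow> (\<exists>R. supported_in R \<phi>)"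
    unfolding compact_closure bounded_iff supported_in_def
    by (metis (mono_tags, lifting) linorder_not_le mem_Collect_eq)
  then show ?thesis by (simp add: test_function_def smooth_def)
qed

lemma test_function_smooth: "test_function \<phi> \<Longrightarrow> smooth \<phi>"
  by (simp add: test_function_iff)

lemma supported_in_mono: "supported_in R f \<Longrightarrow> R \<le> S \<Longrightarrow> supported_in S f"
  by (auto simp: supported_in_def)

lemma supported_in_partial_deriv:
  assumes "supported_in R f"
  shows "supported_in R (partial_deriv j f)"
  unfolding supported_in_def
proof (intro allI impI)
  fix x :: "real^3" assume x: "norm x > R"
  have "((\<lambda>x. 0) has_derivative (\<lambda>h. 0)) (at x)" by simp
  moreover have "open {x :: real^3. norm x > R}"
    by (intro open_Collect_less continuous_intros)
  ultimately have "(f has_derivative (\<lambda>h. 0)) (at x)"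
    by (rule has_derivative_transform_within_open) (use assms x in \<open>auto simp: supported_in_def\<close>)
  then show "partial_deriv j f x = 0"
    by (simp add: partial_deriv_eqI)
qed

lemma test_function_partial_deriv: "test_function \<phi> \<Longrightarrow> test_function (partial_deriv j \<phi>)"
  using smooth_partial_deriv supported_in_partial_deriv by (meson test_function_iff)

lemma test_function_mult: "test_function \<phi> \<Longrightarrow> smooth f \<Longrightarrow> test_function (\<lambda>x. f x * \<phi> x)"
  by (auto simp: test_function_iff smooth_mult supported_in_def)

lemma test_function_cnj: "test_function \<phi> \<Longrightarrow> test_function (\<lambda>x. cnj (\<phi> x))"
  by (auto simp: test_function_iff smooth_cnj supported_in_def)

lemma test_function_add:
  assumes "test_function \<phi>" "test_function \<psi>"
  shows "test_function (\<lambda>x. \<phi> x + \<psi> x)"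
proof -
  obtain R S where "supported_in R \<phi>" "supported_in S \<psi>"
    using assms by (auto simp: test_function_iff)
  then have "supported_in (max R S) (\<lambda>x. \<phi> x + \<psi> x)"
    by (auto simp: supported_in_def)
  with assms show ?thesis by (auto simp: test_function_iff smooth_add)
qed

lemma test_function_cmult: "test_function \<phi> \<Longrightarrow> test_function (\<lambda>x. c * \<phi> x)"
  by (rule test_function_mult[OF _ smooth_const])

lemma test_function_diff: "test_function \<phi> \<Longrightarrow> test_function \<psi> \<Longrightarrow> test_function (\<lambda>x. \<phi> x - \<psi> x)"
  using test_function_add[OF _ test_function_cmult[of \<psi> "-1"], of \<phi>] by simp

lemma test_function_reflect:
  assumes "test_function \<phi>"
  shows "test_function (\<lambda>x. \<phi> (a - x))"
proof -
  obtain R where "supported_in R \<phi>" using assms by (auto simp: test_function_iff)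
  then have "supported_in (R + norm a) (\<lambda>x. \<phi> (a - x))"
    unfolding supported_in_def by (smt (verit) norm_minus_commute norm_triangle_sub)
  with assms show ?thesis by (auto simp: test_function_iff smooth_reflect)
qed

text \<open>For \<open>k = 0\<close> this is the classical smooth function \<open>exp (-1/t)\<close> on the positive half line that is flat
at \<open>0\<close>. The powers of \<open>1/t\<close> are included because differentiation stays within this family.\<close>

definition flat_exp :: "nat \<Rightarrow> real \<Rightarrow> real" where
  "flat_exp k t = (if t > 0 then (1 / t) ^ k / exp (1 / t) else 0)"

lemma flat_exp_tendsto_0: "(flat_exp k \<longlongrightarrow> 0) (at_right 0)"
proof -
  have "((\<lambda>t. inverse t ^ k / exp (inverse t)) \<longlongrightarrow> (0::real)) (at_right 0)"
    by (rule filterlim_compose[OF tendsto_power_div_exp_0 filterlim_inverse_at_top_right])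
  moreover have "\<forall>\<^sub>F t in at_right 0. inverse t ^ k / exp (inverse t) = flat_exp k t"
    by (auto simp: eventually_at_right_less flat_exp_def divide_inverse
          intro: eventually_mono[OF eventually_at_right_less])
  ultimately show ?thesis by (rule Lim_transform_eventually)
qed

lemma DERIV_flat_exp:
  "(flat_exp k has_real_derivative flat_exp (k + 2) t - real k * flat_exp (k + 1) t) (at t)"
proof -
  consider "t > 0" | "t < 0" | "t = 0" by linarith
  then show ?thesis
  proof cases
    case 1
    have "((\<lambda>t. (1 / t) ^ k / exp (1 / t)) has_real_derivative
        flat_exp (k + 2) t - real k * flat_exp (k + 1) t) (at t)"
    proof -
      define u where "u = 1 / t"
      have p: "((\<lambda>t. 1 / t) has_real_derivative - (u ^ 2)) (at t)"
        using 1 by (auto intro!: derivative_eq_intros simp: u_def power2_eq_square)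
      have e: "((\<lambda>t. exp (1 / t)) has_real_derivative exp u * (- (u ^ 2))) (at t)"
        unfolding u_def by (rule DERIV_chain2[OF DERIV_exp p[unfolded u_def]])
      have "(real k * (- (u ^ 2) * u ^ (k - Suc 0)) * exp u - u ^ k * (exp u * (- (u ^ 2)))) / (exp u * exp u)
          = u ^ (k + 2) / exp u - real k * (u ^ (k + 1) / exp u)"
        by (cases k) (simp_all add: field_simps power2_eq_square)
      with DERIV_divide[OF DERIV_power[OF p, of k] e] 1 show ?thesis
        by (simp add: flat_exp_def u_def)
    qed
    then show ?thesis
      by (rule has_field_derivative_transform_within_open[of _ _ _ "{0<..}"])
        (use 1 in \<open>auto simp: flat_exp_def\<close>)
  next
    case 2
    have "((\<lambda>t. 0) has_real_derivative flat_exp (k + 2) t - real k * flat_exp (k + 1) t) (at t)"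
      using 2 by (simp add: flat_exp_def)
    then show ?thesis
      by (rule has_field_derivative_transform_within_open[of _ _ _ "{..<0}"])
        (use 2 in \<open>auto simp: flat_exp_def\<close>)
  next
    case 3
    have "((\<lambda>h. (flat_exp k (0 + h) - flat_exp k 0) / h) \<longlongrightarrow> 0) (at 0)"
    proof (rule filterlim_split_at)
      show "((\<lambda>h. (flat_exp k (0 + h) - flat_exp k 0) / h) \<longlongrightarrow> 0) (at_left 0)"
        by (rule Lim_transform_eventually[OF tendsto_const])
          (auto simp: eventually_at_filter flat_exp_def)
      show "((\<lambda>h. (flat_exp k (0 + h) - flat_exp k 0) / h) \<longlongrightarrow> 0) (at_right 0)"
        by (rule Lim_transform_eventually[OF flat_exp_tendsto_0[of "Suc k"]])
          (auto simp: eventually_at_filter flat_exp_def)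
    qed
    then show ?thesis using 3 by (simp add: DERIV_def flat_exp_def)
  qed
qed

text \<open>A derivative is a combination of members of the same family with polynomial coefficients, so
induction on the order works when \<open>k\<close> is left arbitrary.\<close>

lemma Ck_flat_exp_comp: "Ck m (\<lambda>x. complex_of_real (flat_exp k (c - x \<bullet> x)))"
proof (induction m arbitrary: k)
  case 0
  have "continuous_on UNIV (flat_exp k)"
    using DERIV_flat_exp DERIV_isCont continuous_at_imp_continuous_on by blast
  then show ?case
    by (auto intro!: continuous_intros continuous_on_compose2[of UNIV "flat_exp k"])
next
  case (Suc m)
  let ?f = "\<lambda>k (x :: real^3). complex_of_real (flat_exp k (c - x \<bullet> x))"
  let ?d = "\<lambda>x :: real^3. flat_exp (k + 2) (c - x \<bullet> x) - real k * flat_exp (k + 1) (c - x \<bullet> x)"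
  have D: "(?f k has_derivative (\<lambda>h. complex_of_real (?d x * (- 2 * (x \<bullet> h))))) (at x)" for x
  proof -
    have "((\<lambda>x. c - x \<bullet> x) has_derivative (\<lambda>h. - 2 * (x \<bullet> h))) (at x)"
      by (auto intro!: derivative_eq_intros simp: inner_commute)
    from has_derivative_compose[OF this DERIV_flat_exp[THEN has_field_derivative_imp_has_derivative]]
    have "((\<lambda>x. flat_exp k (c - x \<bullet> x)) has_derivative (\<lambda>h. ?d x * (- 2 * (x \<bullet> h)))) (at x)" .
    from bounded_linear.has_derivative[OF bounded_linear_of_real this] show ?thesis .
  qed
  have eq: "partial_deriv j (?f k)
      = (\<lambda>x. (?f (k + 2) x + complex_of_real (- real k) * ?f (k + 1) x) * (complex_of_real (- 2) * complex_of_real (x $ j)))" for j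
    by (rule ext) (simp add: partial_deriv_eqI[OF D] inner_axis algebra_simps)
  have "Ck m (partial_deriv j (?f k))" for j
    unfolding eq by (intro Ck_mult Ck_add Ck_const Ck_coordinate Suc.IH)
  moreover have "?f k differentiable (at x)" for x
    using D differentiable_def by blast
  ultimately show ?case by auto
qed


section \<open>Integration of test functions\<close>

lemma integrable_continuous_supported:
  fixes f :: "real^3 \<Rightarrow> 'b::euclidean_space"
  assumes "continuous_on UNIV f" "supported_in R f"
  shows "integrable lebesgue f"
proof -
  have "integrable lborel (\<lambda>x. indicator (cball 0 R) x *\<^sub>R f x)"
    using assms(1) by (intro borel_integrable_compact continuous_on_subset[OF assms(1)]) auto
  also have "(\<lambda>x. indicator (cball 0 R) x *\<^sub>R f x) = f"
    using assms(2) by (auto simp: supported_in_def indicator_def fun_eq_iff)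
  finally show ?thesis
    by (subst integrable_completion) (auto dest: borel_measurable_integrable)
qed

lemma uniformly_continuous_supported:
  fixes f :: "real^3 \<Rightarrow> 'b::real_normed_vector"
  assumes "continuous_on UNIV f" "supported_in R f"
  shows "uniformly_continuous_on UNIV f"
proof -
  have "uniformly_continuous_on (cball 0 (R + 1)) f"
    using assms(1) by (intro compact_uniformly_continuous continuous_on_subset[OF assms(1)]) auto
  then have uc: "\<exists>d>0. \<forall>x\<in>cball 0 (R + 1). \<forall>y\<in>cball 0 (R + 1). dist y x < d \<longrightarrow> dist (f y) (f x) < e"
    if "e > 0" for e
    using that unfolding uniformly_continuous_on_def by blast
  show ?thesis
    unfolding uniformly_continuous_on_def
  proof (intro allI impI)
    fix e :: real assume e: "e > 0"
    from uc[OF e] obtain d where d: "d > 0"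
      "\<And>x y. norm x \<le> R + 1 \<Longrightarrow> norm y \<le> R + 1 \<Longrightarrow> dist y x < d \<Longrightarrow> dist (f y) (f x) < e"
      by auto
    have "dist (f y) (f x) < e" if xy: "dist y x < min d 1" for x y
    proof (cases "norm x \<le> R + 1 \<and> norm y \<le> R + 1")
      case True
      with d xy show ?thesis by auto
    next
      case False
      have "norm x \<le> norm y + dist y x" "norm y \<le> norm x + dist y x"
        unfolding dist_norm using norm_triangle_sub[of x y] norm_triangle_sub[of y x]
        by (simp_all add: norm_minus_commute)
      with False xy have "norm x > R" "norm y > R" by auto
      with assms(2) e show ?thesis by (simp add: supported_in_def)
    qed
    with d(1) show "\<exists>d>0. \<forall>x\<in>UNIV. \<forall>y\<in>UNIV. dist y x < d \<longrightarrow> dist (f y) (f x) < e"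
      by (intro exI[of _ "min d 1"]) auto
  qed
qed

lemma bounded_continuous_supported:
  fixes f :: "real^3 \<Rightarrow> 'b::real_normed_vector"
  assumes "continuous_on UNIV f" "supported_in R f"
  obtains B where "B \<ge> 0" "\<And>x. norm (f x) \<le> B"
proof -
  have "compact (f ` cball 0 R)"
    using assms(1) by (intro compact_continuous_image continuous_on_subset[OF assms(1)]) auto
  then obtain B where B: "B > 0" "\<And>y. y \<in> f ` cball 0 R \<Longrightarrow> norm y \<le> B"
    using compact_imp_bounded bounded_pos by metis
  have "norm (f x) \<le> B" for x
  proof (cases "norm x \<le> R")
    case True with B(2) show ?thesis by auto
  next
    case False with B(1) assms(2) show ?thesis by (auto simp: supported_in_def)
  qed
  then show thesis using B(1) by (intro that[of B]) auto
qed

lemma test_function_supported: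
  assumes "test_function \<phi>"
  obtains R where "R > 0" "supported_in R \<phi>"
proof -
  obtain R where "supported_in R \<phi>" using assms by (auto simp: test_function_iff)
  then have "supported_in (max R 1) \<phi>" by (rule supported_in_mono) simp
  with that[of "max R 1"] show thesis by simp
qed

lemma test_function_continuous: "test_function \<phi> \<Longrightarrow> continuous_on S \<phi>"
  by (simp add: test_function_smooth smooth_continuous_on)

lemma test_function_integrable: "test_function \<phi> \<Longrightarrow> integrable lebesgue \<phi>"
  using test_function_supported integrable_continuous_supported test_function_continuous by meson

lemma continuous_on_imp_borel_measurable_lebesgue:
  fixes f :: "real^3 \<Rightarrow> 'b::topological_space"
  shows "continuous_on UNIV f \<Longrightarrow> f \<in> borel_measurable lebesgue"
  by (intro measurable_completion) (simp add: borel_measurable_continuous_onI)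

text \<open>The bilinear product \<open>p\<close> covers both scalar products of functions and a scalar test function times a
vector field.\<close>

lemma integrable_mult_L1_loc:
  fixes f :: "real^3 \<Rightarrow> 'b::euclidean_space" and \<phi> :: "real^3 \<Rightarrow> complex"
    and p :: "complex \<Rightarrow> 'b \<Rightarrow> 'c::euclidean_space"
  assumes \<phi>: "continuous_on UNIV \<phi>" "supported_in R \<phi>" and f: "L1_loc f"
    and p: "bounded_bilinear p"
  shows "integrable lebesgue (\<lambda>x. p (\<phi> x) (f x))"
proof -
  interpret bounded_bilinear p by (rule p)
  obtain B where B: "B \<ge> 0" "\<And>x. norm (\<phi> x) \<le> B"
    using bounded_continuous_supported[OF \<phi>] by blast
  obtain K where K: "\<And>a b. norm (p a b) \<le> norm a * norm b * K" "K \<ge> 0"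
    using nonneg_bounded by blast
  have int: "integrable lebesgue (\<lambda>x. indicator (cball 0 R) x *\<^sub>R f x)"
    using f unfolding L1_loc_def set_integrable_def by auto
  have [measurable]: "f \<in> borel_measurable lebesgue" "\<phi> \<in> borel_measurable lebesgue"
    using f \<phi>(1) by (auto simp: L1_loc_def continuous_on_imp_borel_measurable_lebesgue)
  have m: "(\<lambda>x. p (\<phi> x) (f x)) \<in> borel_measurable lebesgue"
    by (intro borel_measurable_continuous_Pair[of \<phi> lebesgue f p] continuous_on continuous_intros) auto
  show ?thesis
  proof (rule Bochner_Integration.integrable_bound[OF integrable_mult_right[OF integrable_norm[OF int], of "B * K"] m])
    show "AE x in lebesgue. norm (p (\<phi> x) (f x)) \<le> norm (B * K * norm (indicat_real (cball 0 R) x *\<^sub>R f x))"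
    proof (rule AE_I2)
      fix x :: "real^3"
      show "norm (p (\<phi> x) (f x)) \<le> norm (B * K * norm (indicat_real (cball 0 R) x *\<^sub>R f x))"
      proof (cases "norm x \<le> R")
        case True
        have "norm (p (\<phi> x) (f x)) \<le> norm (\<phi> x) * norm (f x) * K" by (rule K)
        also have "\<dots> \<le> B * norm (f x) * K" using B K by (intro mult_right_mono) auto
        finally show ?thesis using True B K by (simp add: mult_ac)
      next
        case False
        with \<phi>(2) show ?thesis by (simp add: supported_in_def zero_left)
      qed
    qed
  qed
qed

lemma test_function_mult_integrable:
  fixes f :: "real^3 \<Rightarrow> complex"
  assumes "test_function \<phi>" "L1_loc f"
  shows "integrable lebesgue (\<lambda>x. \<phi> x * f x)"
  using assms(1) integrable_mult_L1_loc[OF test_function_continuous[OF assms(1)] _ assms(2) bounded_bilinear_mult]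
  by (auto elim: test_function_supported)

lemma lborel_distr_reflect: "distr lborel borel (\<lambda>y. x - y) = (lborel :: 'a::euclidean_space measure)"
  using lborel_affine[of "-1" x] by (simp add: density_1)

lemma lborel_distr_translate: "distr lborel borel (\<lambda>y. x + y) = (lborel :: 'a::euclidean_space measure)"
  using lborel_affine[of "1" x] by (simp add: density_1)

lemma integral_lebesgue_continuous:
  fixes f :: "real^3 \<Rightarrow> 'b::euclidean_space"
  shows "continuous_on UNIV f \<Longrightarrow> (LINT y|lebesgue. f y) = (LINT y|lborel. f y)"
  by (intro integral_completion) (simp add: borel_measurable_continuous_onI)

lemma integral_reflect:
  fixes f :: "real^3 \<Rightarrow> 'b::euclidean_space"
  assumes "continuous_on UNIV f"
  shows "(LINT y|lebesgue. f (x - y)) = (LINT y|lebesgue. f y)"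
proof -
  have [measurable]: "f \<in> borel_measurable borel" using assms by (rule borel_measurable_continuous_onI)
  have "continuous_on UNIV (\<lambda>y. f (x - y))"
    using assms by (auto intro!: continuous_on_compose2[of UNIV f UNIV "\<lambda>y. x - y"] continuous_intros)
  then show ?thesis
    using integral_distr[of "\<lambda>y. x - y" lborel borel f] lborel_distr_reflect[of x] assms
    by (simp add: integral_lebesgue_continuous)
qed

lemma integral_translate:
  fixes f :: "real^3 \<Rightarrow> 'b::euclidean_space"
  assumes "continuous_on UNIV f"
  shows "(LINT y|lebesgue. f (x + y)) = (LINT y|lebesgue. f y)"
proof -
  have [measurable]: "f \<in> borel_measurable borel" using assms by (rule borel_measurable_continuous_onI)
  have "continuous_on UNIV (\<lambda>y. f (x + y))"
    using assms by (auto intro!: continuous_on_compose2[of UNIV f UNIV "\<lambda>y. x + y"] continuous_intros)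
  then show ?thesis
    using integral_distr[of "\<lambda>y. x + y" lborel borel f] lborel_distr_translate[of x] assms
    by (simp add: integral_lebesgue_continuous)
qed

text \<open>Test functions have uniformly continuous derivatives, which makes the first order remainder small
uniformly in the base point. This permits differentiation under integral signs without any limit
theorem.\<close>

lemma uniform_differentiability:
  assumes \<phi>: "test_function \<phi>" and e: "e > 0"
  obtains d where "d > 0"
    "\<And>x h. norm h < d \<Longrightarrow> norm (\<phi> (x + h) - \<phi> x - (\<Sum>j\<in>UNIV. h $ j *\<^sub>R partial_deriv j \<phi> x)) \<le> e * norm h"
proof -
  let ?D = "\<lambda>x h. \<Sum>j\<in>UNIV. h $ j *\<^sub>R partial_deriv j \<phi> x"
  have "\<exists>d>0. \<forall>x y. dist y x < d \<longrightarrow> dist (partial_deriv j \<phi> y) (partial_deriv j \<phi> x) < e / 3" for j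
  proof -
    have "test_function (partial_deriv j \<phi>)" using \<phi> by (rule test_function_partial_deriv)
    then have "uniformly_continuous_on UNIV (partial_deriv j \<phi>)"
      using test_function_supported uniformly_continuous_supported test_function_continuous by meson
    then show ?thesis using e unfolding uniformly_continuous_on_def by (auto dest!: spec[of _ "e / 3"])
  qed
  then obtain d where d: "\<And>j. d j > 0"
    "\<And>j x y. dist y x < d j \<Longrightarrow> dist (partial_deriv j \<phi> y) (partial_deriv j \<phi> x) < e / 3"
    by metis
  define d0 where "d0 = Min (range d)"
  have d0: "d0 > 0" "d0 \<le> d j" for j
    using d(1) by (auto simp: d0_def)
  have "norm (\<phi> (x + h) - \<phi> x - ?D x h) \<le> e * norm h" if h: "norm h < d0" for x h
  proof -
    have "norm (\<phi> (x + h) - \<phi> x - ?D x ((x + h) - x)) \<le> norm ((x + h) - x) * e"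
    proof (rule differentiable_bound_linearization[of x "x + h" "ball x d0" \<phi> ?D x])
      show "x + t *\<^sub>R ((x + h) - x) \<in> ball x d0" if "t \<in> {0..1}" for t
      proof -
        have "norm (t *\<^sub>R h) \<le> norm h" using that by (simp add: mult_left_le_one_le)
        with h show ?thesis by (simp add: dist_norm)
      qed
      show "(\<phi> has_derivative ?D y) (at y within ball x d0)" for y
        using has_derivative_eq_sum_partial_deriv[OF test_function_smooth[OF \<phi>]]
        by (rule has_derivative_at_withinI)
      show "x \<in> ball x d0" using d0 by simp
      show "onorm (?D y - ?D x) \<le> e" if y: "y \<in> ball x d0" for y
        unfolding fun_diff_def
      proof (rule onorm_le)
        fix v :: "real^3"
        have "?D y v - ?D x v = (\<Sum>j\<in>UNIV. v $ j *\<^sub>R (partial_deriv j \<phi> y - partial_deriv j \<phi> x))"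
          by (simp add: scaleR_diff_right sum_subtractf)
        also have "norm \<dots> \<le> (\<Sum>j\<in>(UNIV::3 set). norm v * (e / 3))"
        proof (rule sum_norm_le)
          fix j :: 3
          have "norm (partial_deriv j \<phi> y - partial_deriv j \<phi> x) \<le> e / 3"
            using d(2)[of y x j] d0(2)[of j] y by (auto simp: dist_norm norm_minus_commute)
          then show "norm (v $ j *\<^sub>R (partial_deriv j \<phi> y - partial_deriv j \<phi> x)) \<le> norm v * (e / 3)"
            using component_le_norm_cart[of v j] by (simp only: norm_scaleR real_norm_def mult_mono abs_ge_zero norm_ge_zero)
        qed
        also have "\<dots> = e * norm v" by simp
        finally show "norm (?D y v - ?D x v) \<le> e * norm v" .
      qed
    qed
    then show ?thesis by (simp add: mult.commute)
  qed
  with d0(1) that show thesis by blast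
qed

lemma norm_integral_le_integral:
  fixes f :: "real^3 \<Rightarrow> complex" and g :: "real^3 \<Rightarrow> real"
  assumes f: "integrable lebesgue f" and g: "integrable lebesgue g" and "\<And>x. norm (f x) \<le> g x"
  shows "norm (LINT x|lebesgue. f x) \<le> (LINT x|lebesgue. g x)"
  by (rule order_trans[OF integral_norm_bound integral_mono]) (use assms in auto)

text \<open>The integral of \<open>\<phi> (x + s e\<^sub>j) - \<phi> x\<close> vanishes by translation
invariance, and it differs from \<open>s\<close> times the integral of the derivative by at most \<open>e s V\<close>, where
\<open>V\<close> is the volume of a ball that contains all supports.\<close>

lemma integral_partial_deriv_eq_0:
  assumes \<phi>: "test_function \<phi>"
  shows "(LINT x|lebesgue. partial_deriv j \<phi> x) = 0"
proof -
  let ?I = "LINT x|lebesgue. partial_deriv j \<phi> x"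
  obtain R where R: "supported_in R \<phi>" using \<phi> by (auto simp: test_function_iff)
  define V where "V = measure lebesgue (cball (0::real^3) (R + 1))"
  have V: "V \<ge> 0" by (simp add: V_def)
  have "norm ?I \<le> e * V" if e: "e > 0" for e
  proof -
    obtain d where d: "d > 0"
      "\<And>x h. norm h < d \<Longrightarrow> norm (\<phi> (x + h) - \<phi> x - (\<Sum>j\<in>UNIV. h $ j *\<^sub>R partial_deriv j \<phi> x)) \<le> e * norm h"
      using uniform_differentiability[OF \<phi> e] by metis
    define s where "s = min (d / 2) (1 / 2)"
    have s: "0 < s" "s < d" "s < 1" using d(1) by (auto simp: s_def)
    let ?h = "s *\<^sub>R axis j 1 :: real^3"
    have nh: "norm ?h = s" using s by (simp add: norm_axis_1)
    have hj: "(\<Sum>i\<in>UNIV. ?h $ i *\<^sub>R partial_deriv i \<phi> x) = s *\<^sub>R partial_deriv j \<phi> x" for x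
    proof -
      have "(\<Sum>i\<in>UNIV. ?h $ i *\<^sub>R partial_deriv i \<phi> x) = (\<Sum>i\<in>UNIV. if i = j then s *\<^sub>R partial_deriv j \<phi> x else 0)"
        by (intro sum.cong) (auto simp: axis_def)
      then show ?thesis by simp
    qed
    have c: "continuous_on UNIV \<phi>" using \<phi> by (rule test_function_continuous)
    have ct: "continuous_on UNIV (\<lambda>x. \<phi> (?h + x))"
      using c by (auto intro!: continuous_on_compose2[of UNIV \<phi> UNIV "\<lambda>y. ?h + y"] continuous_intros)
    have far: "norm (?h + x) > R" "norm x > R" if "norm x > R + 1" for x
      using that s nh norm_triangle_sub[of x "- ?h"] by (auto simp: add.commute)
    have "supported_in (R + 1) (\<lambda>x. \<phi> (?h + x))"
      using R far by (auto simp: supported_in_def)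
    with ct have i1: "integrable lebesgue (\<lambda>x. \<phi> (?h + x))"
      by (rule integrable_continuous_supported)
    have i2: "integrable lebesgue \<phi>" "integrable lebesgue (partial_deriv j \<phi>)"
      using \<phi> by (auto intro: test_function_integrable test_function_partial_deriv)
    have "s * norm ?I = norm (LINT x|lebesgue. \<phi> (?h + x) - \<phi> x - s *\<^sub>R partial_deriv j \<phi> x)"
      using i1 i2 s integral_translate[OF c, of ?h] by simp
    also have "\<dots> \<le> (LINT x :: real^3|lebesgue. e * s * indicator (cball 0 (R + 1)) x)"
    proof (rule norm_integral_le_integral)
      show "norm (\<phi> (?h + x) - \<phi> x - s *\<^sub>R partial_deriv j \<phi> x) \<le> e * s * indicator (cball 0 (R + 1)) x" for x
      proof (cases "norm x \<le> R + 1")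
        case True
        with d(2)[of ?h x] nh s hj show ?thesis by (simp add: add.commute)
      next
        case False
        with far[of x] R supported_in_partial_deriv[OF R, of j] show ?thesis
          by (auto simp: supported_in_def)
      qed
    qed (use i1 i2 in \<open>auto simp flip: lmeasurable_iff_integrable\<close>)
    also have "\<dots> = s * (e * V)" by (simp add: V_def)
    finally show ?thesis using s by simp
  qed
  then have bound: "norm ?I \<le> e * V" if "e > 0" for e using that by blast
  have "norm ?I \<le> 0"
  proof (rule field_le_epsilon)
    fix e :: real assume e: "e > 0"
    have "norm ?I \<le> e / (V + 1) * V" using e V by (intro bound) simp
    also have "\<dots> \<le> e" using e V by (simp add: field_simps)
    finally show "norm ?I \<le> 0 + e" by simp
  qed
  then show ?thesis by simp
qed

lemma integration_by_parts:
  assumes \<phi>: "test_function \<phi>" and \<psi>: "smooth \<psi>"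
  shows "(LINT x|lebesgue. partial_deriv j \<phi> x * \<psi> x) = - (LINT x|lebesgue. \<phi> x * partial_deriv j \<psi> x)"
proof -
  have t: "test_function (\<lambda>x. \<phi> x * partial_deriv j \<psi> x)" "test_function (\<lambda>x. partial_deriv j \<phi> x * \<psi> x)"
    using test_function_mult[OF \<phi> smooth_partial_deriv[OF \<psi>], of j]
      test_function_mult[OF test_function_partial_deriv[OF \<phi>] \<psi>] by (simp_all add: mult.commute)
  have "0 = (LINT x|lebesgue. partial_deriv j (\<lambda>x. \<phi> x * \<psi> x) x)"
    using integral_partial_deriv_eq_0[OF test_function_mult[OF \<phi> \<psi>], of j] by (simp add: mult.commute)
  also have "\<dots> = (LINT x|lebesgue. \<phi> x * partial_deriv j \<psi> x + partial_deriv j \<phi> x * \<psi> x)"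
    using \<phi> \<psi> by (simp add: partial_deriv_mult smooth_differentiable test_function_smooth)
  also have "\<dots> = (LINT x|lebesgue. \<phi> x * partial_deriv j \<psi> x) + (LINT x|lebesgue. partial_deriv j \<phi> x * \<psi> x)"
    using t by (intro Bochner_Integration.integral_add test_function_integrable)
  finally show ?thesis by (simp add: eq_neg_iff_add_eq_0 add.commute)
qed


section \<open>Mollification\<close>

definition conv :: "(real^3 \<Rightarrow> complex) \<Rightarrow> (real^3 \<Rightarrow> complex) \<Rightarrow> real^3 \<Rightarrow> complex" where
  "conv \<rho> f x = (LINT y|lebesgue. \<rho> (x - y) * f y)"

lemma conv_integrable:
  assumes "test_function \<rho>" "L1_loc f"
  shows "integrable lebesgue (\<lambda>y. \<rho> (x - y) * f y)"
  using test_function_mult_integrable[OF test_function_reflect[OF assms(1)] assms(2)] .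

lemma L1_loc_integrable_norm:
  fixes f :: "real^3 \<Rightarrow> 'b::euclidean_space"
  assumes "L1_loc f"
  shows "integrable lebesgue (\<lambda>x. indicator (cball 0 R) x * norm (f x))"
proof -
  have "integrable lebesgue (\<lambda>x. indicator (cball 0 R) x *\<^sub>R f x)"
    using assms unfolding L1_loc_def set_integrable_def by auto
  from integrable_norm[OF this] show ?thesis by simp
qed

text \<open>Only the smooth factor depends on \<open>x\<close>, so the remainder is the convolution of \<open>f\<close> with the first
order remainder of \<open>\<rho>\<close>, which is uniformly small and vanishes off a ball.\<close>

lemma conv_has_derivative:
  assumes \<rho>: "test_function \<rho>" and f: "L1_loc f"
  shows "(conv \<rho> f has_derivative (\<lambda>h. \<Sum>j\<in>UNIV. h $ j *\<^sub>R conv (partial_deriv j \<rho>) f x)) (at x)"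
  unfolding has_derivative_at_alt
proof (intro conjI allI impI)
  show "bounded_linear (\<lambda>h. \<Sum>j\<in>UNIV. h $ j *\<^sub>R conv (partial_deriv j \<rho>) f x)"
    by (intro bounded_linear_sum bounded_linear_scaleR_left[THEN bounded_linear_compose] bounded_linear_vec_nth)
next
  fix e :: real assume e: "e > 0"
  obtain R where R: "R > 0" "supported_in R \<rho>" using \<rho> by (rule test_function_supported)
  \<comment> \<open>For \<open>x'\<close> within distance \<open>1\<close> of \<open>x\<close>, the integrands vanish outside the ball of radius \<open>S\<close>.\<close>
  define S where "S = norm x + R + 1"
  define M where "M = (LINT y|lebesgue. indicator (cball 0 S) y * norm (f y))"
  have M: "M \<ge> 0" unfolding M_def by (intro integral_nonneg_AE) auto
  define e' where "e' = e / (M + 1)"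
  have e': "e' > 0" "e' * M \<le> e" using e M by (auto simp: e'_def field_simps)
  obtain d where d: "d > 0"
    "\<And>x h. norm h < d \<Longrightarrow> norm (\<rho> (x + h) - \<rho> x - (\<Sum>j\<in>UNIV. h $ j *\<^sub>R partial_deriv j \<rho> x)) \<le> e' * norm h"
    using uniform_differentiability[OF \<rho> e'(1)] by metis
  have "norm (conv \<rho> f x' - conv \<rho> f x - (\<Sum>j\<in>UNIV. (x' - x) $ j *\<^sub>R conv (partial_deriv j \<rho>) f x)) \<le> e * norm (x' - x)"
    if x': "norm (x' - x) < min d 1" for x'
  proof -
    define h where "h = x' - x"
    let ?q = "\<lambda>y. \<rho> (x' - y) - \<rho> (x - y) - (\<Sum>j\<in>UNIV. h $ j *\<^sub>R partial_deriv j \<rho> (x - y))"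
    have i: "integrable lebesgue (\<lambda>y. \<rho> (x' - y) * f y)" "integrable lebesgue (\<lambda>y. \<rho> (x - y) * f y)"
       "\<And>j. integrable lebesgue (\<lambda>y. h $ j *\<^sub>R (partial_deriv j \<rho> (x - y) * f y))"
      using \<rho> f by (auto intro!: conv_integrable test_function_partial_deriv)
    have q: "?q y * f y = \<rho> (x' - y) * f y - \<rho> (x - y) * f y - (\<Sum>j\<in>UNIV. h $ j *\<^sub>R (partial_deriv j \<rho> (x - y) * f y))" for y
      by (simp add: left_diff_distrib sum_distrib_right)
    have "norm (LINT y|lebesgue. ?q y * f y) \<le> (LINT y|lebesgue. e' * norm h * (indicator (cball 0 S) y * norm (f y)))"
    proof (rule norm_integral_le_integral)
      show "integrable lebesgue (\<lambda>y. ?q y * f y)"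
        unfolding q using i by (intro Bochner_Integration.integrable_diff Bochner_Integration.integrable_sum) auto
      show "integrable lebesgue (\<lambda>y. e' * norm h * (indicator (cball 0 S) y * norm (f y)))"
        using L1_loc_integrable_norm[OF f] by (rule integrable_mult_right)
      show "norm (?q y * f y) \<le> e' * norm h * (indicator (cball 0 S) y * norm (f y))" for y
      proof (cases "norm y \<le> S")
        case True
        have "norm (?q y) \<le> e' * norm h"
          using d(2)[of h "x - y"] x' by (simp add: h_def algebra_simps)
        with True show ?thesis by (simp add: norm_mult mult_right_mono flip: mult.assoc)
      next
        case False
        then have "norm (x - y) > R" "norm (x' - y) > R"
          using x' norm_triangle_sub[of y x] norm_triangle_sub[of y x'] norm_triangle_sub[of x' x]
          by (auto simp: S_def norm_minus_commute)
        with R(2) supported_in_partial_deriv[OF R(2)] have "?q y = 0"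
          by (simp add: supported_in_def)
        with False show ?thesis by simp
      qed
    qed
    also have "(LINT y|lebesgue. ?q y * f y)
        = conv \<rho> f x' - conv \<rho> f x - (\<Sum>j\<in>UNIV. h $ j *\<^sub>R conv (partial_deriv j \<rho>) f x)"
    proof -
      have "(LINT y|lebesgue. (\<Sum>j\<in>UNIV. h $ j *\<^sub>R (partial_deriv j \<rho> (x - y) * f y)))
          = (\<Sum>j\<in>UNIV. h $ j *\<^sub>R conv (partial_deriv j \<rho>) f x)"
        using i(3) by (subst Bochner_Integration.integral_sum) (auto simp: conv_def)
      moreover have "integrable lebesgue (\<lambda>y. \<Sum>j\<in>UNIV. h $ j *\<^sub>R (partial_deriv j \<rho> (x - y) * f y))"
        using i(3) by (intro Bochner_Integration.integrable_sum) auto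
      ultimately show ?thesis unfolding q using i(1,2) by (simp add: conv_def)
    qed
    also have "(LINT y|lebesgue. e' * norm h * (indicator (cball 0 S) y * norm (f y))) = e' * M * norm h"
      by (simp add: M_def)
    also have "\<dots> \<le> e * norm h" using e'(2) by (rule mult_right_mono) simp
    finally show ?thesis by (simp add: h_def)
  qed
  with d(1) show "\<exists>d>0. \<forall>x'. norm (x' - x) < d \<longrightarrow>
      norm (conv \<rho> f x' - conv \<rho> f x - (\<Sum>j\<in>UNIV. (x' - x) $ j *\<^sub>R conv (partial_deriv j \<rho>) f x)) \<le> e * norm (x' - x)"
    by (intro exI[of _ "min d 1"]) auto
qed

lemma partial_deriv_conv:
  assumes "test_function \<rho>" "L1_loc f"
  shows "partial_deriv j (conv \<rho> f) = conv (partial_deriv j \<rho>) f"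
proof
  fix x
  have "(\<Sum>i\<in>UNIV. axis j 1 $ i *\<^sub>R conv (partial_deriv i \<rho>) f x)
      = (\<Sum>i\<in>UNIV. if i = j then conv (partial_deriv j \<rho>) f x else 0)"
    by (intro sum.cong) (auto simp: axis_def)
  then show "partial_deriv j (conv \<rho> f) x = conv (partial_deriv j \<rho>) f x"
    using partial_deriv_eqI[OF conv_has_derivative[OF assms], of j x] by simp
qed

lemma smooth_conv:
  assumes "test_function \<rho>" "L1_loc f"
  shows "smooth (conv \<rho> f)"
proof -
  have "Ck k (conv \<rho> f)" for k
    using assms(1)
  proof (induction k arbitrary: \<rho>)
    case 0
    then show ?case
      using has_derivative_continuous[OF conv_has_derivative[OF 0 assms(2)]]
      by (simp add: continuous_on_eq_continuous_at)
  next
    case (Suc k)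
    have "conv \<rho> f differentiable (at x)" for x
      using conv_has_derivative[OF Suc.prems assms(2)] by (auto simp: differentiable_def)
    with Suc assms(2) show ?case
      by (simp add: partial_deriv_conv test_function_partial_deriv)
  qed
  then show ?thesis by (simp add: smooth_def)
qed

lemma supported_in_conv:
  assumes "supported_in R \<rho>" "supported_in S f"
  shows "supported_in (R + S) (conv \<rho> f)"
  unfolding supported_in_def
proof (intro allI impI)
  fix x :: "real^3" assume x: "norm x > R + S"
  have zero: "\<rho> (x - y) * f y = 0" for y
  proof -
    have "norm x \<le> norm y + norm (x - y)" by (rule norm_triangle_sub)
    with x have "norm (x - y) > R \<or> norm y > S" by linarith
    with assms show ?thesis by (auto simp: supported_in_def)
  qed
  show "conv \<rho> f x = 0" unfolding conv_def zero by simp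
qed

lemma test_function_conv:
  assumes "test_function \<rho>" "L1_loc f" "supported_in S f"
  shows "test_function (conv \<rho> f)"
proof -
  obtain R where "supported_in R \<rho>" using assms(1) by (rule test_function_supported)
  then show ?thesis
    using smooth_conv[OF assms(1,2)] supported_in_conv[OF _ assms(3)] unfolding test_function_iff by blast
qed

lemma conv_diff_right:
  assumes "test_function \<rho>" "L1_loc f" "L1_loc g"
  shows "conv \<rho> (\<lambda>x. f x - g x) x = conv \<rho> f x - conv \<rho> g x"
  using conv_integrable[OF assms(1,2)] conv_integrable[OF assms(1,3)]
  by (simp add: conv_def right_diff_distrib)

lemma conv_diff_left:
  assumes "test_function \<rho>" "test_function \<sigma>" "L1_loc f"
  shows "conv (\<lambda>x. \<rho> x - \<sigma> x) f x = conv \<rho> f x - conv \<sigma> f x"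
  using conv_integrable[OF assms(1,3)] conv_integrable[OF assms(2,3)]
  by (simp add: conv_def left_diff_distrib)

text \<open>Mollifiers are complex valued so that they are themselves test functions; the values are required to
be real and nonnegative.\<close>

definition mollifier :: "real \<Rightarrow> (real^3 \<Rightarrow> complex) \<Rightarrow> bool" where
  "mollifier r \<rho> \<longleftrightarrow> test_function \<rho> \<and> supported_in r \<rho> \<and>
     (\<forall>x. \<rho> x \<in> \<real> \<and> Re (\<rho> x) \<ge> 0) \<and> (LINT x|lebesgue. \<rho> x) = 1"

lemma mollifier_exists:
  assumes "r > 0"
  shows "\<exists>\<rho>. mollifier r \<rho>"
proof -
  define g where "g x = flat_exp 0 (r\<^sup>2 - x \<bullet> x)" for x :: "real^3"
  have pos_iff: "g x > 0 \<longleftrightarrow> norm x < r" for x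
    using assms by (simp add: g_def flat_exp_def norm_lt_square)
  have nonneg: "g x \<ge> 0" for x by (simp add: g_def flat_exp_def)
  have supp: "supported_in r (\<lambda>x. complex_of_real (g x))"
    unfolding supported_in_def using pos_iff nonneg
    by (metis of_real_0 order_less_asym order_less_le)
  have test: "test_function (\<lambda>x. complex_of_real (g x))"
    using supp Ck_flat_exp_comp[of _ 0 "r\<^sup>2"] by (auto simp: test_function_iff smooth_def g_def)
  have int: "integrable lebesgue g"
    using integrable_Re[OF test_function_integrable[OF test]] by simp
  define c where "c = (LINT x|lebesgue. g x)"
  have "c \<noteq> 0"
  proof
    assume "c = 0"
    then have "AE x in lebesgue. g x = 0"
      using integral_nonneg_eq_0_iff_AE[OF int] nonneg by (simp add: c_def)
    then have "AE x in lebesgue. x \<notin> ball (0 :: real^3) r"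
      by eventually_elim (simp flip: pos_iff)
    then have "emeasure lebesgue (ball (0 :: real^3) r) = 0"
      by (subst (asm) AE_iff_measurable[OF _ refl]) (auto simp: ball_def)
    then show False
      using assms content_ball_pos[of r "0 :: real^3"] by (simp add: measure_def)
  qed
  moreover have "c \<ge> 0" unfolding c_def by (intro integral_nonneg_AE) (simp add: nonneg)
  ultimately have c: "c > 0" by simp
  have "mollifier r (\<lambda>x. complex_of_real (1 / c) * complex_of_real (g x))"
    unfolding mollifier_def
  proof (intro conjI allI)
    show "test_function (\<lambda>x. complex_of_real (1 / c) * complex_of_real (g x))"
      by (rule test_function_cmult[OF test])
    show "supported_in r (\<lambda>x. complex_of_real (1 / c) * complex_of_real (g x))"
      using supp by (auto simp: supported_in_def)
    show "(LINT x|lebesgue. complex_of_real (1 / c) * complex_of_real (g x)) = 1"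
      using c by (simp add: c_def)
  qed (use c nonneg in \<open>auto simp flip: of_real_mult\<close>)
  then show ?thesis by blast
qed

lemma mollifier_test_function: "mollifier r \<rho> \<Longrightarrow> test_function \<rho>"
  by (simp add: mollifier_def)

lemma mollifier_of_Re: "mollifier r \<rho> \<Longrightarrow> complex_of_real (Re (\<rho> x)) = \<rho> x"
  by (simp add: mollifier_def complex_is_Real_iff complex_eq_iff)

lemma mollifier_Re_integral: "mollifier r \<rho> \<Longrightarrow> (LINT x|lebesgue. Re (\<rho> x)) = 1"
  using integral_Re[of lebesgue \<rho>] test_function_integrable[of \<rho>] by (simp add: mollifier_def)

lemma mollifier_reflect_integral:
  assumes "mollifier r \<rho>"
  shows "(LINT y|lebesgue. \<rho> (x - y)) = 1"
  using assms integral_reflect[OF test_function_continuous[OF mollifier_test_function[OF assms]], of x]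
  by (simp add: mollifier_def)


section \<open>Square integrable functions\<close>

text \<open>Distances in \<open>L\<^sup>2\<close> are measured below by the integral of the squared norm
of the difference, which saves the square roots of the \<open>L\<^sup>2\<close> norm at the price of a factor \<open>2\<close> in the
triangle inequality.\<close>

definition square_integrable :: "(real^3 \<Rightarrow> 'b::euclidean_space) \<Rightarrow> bool" where
  "square_integrable f \<longleftrightarrow> f \<in> borel_measurable lebesgue \<and> integrable lebesgue (\<lambda>x. (norm (f x))\<^sup>2)"

lemma norm_add_square_le: "(norm (a + b))\<^sup>2 \<le> 2 * (norm a)\<^sup>2 + 2 * (norm b)\<^sup>2"
  for a b :: "'b::real_normed_vector"
proof -
  have "(norm (a + b))\<^sup>2 \<le> (norm a + norm b)\<^sup>2"
    by (intro power_mono norm_triangle_ineq) simp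
  also have "\<dots> \<le> 2 * (norm a)\<^sup>2 + 2 * (norm b)\<^sup>2"
    using sum_squares_bound[of "norm a" "norm b"] by (simp add: power2_sum)
  finally show ?thesis .
qed

lemma square_integrableI_bound:
  fixes f :: "real^3 \<Rightarrow> 'b::euclidean_space"
  assumes "f \<in> borel_measurable lebesgue" "integrable lebesgue g"
    and "AE x in lebesgue. (norm (f x))\<^sup>2 \<le> g x"
  shows "square_integrable f"
  unfolding square_integrable_def
proof
  have [measurable]: "f \<in> borel_measurable lebesgue" by fact
  show "integrable lebesgue (\<lambda>x. (norm (f x))\<^sup>2)"
    by (rule Bochner_Integration.integrable_bound[OF assms(2)])
      (use assms(3) in \<open>auto elim: eventually_mono\<close>)
qed fact

lemma square_integrable_add:
  assumes "square_integrable f" "square_integrable g"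
  shows "square_integrable (\<lambda>x. f x + g x)"
    and "(LINT x|lebesgue. (norm (f x + g x))\<^sup>2)
      \<le> 2 * (LINT x|lebesgue. (norm (f x))\<^sup>2) + 2 * (LINT x|lebesgue. (norm (g x))\<^sup>2)"
proof -
  let ?b = "\<lambda>x. 2 * (norm (f x))\<^sup>2 + 2 * (norm (g x))\<^sup>2"
  have b: "integrable lebesgue ?b" using assms by (simp add: square_integrable_def)
  show s: "square_integrable (\<lambda>x. f x + g x)"
    using assms norm_add_square_le
    by (intro square_integrableI_bound[OF _ b]) (auto simp: square_integrable_def)
  have "(LINT x|lebesgue. (norm (f x + g x))\<^sup>2) \<le> (LINT x|lebesgue. ?b x)"
    using s b norm_add_square_le by (intro integral_mono) (auto simp: square_integrable_def)
  then show "(LINT x|lebesgue. (norm (f x + g x))\<^sup>2)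
      \<le> 2 * (LINT x|lebesgue. (norm (f x))\<^sup>2) + 2 * (LINT x|lebesgue. (norm (g x))\<^sup>2)"
    using assms by (simp add: square_integrable_def)
qed

lemma square_integrable_uminus: "square_integrable f \<Longrightarrow> square_integrable (\<lambda>x. - f x)"
  by (auto simp: square_integrable_def)

lemma square_integrable_diff:
  assumes "square_integrable f" "square_integrable g"
  shows "square_integrable (\<lambda>x. f x - g x)"
    and "(LINT x|lebesgue. (norm (f x - g x))\<^sup>2)
      \<le> 2 * (LINT x|lebesgue. (norm (f x))\<^sup>2) + 2 * (LINT x|lebesgue. (norm (g x))\<^sup>2)"
  using square_integrable_add[OF assms(1) square_integrable_uminus[OF assms(2)]] by auto

lemma square_integrable_dist_triangle:
  assumes "square_integrable f" "square_integrable g" "square_integrable h"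
  shows "(LINT x|lebesgue. (norm (f x - h x))\<^sup>2)
      \<le> 2 * (LINT x|lebesgue. (norm (f x - g x))\<^sup>2) + 2 * (LINT x|lebesgue. (norm (g x - h x))\<^sup>2)"
  using square_integrable_add(2)[OF square_integrable_diff(1)[OF assms(1,2)] square_integrable_diff(1)[OF assms(2,3)]]
  by simp

lemma L2_loc_imp_L1_loc:
  fixes f :: "real^3 \<Rightarrow> 'b::euclidean_space"
  assumes "L2_loc f"
  shows "L1_loc f"
  unfolding L1_loc_def
proof (intro conjI allI impI)
  show [measurable]: "f \<in> borel_measurable lebesgue" using assms by (simp add: L2_loc_def)
  fix K :: "(real^3) set" assume K: "compact K"
  have [measurable]: "K \<in> sets lebesgue" using K by (simp add: lmeasurable_compact fmeasurableD)
  have "integrable lebesgue (\<lambda>x. indicat_real K x + indicat_real K x *\<^sub>R (norm (f x))\<^sup>2)"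
    using assms K unfolding L2_loc_def set_integrable_def
    by (intro Bochner_Integration.integrable_add) (auto simp flip: lmeasurable_iff_integrable intro: lmeasurable_compact)
  then show "set_integrable lebesgue K f"
    unfolding set_integrable_def
  proof (rule Bochner_Integration.integrable_bound)
    have "norm (f x) \<le> 1 + (norm (f x))\<^sup>2" for x
    proof -
      have "2 * norm (f x) \<le> (norm (f x))\<^sup>2 + 1" using sum_squares_bound[of "norm (f x)" 1] by simp
      then show ?thesis using norm_ge_zero[of "f x"] by linarith
    qed
    then show "AE x in lebesgue. norm (indicat_real K x *\<^sub>R f x)
        \<le> norm (indicat_real K x + indicat_real K x *\<^sub>R (norm (f x))\<^sup>2)"
      by (auto simp: indicator_def)
  qed measurable
qed

lemma square_integrable_imp_L2_loc:
  fixes f :: "real^3 \<Rightarrow> 'b::euclidean_space"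
  shows "square_integrable f \<Longrightarrow> L2_loc f"
  unfolding square_integrable_def L2_loc_def set_integrable_def
  by (intro conjI allI impI integrable_mult_indicator) (auto simp: lmeasurable_compact fmeasurableD)

lemma square_integrable_imp_L1_loc:
  fixes f :: "real^3 \<Rightarrow> 'b::euclidean_space"
  shows "square_integrable f \<Longrightarrow> L1_loc f"
  by (intro L2_loc_imp_L1_loc square_integrable_imp_L2_loc)

lemma square_integrable_continuous_supported:
  fixes f :: "real^3 \<Rightarrow> 'b::euclidean_space"
  assumes "continuous_on UNIV f" "supported_in R f"
  shows "square_integrable f"
  unfolding square_integrable_def
  using assms continuous_on_imp_borel_measurable_lebesgue
  by (auto intro!: integrable_continuous_supported[of _ R] continuous_intros simp: supported_in_def)

lemma square_integrable_test_function: "test_function \<phi> \<Longrightarrow> square_integrable \<phi>"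
  by (meson square_integrable_continuous_supported test_function_continuous test_function_supported)

interpretation lebesgue: sigma_finite_measure "lebesgue :: (real^3) measure"
proof
  obtain A :: "(real^3) set set" where "countable A" "A \<subseteq> sets lborel" "\<Union> A = space lborel" "\<forall>a\<in>A. emeasure lborel a \<noteq> \<infinity>"
    using lborel.sigma_finite_countable by blast
  then show "\<exists>A::(real^3) set set. countable A \<and> A \<subseteq> sets lebesgue \<and> \<Union> A = space lebesgue \<and> (\<forall>a\<in>A. emeasure lebesgue a \<noteq> \<infinity>)"
    by (intro exI[of _ A]) (auto intro: sets_completionI_sets)
qed

interpretation lebesgue_pair: pair_sigma_finite "lebesgue :: (real^3) measure" "lebesgue :: (real^3) measure" ..

text \<open>Since \<open>\<rho> (x - y) dy\<close> is a probability measure, \<open>w = (\<rho> * f) x\<close> is a mean of \<open>f\<close>, and the bound is the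
nonnegativity of the variance \<open>\<integral>\<rho> (x - y) |f y - w|\<^sup>2 dy\<close>.\<close>

lemma conv_norm_square_le:
  assumes \<rho>: "mollifier r \<rho>" and f: "square_integrable f"
  shows "(norm (conv \<rho> f x))\<^sup>2 \<le> (LINT y|lebesgue. Re (\<rho> (x - y)) * (norm (f y))\<^sup>2)"
    and "integrable lebesgue (\<lambda>y. Re (\<rho> (x - y)) * (norm (f y))\<^sup>2)"
proof -
  have test: "test_function \<rho>" using \<rho> by (rule mollifier_test_function)
  have f2: "L1_loc (\<lambda>y. complex_of_real ((norm (f y))\<^sup>2))"
    using f unfolding square_integrable_def L1_loc_def set_integrable_def
    by (intro conjI allI impI integrable_mult_indicator integrable_of_real)
      (auto simp: lmeasurable_compact fmeasurableD simp flip: of_real_power)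
  define w where "w = conv \<rho> f x"
  let ?r = "\<lambda>y. \<rho> (x - y)"
  have real_r: "cnj (?r y) = ?r y" for y using \<rho> by (simp add: mollifier_def Reals_cnj_iff)
  have i2: "integrable lebesgue (\<lambda>y. ?r y * complex_of_real ((norm (f y))\<^sup>2))"
    by (rule conv_integrable[OF test f2])
  have re: "Re (?r y * complex_of_real c) = Re (?r y) * c" for y c by simp
  show i2r: "integrable lebesgue (\<lambda>y. Re (?r y) * (norm (f y))\<^sup>2)"
    using integrable_Re[OF i2] by (simp only: re)
  have i1: "integrable lebesgue (\<lambda>y. ?r y * f y)"
    by (rule conv_integrable[OF test square_integrable_imp_L1_loc[OF f]])
  have i1c: "integrable lebesgue (\<lambda>y. cnj (?r y * f y))" using i1 by (rule integrable_cnj)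
  have i0: "integrable lebesgue ?r"
    using test_function_reflect[OF test] by (rule test_function_integrable)
  have expand: "?r y * complex_of_real ((norm (f y - w))\<^sup>2)
      = ?r y * complex_of_real ((norm (f y))\<^sup>2) - cnj w * (?r y * f y) - w * cnj (?r y * f y) + w * cnj w * ?r y" for y
    unfolding complex_norm_square by (simp add: real_r algebra_simps)
  have "(LINT y|lebesgue. ?r y * complex_of_real ((norm (f y - w))\<^sup>2))
      = (LINT y|lebesgue. ?r y * complex_of_real ((norm (f y))\<^sup>2)) - cnj w * w - w * cnj w + w * cnj w * 1"
    unfolding expand
    using i2 i1 i1c i0 mollifier_reflect_integral[OF \<rho>, of x]
    by (simp del: complex_cnj_mult add: w_def conv_def)
  then have eq: "(LINT y|lebesgue. ?r y * complex_of_real ((norm (f y - w))\<^sup>2))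
      = (LINT y|lebesgue. ?r y * complex_of_real ((norm (f y))\<^sup>2)) - complex_of_real ((norm w)\<^sup>2)"
    unfolding complex_norm_square by simp
  have i3: "integrable lebesgue (\<lambda>y. ?r y * complex_of_real ((norm (f y - w))\<^sup>2))"
    unfolding expand using i2 i1 i1c i0 by (simp del: complex_cnj_mult)
  have "0 \<le> (LINT y|lebesgue. Re (?r y * complex_of_real ((norm (f y - w))\<^sup>2)))"
    using \<rho> by (intro integral_nonneg_AE) (simp add: re mollifier_def del: of_real_power)
  also have "\<dots> = Re (LINT y|lebesgue. ?r y * complex_of_real ((norm (f y - w))\<^sup>2))"
    using integral_Re[OF i3] by simp
  also have "\<dots> = (LINT y|lebesgue. Re (?r y) * (norm (f y))\<^sup>2) - (norm w)\<^sup>2"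
    unfolding eq using integral_Re[OF i2] by (simp del: of_real_power)
  finally show "(norm (conv \<rho> f x))\<^sup>2 \<le> (LINT y|lebesgue. Re (\<rho> (x - y)) * (norm (f y))\<^sup>2)"
    by (simp add: w_def)
qed

lemma mollifier_nn_integral:
  assumes "mollifier r \<rho>"
  shows "(\<integral>\<^sup>+x. ennreal (Re (\<rho> (x - y))) \<partial>lebesgue) = 1"
proof -
  have c: "continuous_on UNIV \<rho>"
    using assms by (intro test_function_continuous mollifier_test_function)
  have [measurable]: "(\<lambda>x. ennreal (Re (\<rho> x))) \<in> borel_measurable borel"
    using borel_measurable_continuous_onI[OF c] by measurable
  have "(\<integral>\<^sup>+x. ennreal (Re (\<rho> (x - y))) \<partial>lebesgue) = (\<integral>\<^sup>+x. ennreal (Re (\<rho> x)) \<partial>lebesgue)"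
    using nn_integral_distr[of "\<lambda>x. - y + x" lborel borel "\<lambda>x. ennreal (Re (\<rho> x))"] lborel_distr_translate[of "- y"]
    by (simp add: nn_integral_completion)
  also have "\<dots> = ennreal (LINT x|lebesgue. Re (\<rho> x))"
    using assms test_function_integrable[OF mollifier_test_function[OF assms]]
    by (intro nn_integral_eq_integral) (auto simp: mollifier_def)
  finally show ?thesis using mollifier_Re_integral[OF assms] by simp
qed

text \<open>Integrate the pointwise bound over \<open>x\<close> and exchange the integrals; the mass of \<open>\<rho>\<close> is one.\<close>

lemma square_integral_conv_le:
  assumes \<rho>: "mollifier r \<rho>" and f: "square_integrable f"
  shows "square_integrable (conv \<rho> f)"
    and "(LINT x|lebesgue. (norm (conv \<rho> f x))\<^sup>2) \<le> (LINT x|lebesgue. (norm (f x))\<^sup>2)"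
proof -
  have test: "test_function \<rho>" using \<rho> by (rule mollifier_test_function)
  have cont: "continuous_on UNIV \<rho>" using test by (rule test_function_continuous)
  have meas: "conv \<rho> f \<in> borel_measurable lebesgue"
    using smooth_conv[OF test square_integrable_imp_L1_loc[OF f]]
    by (intro continuous_on_imp_borel_measurable_lebesgue smooth_continuous_on)
  have [measurable]: "f \<in> borel_measurable lebesgue" using f by (simp add: square_integrable_def)
  have [measurable]: "\<rho> \<in> borel_measurable borel" using cont by (rule borel_measurable_continuous_onI)
  have nonneg: "Re (\<rho> x) \<ge> 0" for x using \<rho> by (simp add: mollifier_def)
  have id: "(\<lambda>x. x) \<in> borel_measurable (lebesgue :: (real^3) measure)"
    by (intro measurable_completion) simp
  have fst_m: "fst \<in> borel_measurable (lebesgue \<Otimes>\<^sub>M lebesgue :: ((real^3) \<times> (real^3)) measure)"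
    by (rule measurable_compose[OF measurable_fst id])
  have snd_m: "snd \<in> borel_measurable (lebesgue \<Otimes>\<^sub>M lebesgue :: ((real^3) \<times> (real^3)) measure)"
    by (rule measurable_compose[OF measurable_snd id])
  have diff_m[measurable]: "(\<lambda>p. fst p - snd p) \<in> borel_measurable (lebesgue \<Otimes>\<^sub>M lebesgue :: ((real^3) \<times> (real^3)) measure)"
    by (rule borel_measurable_diff[OF fst_m snd_m])
  have f_m[measurable]: "(\<lambda>p. f (snd p)) \<in> borel_measurable (lebesgue \<Otimes>\<^sub>M lebesgue :: ((real^3) \<times> (real^3)) measure)"
    by (rule measurable_compose[OF measurable_snd]) measurable
  have joint: "(\<lambda>(x, y). ennreal (Re (\<rho> (x - y))) * ennreal ((norm (f y))\<^sup>2)) \<in> borel_measurable (lebesgue \<Otimes>\<^sub>M lebesgue)"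
  proof -
    have "(\<lambda>p. \<rho> (fst p - snd p)) \<in> borel_measurable (lebesgue \<Otimes>\<^sub>M lebesgue :: ((real^3) \<times> (real^3)) measure)"
      by (rule measurable_compose[OF diff_m]) measurable
    then have "(\<lambda>p. ennreal (Re (\<rho> (fst p - snd p))) * ennreal ((norm (f (snd p)))\<^sup>2)) \<in> borel_measurable (lebesgue \<Otimes>\<^sub>M lebesgue)"
      by measurable
    then show ?thesis by (simp add: case_prod_beta')
  qed
  have "(\<integral>\<^sup>+x. ennreal ((norm (conv \<rho> f x))\<^sup>2) \<partial>lebesgue)
      \<le> (\<integral>\<^sup>+x. (\<integral>\<^sup>+y. ennreal (Re (\<rho> (x - y))) * ennreal ((norm (f y))\<^sup>2) \<partial>lebesgue) \<partial>lebesgue)"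
  proof (rule nn_integral_mono)
    fix x :: "real^3"
    have "ennreal ((norm (conv \<rho> f x))\<^sup>2) \<le> ennreal (LINT y|lebesgue. Re (\<rho> (x - y)) * (norm (f y))\<^sup>2)"
      by (rule ennreal_leI[OF conv_norm_square_le(1)[OF \<rho> f]])
    also have "\<dots> = (\<integral>\<^sup>+y. ennreal (Re (\<rho> (x - y)) * (norm (f y))\<^sup>2) \<partial>lebesgue)"
      using conv_norm_square_le(2)[OF \<rho> f] nonneg by (intro nn_integral_eq_integral[symmetric]) auto
    also have "\<dots> = (\<integral>\<^sup>+y. ennreal (Re (\<rho> (x - y))) * ennreal ((norm (f y))\<^sup>2) \<partial>lebesgue)"
      using nonneg by (simp add: ennreal_mult)
    finally show "ennreal ((norm (conv \<rho> f x))\<^sup>2) \<le> (\<integral>\<^sup>+y. ennreal (Re (\<rho> (x - y))) * ennreal ((norm (f y))\<^sup>2) \<partial>lebesgue)" .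
  qed
  also have "\<dots> = (\<integral>\<^sup>+y. (\<integral>\<^sup>+x. ennreal (Re (\<rho> (x - y))) * ennreal ((norm (f y))\<^sup>2) \<partial>lebesgue) \<partial>lebesgue)"
    using lebesgue_pair.Fubini'[OF joint] by simp
  also have "\<dots> = (\<integral>\<^sup>+y. ennreal ((norm (f y))\<^sup>2) \<partial>lebesgue)"
  proof (rule nn_integral_cong)
    fix y :: "real^3"
    have "(\<lambda>x. \<rho> (x - y)) \<in> borel_measurable lebesgue"
      using cont by (auto intro!: continuous_on_imp_borel_measurable_lebesgue continuous_on_compose2[of UNIV \<rho> UNIV "\<lambda>x. x - y"] continuous_intros)
    then have "(\<lambda>x. ennreal (Re (\<rho> (x - y)))) \<in> borel_measurable lebesgue" by measurable
    then show "(\<integral>\<^sup>+x. ennreal (Re (\<rho> (x - y))) * ennreal ((norm (f y))\<^sup>2) \<partial>lebesgue) = ennreal ((norm (f y))\<^sup>2)"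
      using mollifier_nn_integral[OF \<rho>, of y] by (simp add: nn_integral_multc)
  qed
  also have "\<dots> = ennreal (LINT x|lebesgue. (norm (f x))\<^sup>2)"
    using f by (intro nn_integral_eq_integral) (auto simp: square_integrable_def)
  finally have le: "(\<integral>\<^sup>+x. ennreal ((norm (conv \<rho> f x))\<^sup>2) \<partial>lebesgue) \<le> ennreal (LINT x|lebesgue. (norm (f x))\<^sup>2)" .
  have int: "integrable lebesgue (\<lambda>x. (norm (conv \<rho> f x))\<^sup>2)"
    using meas le by (intro integrableI_bounded) (auto intro: le_less_trans)
  with meas show "square_integrable (conv \<rho> f)" by (simp add: square_integrable_def)
  have "ennreal (LINT x|lebesgue. (norm (conv \<rho> f x))\<^sup>2) \<le> ennreal (LINT x|lebesgue. (norm (f x))\<^sup>2)"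
    using le nn_integral_eq_integral[OF int] by simp
  then show "(LINT x|lebesgue. (norm (conv \<rho> f x))\<^sup>2) \<le> (LINT x|lebesgue. (norm (f x))\<^sup>2)"
    by (subst (asm) ennreal_le_iff) (auto intro: integral_nonneg_AE)
qed


section \<open>Mollifications converge in the square mean\<close>

text \<open>The radial retraction onto the closed disc of radius \<open>c\<close>. It makes functions bounded while keeping
continuous functions continuous.\<close>

definition clip :: "real \<Rightarrow> complex \<Rightarrow> complex" where
  "clip c z = (c / max c (norm z)) *\<^sub>R z"

lemma continuous_on_clip: "c > 0 \<Longrightarrow> continuous_on S (clip c)"
  unfolding clip_def by (intro continuous_intros) auto

lemma norm_clip_le: "c > 0 \<Longrightarrow> norm (clip c z) \<le> c"
  by (auto simp: clip_def max_def field_simps)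

lemma clip_eq: "norm z \<le> c \<Longrightarrow> c > 0 \<Longrightarrow> clip c z = z"
  by (simp add: clip_def max_def)

lemma norm_diff_clip_le: "c > 0 \<Longrightarrow> norm (z - clip c z) \<le> norm z"
proof -
  assume c: "c > 0"
  define t where "t = c / max c (norm z)"
  have t: "0 \<le> t" "t \<le> 1" using c by (auto simp: t_def divide_le_eq_1)
  have "z - clip c z = (1 - t) *\<^sub>R z" by (simp add: clip_def t_def algebra_simps)
  also have "norm \<dots> \<le> norm z" using t by (simp add: mult_left_le_one_le)
  finally show ?thesis .
qed

lemma square_integrable_approx_clip:
  assumes f: "square_integrable f" and e: "e > 0"
  obtains c where "c > 0" "(LINT x|lebesgue. (norm (f x - clip c (f x)))\<^sup>2) < e"
proof -
  have [measurable]: "f \<in> borel_measurable lebesgue" using f by (simp add: square_integrable_def)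
  have [measurable]: "(\<lambda>x. clip c (f x)) \<in> borel_measurable lebesgue" if "c > 0" for c
    using borel_measurable_continuous_onI[OF continuous_on_clip[OF that]] by measurable
  have "(\<lambda>n. LINT x|lebesgue. (norm (f x - clip (real (Suc n)) (f x)))\<^sup>2) \<longlonglongrightarrow> (LINT x|(lebesgue :: (real^3) measure). 0)"
  proof (rule integral_dominated_convergence[where w = "\<lambda>x. (norm (f x))\<^sup>2"])
    show "AE x in lebesgue. (\<lambda>n. (norm (f x - clip (real (Suc n)) (f x)))\<^sup>2) \<longlonglongrightarrow> 0"
    proof (rule AE_I2)
      fix x
      obtain N :: nat where N: "norm (f x) \<le> real N" using real_arch_simple by blast
      have "\<forall>\<^sub>F n in sequentially. (norm (f x - clip (real (Suc n)) (f x)))\<^sup>2 = 0"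
        using eventually_ge_at_top[of N] by eventually_elim (use N in \<open>simp add: clip_eq\<close>)
      then show "(\<lambda>n. (norm (f x - clip (real (Suc n)) (f x)))\<^sup>2) \<longlonglongrightarrow> 0"
        by (rule tendsto_eventually)
    qed
    show "AE x in lebesgue. norm ((norm (f x - clip (real (Suc n)) (f x)))\<^sup>2) \<le> (norm (f x))\<^sup>2" for n
      by (auto intro!: power_mono norm_diff_clip_le)
  qed (use f in \<open>auto simp: square_integrable_def\<close>)
  then have "\<forall>\<^sub>F n in sequentially. (LINT x|lebesgue. (norm (f x - clip (real (Suc n)) (f x)))\<^sup>2) < e"
    using e by (simp add: order_tendstoD)
  then obtain n where "(LINT x|lebesgue. (norm (f x - clip (real (Suc n)) (f x)))\<^sup>2) < e"
    by (auto dest: eventually_happens)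
  then show thesis by (intro that[of "real (Suc n)"]) auto
qed

text \<open>A measurable function is an almost everywhere limit of continuous functions \<open>h n\<close>. After clipping
\<open>f\<close> to a bounded function, clipping the \<open>h n\<close> at the same level and cutting them off by \<open>\<eta>\<close> gives a
majorant, so that dominated convergence applies.\<close>

lemma square_integrable_approx_continuous:
  fixes f :: "real^3 \<Rightarrow> complex"
  assumes f: "square_integrable f" and supp: "supported_in R f" and e: "e > 0"
  obtains g where "continuous_on UNIV g" "supported_in (R + 1) g"
    "(LINT x|lebesgue. (norm (f x - g x))\<^sup>2) < (e :: real)"
proof -
  have fm[measurable]: "f \<in> borel_measurable lebesgue" using f by (simp add: square_integrable_def)
  obtain c where c: "c > 0" "(LINT x|lebesgue. (norm (f x - clip c (f x)))\<^sup>2) < e / 4"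
    using square_integrable_approx_clip[OF f, of "e / 4"] e by auto
  define fc where "fc x = clip c (f x)" for x
  have clip_m[measurable]: "clip c \<in> borel_measurable borel"
    using continuous_on_clip[OF c(1)] by (rule borel_measurable_continuous_onI)
  have fc_m[measurable]: "fc \<in> borel_measurable lebesgue" unfolding fc_def by measurable
  have "f measurable_on UNIV"
    using fm by (simp add: measurable_on_iff_borel_measurable lebesgue_on_UNIV_eq)
  then obtain N h where N: "negligible N" and h: "\<And>n. continuous_on UNIV (h n)"
    and lim: "\<And>x. x \<notin> N \<Longrightarrow> (\<lambda>n. h n x) \<longlonglongrightarrow> f x"
    unfolding measurable_on_def by auto
  define \<eta> :: "real^3 \<Rightarrow> real" where "\<eta> x = max 0 (min 1 (R + 1 - norm x))" for x
  define g where "g n x = \<eta> x *\<^sub>R clip c (h n x)" for n x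
  have \<eta>: "0 \<le> \<eta> x" "\<eta> x \<le> 1" "norm x \<le> R \<Longrightarrow> \<eta> x = 1" "norm x > R + 1 \<Longrightarrow> \<eta> x = 0" for x
    by (auto simp: \<eta>_def)
  have cont: "continuous_on UNIV (g n)" for n
    unfolding g_def \<eta>_def
    by (intro continuous_intros continuous_on_compose2[OF continuous_on_clip[OF c(1), of UNIV] h]) auto
  have gs: "supported_in (R + 1) (g n)" for n
    using \<eta>(4) by (auto simp: supported_in_def g_def)
  have fc_eq: "\<eta> x *\<^sub>R fc x = fc x" for x
    using supp \<eta>(3) by (cases "norm x \<le> R") (auto simp: supported_in_def fc_def clip_def)
  have g_m[measurable]: "g n \<in> borel_measurable lebesgue" for n
    using cont by (rule continuous_on_imp_borel_measurable_lebesgue)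
  have "(\<lambda>n. LINT x|lebesgue. (norm (fc x - g n x))\<^sup>2) \<longlonglongrightarrow> (LINT x|(lebesgue :: (real^3) measure). 0)"
  proof (rule integral_dominated_convergence[where w = "\<lambda>x. (2 * c)\<^sup>2 * indicat_real (cball 0 (R + 1)) x"])
    have "AE x in lebesgue. x \<notin> N"
      using N by (simp add: negligible_iff_null_sets AE_not_in)
    then show "AE x in lebesgue. (\<lambda>n. (norm (fc x - g n x))\<^sup>2) \<longlonglongrightarrow> 0"
    proof eventually_elim
      case (elim x)
      have "(\<lambda>n. clip c (h n x)) \<longlonglongrightarrow> fc x"
        using continuous_on_clip[OF c(1), of UNIV] lim[OF elim] unfolding fc_def
        by (metis UNIV_I continuous_on_eq_continuous_at isCont_tendsto_compose open_UNIV)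
      then have "(\<lambda>n. g n x) \<longlonglongrightarrow> \<eta> x *\<^sub>R fc x" unfolding g_def by (intro tendsto_intros)
      then have "(\<lambda>n. (norm (fc x - g n x))\<^sup>2) \<longlonglongrightarrow> (norm (fc x - fc x))\<^sup>2"
        unfolding fc_eq by (intro tendsto_intros)
      then show ?case by simp
    qed
    show "AE x in lebesgue. norm ((norm (fc x - g n x))\<^sup>2) \<le> (2 * c)\<^sup>2 * indicat_real (cball 0 (R + 1)) x" for n
    proof (rule AE_I2)
      fix x :: "real^3"
      have "fc x - g n x = \<eta> x *\<^sub>R (clip c (f x) - clip c (h n x))"
        using fc_eq[of x] by (simp add: g_def scaleR_diff_right fc_def)
      moreover have "norm (clip c (f x) - clip c (h n x)) \<le> 2 * c"
        using norm_triangle_ineq4[of "clip c (f x)" "clip c (h n x)"]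
          norm_clip_le[OF c(1), of "f x"] norm_clip_le[OF c(1), of "h n x"] by linarith
      ultimately have "norm (fc x - g n x) \<le> \<eta> x * (2 * c)"
        using \<eta>(1)[of x] by (simp add: mult_left_mono)
      also have "\<dots> \<le> 2 * c * indicat_real (cball 0 (R + 1)) x"
        using \<eta>(2,4)[of x] c(1) by (auto simp: indicator_def)
      finally have "(norm (fc x - g n x))\<^sup>2 \<le> (2 * c * indicat_real (cball 0 (R + 1)) x)\<^sup>2"
        by (intro power_mono) auto
      then show "norm ((norm (fc x - g n x))\<^sup>2) \<le> (2 * c)\<^sup>2 * indicat_real (cball 0 (R + 1)) x"
        by (cases "norm x \<le> R + 1") (simp_all add: power_mult_distrib)
    qed
    show "integrable lebesgue (\<lambda>x. (2 * c)\<^sup>2 * indicat_real (cball (0 :: real^3) (R + 1)) x)"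
      by (intro integrable_mult_right) (simp flip: lmeasurable_iff_integrable)
  qed measurable
  then have "(\<lambda>n. LINT x|lebesgue. (norm (fc x - g n x))\<^sup>2) \<longlonglongrightarrow> 0" by simp
  then have "\<forall>\<^sub>F n in sequentially. (LINT x|lebesgue. (norm (fc x - g n x))\<^sup>2) < e / 4"
    by (rule order_tendstoD(2)) (use e in simp)
  then obtain n where n: "(LINT x|lebesgue. (norm (fc x - g n x))\<^sup>2) < e / 4"
    by (auto dest: eventually_happens)
  have fc: "square_integrable fc"
    using f by (intro square_integrableI_bound[of _ "\<lambda>x. (norm (f x))\<^sup>2"])
      (auto simp: fc_def clip_def square_integrable_def intro!: power_mono mult_left_le_one_le,
       use c(1) in \<open>auto simp: max_def field_simps\<close>)
  have "(LINT x|lebesgue. (norm (f x - g n x))\<^sup>2) < e"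
    using square_integrable_dist_triangle[OF f fc square_integrable_continuous_supported[OF cont gs], of n] n c(2)
    by (simp add: fc_def)
  with cont gs that show thesis by blast
qed

text \<open>The value of the mollification is a mean of the values of \<open>g\<close> at distance at most \<open>r\<close>. With \<open>e = 0\<close>
this says that locally constant stretches of \<open>g\<close> are preserved.\<close>

lemma norm_conv_diff_le:
  assumes \<rho>: "mollifier r \<rho>" and g: "L1_loc g" and osc: "\<And>y. norm (x - y) \<le> r \<Longrightarrow> norm (g y - g x) \<le> e"
  shows "norm (conv \<rho> g x - g x) \<le> e"
proof -
  have test: "test_function \<rho>" using \<rho> by (rule mollifier_test_function)
  have i0: "integrable lebesgue (\<lambda>y. \<rho> (x - y))"
    using test_function_reflect[OF test] by (rule test_function_integrable)
  have i1: "integrable lebesgue (\<lambda>y. \<rho> (x - y) * g y)" by (rule conv_integrable[OF test g])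
  have "conv \<rho> g x - g x = (LINT y|lebesgue. \<rho> (x - y) * g y) - (LINT y|lebesgue. \<rho> (x - y) * g x)"
    using mollifier_reflect_integral[OF \<rho>, of x] i0 by (simp add: conv_def)
  also have "\<dots> = (LINT y|lebesgue. \<rho> (x - y) * (g y - g x))"
    using i0 i1 by (simp add: right_diff_distrib)
  also have "norm \<dots> \<le> (LINT y|lebesgue. e * Re (\<rho> (x - y)))"
  proof (rule norm_integral_le_integral)
    show "integrable lebesgue (\<lambda>y. \<rho> (x - y) * (g y - g x))"
      using i0 i1 by (simp add: right_diff_distrib)
    show "integrable lebesgue (\<lambda>y. e * Re (\<rho> (x - y)))"
      using integrable_Re[OF i0] by simp
    fix y
    have Re_nonneg: "Re (\<rho> (x - y)) \<ge> 0" using \<rho> by (simp add: mollifier_def)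
    have "norm (complex_of_real (Re (\<rho> (x - y)))) = Re (\<rho> (x - y))"
      unfolding norm_of_real using Re_nonneg by simp
    then have Re: "norm (\<rho> (x - y)) = Re (\<rho> (x - y))"
      unfolding mollifier_of_Re[OF \<rho>] .
    show "norm (\<rho> (x - y) * (g y - g x)) \<le> e * Re (\<rho> (x - y))"
    proof (cases "norm (x - y) \<le> r")
      case True
      then show ?thesis
        using mult_right_mono[OF osc Re_nonneg] unfolding norm_mult Re by (simp add: mult.commute)
    next
      case False
      with \<rho> show ?thesis by (simp add: mollifier_def supported_in_def)
    qed
  qed
  also have "\<dots> = e * Re (LINT y|lebesgue. \<rho> (x - y))"
    using integral_Re[OF i0] by simp
  also have "\<dots> = e" using mollifier_reflect_integral[OF \<rho>, of x] by simp
  finally show ?thesis .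
qed

definition mollifier_seq :: "(nat \<Rightarrow> real^3 \<Rightarrow> complex) \<Rightarrow> bool" where
  "mollifier_seq \<rho> \<longleftrightarrow> (\<forall>n. mollifier (1 / real (Suc n)) (\<rho> n))"

lemma mollifier_seq_exists: "\<exists>\<rho>. mollifier_seq \<rho>"
  unfolding mollifier_seq_def by (intro choice allI mollifier_exists) simp

lemma conv_tendsto_continuous:
  assumes \<rho>: "mollifier_seq \<rho>" and g: "continuous_on UNIV g" "supported_in R g"
  shows "(\<lambda>n. LINT x|lebesgue. (norm (conv (\<rho> n) g x - g x))\<^sup>2) \<longlonglongrightarrow> 0"
proof (rule LIMSEQ_I)
  fix e :: real assume e: "e > 0"
  have gS: "square_integrable g" by (rule square_integrable_continuous_supported[OF g])
  define V where "V = measure lebesgue (cball (0 :: real^3) (R + 1))"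
  have V: "V \<ge> 0" by (simp add: V_def)
  \<comment> \<open>An error of at most \<open>d\<close> on a set of volume \<open>V\<close> contributes \<open>d\<^sup>2 V < e\<close>; the \<open>1\<close> avoids a zero
    denominator.\<close>
  define d where "d = sqrt (e / (V + 1) / 2)"
  have d: "d > 0" "d\<^sup>2 = e / (V + 1) / 2" using e V by (auto simp: d_def)
  have "\<exists>s>0. \<forall>x\<in>UNIV. \<forall>y\<in>UNIV. dist y x < s \<longrightarrow> dist (g y) (g x) < d"
    using uniformly_continuous_supported[OF g] d(1) unfolding uniformly_continuous_on_def by blast
  then obtain s where s: "s > 0" "\<And>x y. dist y x < s \<Longrightarrow> dist (g y) (g x) < d" by blast
  obtain N :: nat where N: "1 / real (Suc N) < s" using s(1) nat_approx_posE by blast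
  have "norm ((LINT x|lebesgue. (norm (conv (\<rho> n) g x - g x))\<^sup>2) - 0) < e" if n: "n \<ge> N" for n
  proof -
    have m: "mollifier (1 / real (Suc n)) (\<rho> n)" using \<rho> by (simp add: mollifier_seq_def)
    have small: "1 / real (Suc n) < s" 
    proof -
      have "1 / real (Suc n) \<le> 1 / real (Suc N)" using n by (intro divide_left_mono) auto
      with N show ?thesis by simp
    qed
    have pt: "norm (conv (\<rho> n) g x - g x) \<le> d" for x
    proof (rule norm_conv_diff_le[OF m square_integrable_imp_L1_loc[OF gS]])
      fix y assume "norm (x - y) \<le> 1 / real (Suc n)"
      then show "norm (g y - g x) \<le> d"
        using s(2)[of y x] small by (simp add: dist_norm norm_minus_commute)
    qed
    have supp: "supported_in (R + 1) (conv (\<rho> n) g)"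
      using m g(2) by (intro supported_in_mono[OF supported_in_conv[of "1 / real (Suc n)" _ R]]) (auto simp: mollifier_def)
    have "(LINT x|lebesgue. (norm (conv (\<rho> n) g x - g x))\<^sup>2) \<le> (LINT x :: real^3|lebesgue. d\<^sup>2 * indicat_real (cball 0 (R + 1)) x)"
    proof (rule integral_mono)
      show "integrable lebesgue (\<lambda>x. (norm (conv (\<rho> n) g x - g x))\<^sup>2)"
        using square_integrable_diff(1)[OF square_integral_conv_le(1)[OF m gS] gS] by (simp add: square_integrable_def)
      show "integrable lebesgue (\<lambda>x. d\<^sup>2 * indicat_real (cball (0 :: real^3) (R + 1)) x)"
        by (intro integrable_mult_right) (simp flip: lmeasurable_iff_integrable)
      show "(norm (conv (\<rho> n) g x - g x))\<^sup>2 \<le> d\<^sup>2 * indicat_real (cball 0 (R + 1)) x" for x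
      proof (cases "norm x \<le> R + 1")
        case True with pt[of x] show ?thesis by (simp add: power_mono)
      next
        case False with supp g(2) show ?thesis by (simp add: supported_in_def)
      qed
    qed
    also have "\<dots> = d\<^sup>2 * V" by (simp add: V_def)
    also have "\<dots> < e" using e V unfolding d(2) by (simp add: field_simps add_nonneg_pos)
    finally have "(LINT x|lebesgue. (norm (conv (\<rho> n) g x - g x))\<^sup>2) < e" .
    moreover have "(LINT x|lebesgue. (norm (conv (\<rho> n) g x - g x))\<^sup>2) \<ge> 0" by (rule integral_nonneg_AE) simp
    ultimately show ?thesis by simp
  qed
  then show "\<exists>N. \<forall>n\<ge>N. norm ((LINT x|lebesgue. (norm (conv (\<rho> n) g x - g x))\<^sup>2) - 0) < e" by blast
qed

text \<open>Approximate \<open>f\<close> by a continuous \<open>g\<close>: the first and last of the three differences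
\<open>\<rho>\<^sub>n * f - \<rho>\<^sub>n * g\<close>, \<open>\<rho>\<^sub>n * g - g\<close>, \<open>g - f\<close> are small uniformly in \<open>n\<close>, because mollification does not
increase the square mean.\<close>

lemma conv_tendsto_square_integrable:
  assumes \<rho>: "mollifier_seq \<rho>" and f: "square_integrable f" "supported_in R f"
  shows "(\<lambda>n. LINT x|lebesgue. (norm (conv (\<rho> n) f x - f x))\<^sup>2) \<longlonglongrightarrow> 0"
proof (rule LIMSEQ_I)
  fix e :: real assume e: "e > 0"
  obtain g where g: "continuous_on UNIV g" "supported_in (R + 1) g" "(LINT x|lebesgue. (norm (f x - g x))\<^sup>2) < e / 16"
    using square_integrable_approx_continuous[OF f, of "e / 16"] e by auto
  have gS: "square_integrable g" by (rule square_integrable_continuous_supported[OF g(1,2)])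
  obtain N where N: "\<And>n. n \<ge> N \<Longrightarrow> norm ((LINT x|lebesgue. (norm (conv (\<rho> n) g x - g x))\<^sup>2) - 0) < e / 16"
    using LIMSEQ_D[OF conv_tendsto_continuous[OF \<rho> g(1,2)], of "e / 16"] e by auto
  have "norm ((LINT x|lebesgue. (norm (conv (\<rho> n) f x - f x))\<^sup>2) - 0) < e" if n: "n \<ge> N" for n
  proof -
    have m: "mollifier (1 / real (Suc n)) (\<rho> n)" using \<rho> by (simp add: mollifier_seq_def)
    note S = square_integral_conv_le(1)[OF m f(1)] square_integral_conv_le(1)[OF m gS]
    have 1: "(LINT x|lebesgue. (norm (conv (\<rho> n) f x - conv (\<rho> n) g x))\<^sup>2) < e / 16"
      using square_integral_conv_le(2)[OF m square_integrable_diff(1)[OF f(1) gS]] g(3)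
        conv_diff_right[OF mollifier_test_function[OF m] square_integrable_imp_L1_loc[OF f(1)] square_integrable_imp_L1_loc[OF gS]]
      by simp
    have 2: "(LINT x|lebesgue. (norm (conv (\<rho> n) g x - g x))\<^sup>2) < e / 16" using N[OF n] by simp
    have 3: "(LINT x|lebesgue. (norm (g x - f x))\<^sup>2) < e / 16" using g(3) by (simp add: norm_minus_commute)
    have "(LINT x|lebesgue. (norm (conv (\<rho> n) f x - f x))\<^sup>2) < e"
      using 1 2 3 square_integrable_dist_triangle[OF S(1) gS f(1)] square_integrable_dist_triangle[OF S(1) S(2) gS] e
      by linarith
    moreover have "(LINT x|lebesgue. (norm (conv (\<rho> n) f x - f x))\<^sup>2) \<ge> 0" by (rule integral_nonneg_AE) simp
    ultimately show ?thesis by simp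
  qed
  then show "\<exists>N. \<forall>n\<ge>N. norm ((LINT x|lebesgue. (norm (conv (\<rho> n) f x - f x))\<^sup>2) - 0) < e" by blast
qed


section \<open>The fundamental lemma of the calculus of variations\<close>

text \<open>Mollify the indicator of the ball of radius \<open>R + 1\<close> at scale \<open>1\<close>.\<close>

lemma cutoff_exists:
  "\<exists>\<eta>. test_function \<eta> \<and> supported_in (R + 2) \<eta> \<and> (\<forall>x. norm x \<le> R \<longrightarrow> \<eta> x = 1)"
proof -
  let ?i = "\<lambda>x :: real^3. indicator (cball 0 (R + 1)) x :: complex"
  obtain \<rho> where \<rho>: "mollifier 1 \<rho>" using mollifier_exists[of 1] by auto
  have test: "test_function \<rho>" using \<rho> by (rule mollifier_test_function)
  have i: "L1_loc ?i"
    by (intro square_integrable_imp_L1_loc square_integrableI_bound[of _ "indicat_real (cball 0 (R + 1))"])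
      (rule borel_measurable_indicator, simp, auto simp: indicator_def simp flip: lmeasurable_iff_integrable)
  have si: "supported_in (R + 1) ?i" by (auto simp: supported_in_def)
  have "supported_in (R + 2) (conv \<rho> ?i)"
    using supported_in_mono[OF supported_in_conv[OF _ si, of 1 \<rho>], of "R + 2"] \<rho> by (simp add: mollifier_def)
  moreover have "conv \<rho> ?i x = 1" if x: "norm x \<le> R" for x
  proof -
    have "norm (conv \<rho> ?i x - ?i x) \<le> 0"
    proof (rule norm_conv_diff_le[OF \<rho> i])
      fix y :: "real^3" assume "norm (x - y) \<le> 1"
      with x have "norm y \<le> R + 1" using norm_triangle_sub[of y x] by (simp add: norm_minus_commute)
      with x show "norm (?i y - ?i x) \<le> 0" by simp
    qed
    with x show ?thesis by simp
  qed
  ultimately show ?thesis using test_function_conv[OF test i si] by blast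
qed

text \<open>The indicator of \<open>K\<close> is a bounded pointwise limit of test functions: mollify the indicator of the
closed \<open>1/(n+1)\<close>-neighbourhood of \<open>K\<close> at scale \<open>1/(n+1)\<close>. These functions equal \<open>1\<close> on \<open>K\<close>, and at
a point off \<open>K\<close> they vanish as soon as \<open>2/(n+1)\<close> is less than the distance to \<open>K\<close>.\<close>

lemma integral_compact_eq_0:
  assumes f: "L1_loc f" and zero: "\<And>\<phi>. test_function \<phi> \<Longrightarrow> (LINT x|lebesgue. \<phi> x * f x) = 0"
    and K: "compact K"
  shows "(LINT x|lebesgue. indicator K x * (f x :: complex)) = 0"
proof (cases "K = {}")
  case False
  obtain \<rho> where \<rho>: "mollifier_seq \<rho>" using mollifier_seq_exists by blast
  obtain R where R: "\<And>x. x \<in> K \<Longrightarrow> norm x \<le> R" using K compact_imp_bounded bounded_iff by metis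
  let ?r = "\<lambda>n. 1 / real (Suc n)"
  define i where "i n x = (indicator {x. infdist x K \<le> ?r n} x :: complex)" for n and x :: "real^3"
  have m: "mollifier (?r n) (\<rho> n)" for n using \<rho> by (simp add: mollifier_seq_def)
  have near: "norm x \<le> R + 1" if "infdist x K \<le> ?r n" for x n
  proof -
    obtain y where y: "y \<in> K" "infdist x K = dist x y"
      using infdist_attains_inf[OF compact_imp_closed[OF K] False] by metis
    have "dist x y \<le> ?r n" using y that by simp
    also have "?r n \<le> 1" by simp
    finally have "norm (x - y) \<le> 1" by (simp add: dist_norm)
    with R[OF y(1)] norm_triangle_sub[of x y] show ?thesis by simp
  qed
  have si: "supported_in (R + 1) (i n)" for n
  proof -
    have "i n x = 0" if "norm x > R + 1" for x
      using near[of x n] that by (auto simp: i_def indicator_def)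
    then show ?thesis by (simp add: supported_in_def)
  qed
  have ball_i: "norm (i n x) \<le> 1" for n x by (simp add: i_def indicator_def)
  have im: "i n \<in> borel_measurable lebesgue" for n
  proof -
    have "closed {x. infdist x K \<le> ?r n}" by (intro closed_Collect_le continuous_intros)
    then have "{x. infdist x K \<le> ?r n} \<in> sets lebesgue" by auto
    then show ?thesis unfolding i_def by measurable
  qed
  have iS: "square_integrable (i n)" for n
  proof (rule square_integrableI_bound[OF im])
    show "integrable lebesgue (indicat_real (cball (0 :: real^3) (R + 1)))" by (simp flip: lmeasurable_iff_integrable)
    show "AE x in lebesgue. (norm (i n x))\<^sup>2 \<le> indicat_real (cball 0 (R + 1)) x"
    proof (rule AE_I2)
      fix x
      show "(norm (i n x))\<^sup>2 \<le> indicat_real (cball 0 (R + 1)) x"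
        using si[of n] ball_i[of n x] by (cases "norm x \<le> R + 1") (auto simp: supported_in_def power_le_one)
    qed
  qed
  note iL = square_integrable_imp_L1_loc[OF iS]
  define \<phi> where "\<phi> n = conv (\<rho> n) (i n)" for n
  have test: "test_function (\<phi> n)" for n
    unfolding \<phi>_def by (rule test_function_conv[OF mollifier_test_function[OF m] iL si])
  have \<phi>_bound: "norm (\<phi> n x) \<le> 3" for n x
  proof -
    have "norm (\<phi> n x - i n x) \<le> 2"
      unfolding \<phi>_def
    proof (rule norm_conv_diff_le[OF m iL])
      show "norm (i n y - i n x) \<le> 2" for y
        using norm_triangle_ineq4[of "i n y" "i n x"] ball_i[of n x] ball_i[of n y] by linarith
    qed
    with ball_i[of n x] show ?thesis using norm_triangle_sub[of "\<phi> n x" "i n x"] by linarith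
  qed
  have \<phi>_supp: "\<phi> n x = 0" if "norm x > R + 2" for n x
  proof -
    have "supported_in (?r n + (R + 1)) (\<phi> n)"
      unfolding \<phi>_def using m[of n] by (intro supported_in_conv si) (simp add: mollifier_def)
    then have "supported_in (R + 2) (\<phi> n)" by (rule supported_in_mono) simp
    with that show ?thesis by (simp add: supported_in_def)
  qed
  have lim: "(\<lambda>n. \<phi> n x) \<longlonglongrightarrow> indicator K x" for x
  proof (cases "x \<in> K")
    case True
    have "\<phi> n x = 1" for n
    proof -
      have i1: "i n y = 1" if "norm (x - y) \<le> ?r n" for y
      proof -
        have "infdist y K \<le> dist y x" using True by (rule infdist_le)
        with that show ?thesis by (simp add: i_def dist_norm norm_minus_commute)
      qed
      have "norm (\<phi> n x - i n x) \<le> 0"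
        unfolding \<phi>_def by (rule norm_conv_diff_le[OF m iL]) (simp add: i1)
      with i1[of x] show ?thesis by simp
    qed
    with True show ?thesis by simp
  next
    case False
    have pos: "infdist x K > 0"
      using infdist_pos_not_in_closed[OF compact_imp_closed[OF K] \<open>K \<noteq> {}\<close> False] .
    have "(\<lambda>n. 2 * inverse (real (Suc n))) \<longlonglongrightarrow> 0"
      using tendsto_mult_right_zero[OF LIMSEQ_inverse_real_of_nat] by blast
    then have "\<forall>\<^sub>F n in sequentially. 2 * inverse (real (Suc n)) < infdist x K"
      using pos by (rule order_tendstoD)
    then have "\<forall>\<^sub>F n in sequentially. \<phi> n x = 0"
    proof eventually_elim
      case (elim n)
      have i0: "i n y = 0" if "norm (x - y) \<le> ?r n" for y
      proof -
        have "infdist x K \<le> infdist y K + dist x y" by (rule infdist_triangle)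
        with that elim show ?thesis by (simp add: i_def dist_norm inverse_eq_divide)
      qed
      have "norm (\<phi> n x - i n x) \<le> 0"
        unfolding \<phi>_def by (rule norm_conv_diff_le[OF m iL]) (simp add: i0)
      with i0[of x] show ?case by simp
    qed
    with False show ?thesis by (simp add: tendsto_eventually)
  qed
  have [measurable]: "f \<in> borel_measurable lebesgue" using f by (simp add: L1_loc_def)
  have [measurable]: "\<phi> n \<in> borel_measurable lebesgue" for n
    using test_function_continuous[OF test] by (rule continuous_on_imp_borel_measurable_lebesgue)
  have [measurable]: "K \<in> sets lebesgue" using K by (simp add: lmeasurable_compact fmeasurableD)
  have "(\<lambda>n. LINT x|lebesgue. \<phi> n x * f x) \<longlonglongrightarrow> (LINT x|lebesgue. indicator K x * f x)"
  proof (rule integral_dominated_convergence[where w = "\<lambda>x. 3 * (indicat_real (cball 0 (R + 2)) x * norm (f x))"])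
    show "integrable lebesgue (\<lambda>x. 3 * (indicat_real (cball 0 (R + 2)) x * norm (f x)))"
      using L1_loc_integrable_norm[OF f] by (rule integrable_mult_right)
    show "AE x in lebesgue. (\<lambda>n. \<phi> n x * f x) \<longlonglongrightarrow> indicator K x * f x"
      by (intro AE_I2 tendsto_mult lim tendsto_const)
    show "AE x in lebesgue. norm (\<phi> n x * f x) \<le> 3 * (indicat_real (cball 0 (R + 2)) x * norm (f x))" for n
    proof (rule AE_I2)
      fix x
      show "norm (\<phi> n x * f x) \<le> 3 * (indicat_real (cball 0 (R + 2)) x * norm (f x))"
        using \<phi>_bound[of n x] \<phi>_supp[of x n]
        by (cases "norm x \<le> R + 2") (simp_all add: norm_mult mult_right_mono)
    qed
  qed measurable
  then show ?thesis using zero[OF test] by (simp add: LIMSEQ_const_iff)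
qed simp

text \<open>For a real functional \<open>L\<close>, a compact set on which \<open>L f > 0\<close> is null, because \<open>L f\<close> has integral zero over
it. By inner regularity the measurable set \<open>{x. L (f x) > 0}\<close> is, up to a null set, a countable union
of such compact sets. The choices \<open>L = \<plusminus>Re, \<plusminus>Im\<close> finish the proof.\<close>

lemma fundamental_lemma:
  assumes f: "L1_loc f" and zero: "\<And>\<phi>. test_function \<phi> \<Longrightarrow> (LINT x|lebesgue. \<phi> x * f x) = 0"
  shows "AE x in lebesgue. f x = (0 :: complex)"
proof -
  have [measurable]: "f \<in> borel_measurable lebesgue" using f by (simp add: L1_loc_def)
  have nonpos: "AE x in lebesgue. L (f x) \<le> 0" if L: "bounded_linear (L :: complex \<Rightarrow> real)" for L
  proof -
    have L0: "L 0 = 0" using bounded_linear.linear[OF L] by (rule linear_0)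
    have [measurable]: "L \<in> borel_measurable borel"
      using linear_continuous_on[OF L] by (rule borel_measurable_continuous_onI)
    have null: "K \<in> null_sets lebesgue" if K: "compact K" "K \<subseteq> {x. L (f x) > 0}" for K
    proof -
      have Ks: "K \<in> sets lebesgue" using K by (simp add: lmeasurable_compact fmeasurableD)
      have int: "integrable lebesgue (\<lambda>x. indicator K x * f x)"
      proof -
        have "integrable lebesgue (\<lambda>x. indicator K x *\<^sub>R f x)"
          using f K(1) unfolding L1_loc_def set_integrable_def by auto
        moreover have "(\<lambda>x. indicator K x *\<^sub>R f x) = (\<lambda>x. indicator K x * f x)"
          by (auto simp: indicator_def)
        ultimately show ?thesis by simp
      qed
      have LK: "L (indicator K x * f x) = indicator K x * L (f x)" for x
        by (simp add: indicator_def L0)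
      have "(LINT x|lebesgue. indicator K x * L (f x)) = L (LINT x|lebesgue. indicator K x * f x)"
        using integral_bounded_linear[OF L int] by (simp only: LK)
      then have I0: "(LINT x|lebesgue. indicator K x * L (f x)) = 0"
        using integral_compact_eq_0[OF f assms(2) K(1)] by (simp add: L0)
      have "integrable lebesgue (\<lambda>x. indicator K x * L (f x))"
        using integrable_bounded_linear[OF L int] by (simp only: LK)
      moreover have "AE x in lebesgue. 0 \<le> indicator K x * L (f x)"
        using K(2) by (intro AE_I2) (auto simp: indicator_def)
      ultimately have "AE x in lebesgue. indicator K x * L (f x) = 0"
        using I0 integral_nonneg_eq_0_iff_AE by blast
      then have "AE x in lebesgue. x \<notin> K"
        by eventually_elim (use K(2) in \<open>auto simp: indicator_def split: if_splits\<close>)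
      then show ?thesis using Ks by (simp add: AE_iff_null_sets)
    qed
    have "{x \<in> space lebesgue. L (f x) > 0} \<in> sets lebesgue" by measurable
    then have S: "{x. L (f x) > 0} \<in> sets lebesgue" by simp
    obtain C T where CT: "fsigma C" "T \<in> null_sets lebesgue" "C \<union> T = {x. L (f x) > 0}"
      using lebesgue_set_almost_fsigma[OF S] by metis
    obtain F :: "nat \<Rightarrow> (real^3) set" where F: "range F \<subseteq> Collect compact" "C = \<Union> (range F)"
      using fsigma_Union_compact CT(1) by metis
    have "F n \<in> null_sets lebesgue" for n
      using F CT(3) by (intro null) auto
    then have "C \<in> null_sets lebesgue" unfolding F(2) by (rule null_sets_UN)
    then have "{x. L (f x) > 0} \<in> null_sets lebesgue"
      using null_sets.Un[OF _ CT(2)] CT(3) by metis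
    then have "AE x in lebesgue. x \<notin> {x. L (f x) > 0}" by (rule AE_not_in)
    then show ?thesis by eventually_elim auto
  qed
  have "AE x in lebesgue. Re (f x) \<le> 0" "AE x in lebesgue. - Re (f x) \<le> 0"
    "AE x in lebesgue. Im (f x) \<le> 0" "AE x in lebesgue. - Im (f x) \<le> 0"
    by (intro nonpos bounded_linear_Re bounded_linear_Im bounded_linear_minus)+
  then show ?thesis by eventually_elim (simp add: complex_eq_iff)
qed

section \<open>Completeness of the space of square integrable functions\<close>

text \<open>Choose a subsequence whose squared increments have integral below \<open>(1 / 8) ^ k\<close>. With weights \<open>2 ^ k\<close>
these squared increments still have a summable series of integrals, so their sum is finite almost everywhere.
There the increments decay geometrically and the subsequence converges pointwise. Fatou's lemma
compares the limit with the whole sequence.\<close>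

lemma square_integrable_complete:
  assumes F: "\<And>n. square_integrable (F n)"
    and Cauchy: "\<And>e. e > 0 \<Longrightarrow> \<exists>N. \<forall>m\<ge>N. \<forall>n\<ge>N. (LINT x|lebesgue. (norm (F m x - F n x))\<^sup>2) < e"
  shows "\<exists>v. square_integrable v \<and> (\<lambda>n. LINT x|lebesgue. (norm (F n x - v x :: complex))\<^sup>2) \<longlonglongrightarrow> 0"
proof -
  have Fm[measurable]: "F n \<in> borel_measurable lebesgue" for n using F by (simp add: square_integrable_def)
  have int: "integrable lebesgue (\<lambda>x. (norm (F m x - F n x))\<^sup>2)" for m n
    using square_integrable_diff(1)[OF F F] by (simp add: square_integrable_def)
  have "\<forall>k. \<exists>N. \<forall>m\<ge>N. \<forall>n\<ge>N. (LINT x|lebesgue. (norm (F m x - F n x))\<^sup>2) < (1 / 8) ^ k"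
    using Cauchy by simp
  then obtain N where N: "\<And>k m n. m \<ge> N k \<Longrightarrow> n \<ge> N k \<Longrightarrow> (LINT x|lebesgue. (norm (F m x - F n x))\<^sup>2) < (1 / 8) ^ k"
    by metis
  \<comment> \<open>A sum serves as a bound for \<open>N 0, \<dots>, N k\<close>, and the term \<open>k\<close> forces \<open>r\<close> to infinity.\<close>
  define r where "r k = (\<Sum>i\<le>k. N i) + k" for k
  have r: "r k \<ge> N k" "r (Suc k) \<ge> N k" "r k \<ge> k" for k
  proof -
    have "N k \<le> (\<Sum>i\<le>k. N i)" by (rule member_le_sum) auto
    then show "r k \<ge> N k" "r (Suc k) \<ge> N k" "r k \<ge> k" by (auto simp: r_def)
  qed
  define D where "D k x = 2 ^ k * (norm (F (r (Suc k)) x - F (r k) x))\<^sup>2" for k x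
  have D_nonneg: "D k x \<ge> 0" for k x by (simp add: D_def)
  have [measurable]: "D k \<in> borel_measurable lebesgue" for k unfolding D_def by measurable
  have D_int: "(\<integral>\<^sup>+x. ennreal (D k x) \<partial>lebesgue) \<le> ennreal ((1 / 4) ^ k)" for k
  proof -
    have "(\<integral>\<^sup>+x. ennreal (D k x) \<partial>lebesgue) = ennreal (LINT x|lebesgue. D k x)"
      using int D_nonneg by (intro nn_integral_eq_integral) (auto simp: D_def)
    also have "(LINT x|lebesgue. D k x) \<le> 2 ^ k * (1 / 8) ^ k"
      using N[OF r(2) r(1), of k] by (simp add: D_def)
    also have "\<dots> = (2 * (1 / 8)) ^ k" by (simp only: power_mult_distrib)
    also have "\<dots> = (1 / 4) ^ k" by simp
    finally show ?thesis by (simp add: ennreal_leI)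
  qed
  have "(\<integral>\<^sup>+x. (\<Sum>k. ennreal (D k x)) \<partial>lebesgue) = (\<Sum>k. \<integral>\<^sup>+x. ennreal (D k x) \<partial>lebesgue)"
    by (rule nn_integral_suminf) measurable
  also have "\<dots> \<le> (\<Sum>k. ennreal ((1 / 4) ^ k))"
    by (intro suminf_le D_int) auto
  also have "\<dots> = ennreal (\<Sum>k. (1 / 4) ^ k)"
    by (intro suminf_ennreal2) (auto intro: summable_geometric)
  also have "\<dots> < \<infinity>" by simp
  finally have "(\<integral>\<^sup>+x. (\<Sum>k. ennreal (D k x)) \<partial>lebesgue) \<noteq> \<infinity>" by simp
  then have "AE x in lebesgue. (\<Sum>k. ennreal (D k x)) \<noteq> \<infinity>"
    by (intro nn_integral_PInf_AE) measurable
  then have conv: "AE x in lebesgue. convergent (\<lambda>n. F (r n) x)"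
  proof eventually_elim
    case (elim x)
    then have sD: "summable (\<lambda>k. D k x)"
      using D_nonneg by (intro summable_suminf_not_top) auto
    define M where "M = (\<Sum>k. D k x)"
    have DM: "D k x \<le> M" for k
      using sum_le_suminf[OF sD, of "{k}"] D_nonneg by (simp add: M_def)
    have M: "M \<ge> 0" using DM[of 0] D_nonneg[of 0 x] by linarith
    have step: "norm (F (r (Suc k)) x - F (r k) x) \<le> sqrt M * (1 / sqrt 2) ^ k" for k
    proof -
      have "(norm (F (r (Suc k)) x - F (r k) x))\<^sup>2 \<le> M / 2 ^ k"
        using DM[of k] by (simp add: D_def field_simps)
      then have "norm (F (r (Suc k)) x - F (r k) x) \<le> sqrt (M / 2 ^ k)" by (rule real_le_rsqrt)
      also have "\<dots> = sqrt M * (1 / sqrt 2) ^ k"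
        by (simp add: real_sqrt_divide real_sqrt_power power_one_over)
      finally show ?thesis .
    qed
    have "summable (\<lambda>k. sqrt M * (1 / sqrt 2) ^ k)"
      by (intro summable_mult summable_geometric) simp
    then have "summable (\<lambda>k. F (r (Suc k)) x - F (r k) x)"
      by (rule summable_comparison_test') (rule step)
    then have "convergent (\<lambda>n. \<Sum>k<n. F (r (Suc k)) x - F (r k) x)"
      by (simp add: summable_iff_convergent)
    then have "convergent (\<lambda>n. F (r n) x - F (r 0) x)"
      using sum_lessThan_telescope[of "\<lambda>n. F (r n) x"] by simp
    then have "convergent (\<lambda>n. (F (r n) x - F (r 0) x) + F (r 0) x)"
      by (intro convergent_add convergent_const)
    then show ?case by simp
  qed
  define v where "v x = lim (\<lambda>n. F (r n) x)" for x
  have [measurable]: "v \<in> borel_measurable lebesgue"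
    unfolding v_def by (intro borel_measurable_lim_metric Fm)
  have lim: "AE x in lebesgue. (\<lambda>n. F (r n) x) \<longlonglongrightarrow> v x"
    using conv by eventually_elim (simp add: v_def convergent_LIMSEQ_iff)
  have fatou: "(\<integral>\<^sup>+x. ennreal ((norm (F n x - v x))\<^sup>2) \<partial>lebesgue) \<le> ennreal e"
    if N': "\<forall>m\<ge>N'. \<forall>n\<ge>N'. (LINT x|lebesgue. (norm (F m x - F n x))\<^sup>2) < e" and n: "n \<ge> N'" for e N' n
  proof -
    have "(\<integral>\<^sup>+x. ennreal ((norm (F n x - v x))\<^sup>2) \<partial>lebesgue)
        = (\<integral>\<^sup>+x. liminf (\<lambda>m. ennreal ((norm (F n x - F (r m) x))\<^sup>2)) \<partial>lebesgue)"
    proof (rule nn_integral_cong_AE)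
      show "AE x in lebesgue. ennreal ((norm (F n x - v x))\<^sup>2) = liminf (\<lambda>m. ennreal ((norm (F n x - F (r m) x))\<^sup>2))"
        using lim
      proof eventually_elim
        case (elim x)
        then have "(\<lambda>m. ennreal ((norm (F n x - F (r m) x))\<^sup>2)) \<longlonglongrightarrow> ennreal ((norm (F n x - v x))\<^sup>2)"
          by (intro tendsto_intros)
        then show ?case by (rule lim_imp_Liminf[OF trivial_limit_sequentially, symmetric])
      qed
    qed
    also have "\<dots> \<le> liminf (\<lambda>m. \<integral>\<^sup>+x. ennreal ((norm (F n x - F (r m) x))\<^sup>2) \<partial>lebesgue)"
      by (rule nn_integral_liminf) measurable
    also have "\<dots> \<le> limsup (\<lambda>m. \<integral>\<^sup>+x. ennreal ((norm (F n x - F (r m) x))\<^sup>2) \<partial>lebesgue)"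
      by (simp add: Liminf_le_Limsup)
    also have "\<dots> \<le> ennreal e"
    proof (rule Limsup_bounded)
      show "\<forall>\<^sub>F m in sequentially. (\<integral>\<^sup>+x. ennreal ((norm (F n x - F (r m) x))\<^sup>2) \<partial>lebesgue) \<le> ennreal e"
        using eventually_ge_at_top[of N']
      proof eventually_elim
        case (elim m)
        then have "r m \<ge> N'" using r(3)[of m] by linarith
        with N' n have "(LINT x|lebesgue. (norm (F n x - F (r m) x))\<^sup>2) < e" by blast
        then show ?case
          using nn_integral_eq_integral[OF int[of n "r m"]] by (simp add: ennreal_leI)
      qed
    qed
    finally show ?thesis .
  qed
  have diff: "square_integrable (\<lambda>x. F n x - v x) \<and> (LINT x|lebesgue. (norm (F n x - v x))\<^sup>2) \<le> e"
    if N': "\<forall>m\<ge>N'. \<forall>n\<ge>N'. (LINT x|lebesgue. (norm (F m x - F n x))\<^sup>2) < e" and n: "n \<ge> N'" and e: "e > 0" for e N' n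
  proof -
    have i: "integrable lebesgue (\<lambda>x. (norm (F n x - v x))\<^sup>2)"
      using fatou[OF N' n] by (intro integrableI_bounded) (auto intro: le_less_trans)
    have "ennreal (LINT x|lebesgue. (norm (F n x - v x))\<^sup>2) \<le> ennreal e"
      using fatou[OF N' n] nn_integral_eq_integral[OF i] by simp
    with e i show ?thesis by (simp add: square_integrable_def)
  qed
  obtain N1 where N1: "\<forall>m\<ge>N1. \<forall>n\<ge>N1. (LINT x|lebesgue. (norm (F m x - F n x))\<^sup>2) < 1"
    using Cauchy[of 1] by auto
  have "square_integrable (\<lambda>x. F N1 x - v x)" using diff[OF N1, of N1] by simp
  from square_integrable_diff(1)[OF F this, of N1] have "square_integrable v" by simp
  moreover have "(\<lambda>n. LINT x|lebesgue. (norm (F n x - v x))\<^sup>2) \<longlonglongrightarrow> 0"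
  proof (rule LIMSEQ_I)
    fix e :: real assume e: "e > 0"
    obtain N' where N': "\<forall>m\<ge>N'. \<forall>n\<ge>N'. (LINT x|lebesgue. (norm (F m x - F n x))\<^sup>2) < e / 2"
      using Cauchy[of "e / 2"] e by auto
    have "norm ((LINT x|lebesgue. (norm (F n x - v x))\<^sup>2) - 0) < e" if "n \<ge> N'" for n
      using diff[OF N' that] e integral_nonneg_AE[of "\<lambda>x. (norm (F n x - v x))\<^sup>2" lebesgue] by simp
    then show "\<exists>N. \<forall>n\<ge>N. norm ((LINT x|lebesgue. (norm (F n x - v x))\<^sup>2) - 0) < e" by blast
  qed
  ultimately show ?thesis by blast
qed



section \<open>Weak derivatives of fields with square integrable curl and divergence\<close>

definition weak_deriv :: "3 \<Rightarrow> (real^3 \<Rightarrow> complex) \<Rightarrow> (real^3 \<Rightarrow> complex) \<Rightarrow> complex" where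
  "weak_deriv j f \<phi> = - (LINT x|lebesgue. partial_deriv j \<phi> x * f x)"

text \<open>This transports differential equations in the sense of distributions to mollifications: the reflected
kernel is a test function, and the reflection produces the sign in the definition of the weak
derivative.\<close>

lemma conv_partial_deriv_eq_weak_deriv:
  assumes "test_function \<rho>"
  shows "conv (partial_deriv j \<rho>) f x = weak_deriv j f (\<lambda>y. \<rho> (x - y))"
proof -
  have "partial_deriv j (\<lambda>y. \<rho> (x - y)) y = - partial_deriv j \<rho> (x - y)" for y
    using smooth_differentiable[OF test_function_smooth[OF assms]] by (rule partial_deriv_reflect)
  then show ?thesis by (simp add: weak_deriv_def conv_def)
qed

text \<open>Moving \<open>\<partial>\<^sub>j\<close> off \<open>a\<close> turns the left side into the real part of \<open>- \<integral>a \<partial>\<^sub>j \<partial>\<^sub>k b'\<close>, where \<open>b'\<close> is the conjugate of \<open>b\<close>;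
this is symmetric in \<open>j\<close> and \<open>k\<close>.\<close>

lemma integral_cross_derivatives:
  assumes a: "test_function a" and b: "test_function b"
  shows "(LINT x|lebesgue. Re (partial_deriv j a x * cnj (partial_deriv k b x)))
       = (LINT x|lebesgue. Re (partial_deriv k a x * cnj (partial_deriv j b x)))"
proof -
  define b' where "b' x = cnj (b x)" for x
  have b': "test_function b'" unfolding b'_def by (rule test_function_cnj[OF b])
  have pd: "partial_deriv i b' x = cnj (partial_deriv i b x)" for i x
    unfolding b'_def using smooth_differentiable[OF test_function_smooth[OF b]] by (rule partial_deriv_cnj)
  have parts: "(LINT x|lebesgue. partial_deriv j a x * partial_deriv k b' x)
      = - (LINT x|lebesgue. a x * partial_deriv j (partial_deriv k b') x)" for j k
    by (rule integration_by_parts[OF a smooth_partial_deriv[OF test_function_smooth[OF b']]])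
  have eq: "(LINT x|lebesgue. partial_deriv j a x * partial_deriv k b' x)
     = (LINT x|lebesgue. partial_deriv k a x * partial_deriv j b' x)"
    unfolding parts using partial_deriv_commute[OF test_function_smooth[OF b'], of j k] by simp
  have int: "integrable lebesgue (\<lambda>x. partial_deriv j a x * partial_deriv k b' x)" for j k
    by (intro test_function_integrable test_function_mult test_function_partial_deriv b' smooth_partial_deriv test_function_smooth[OF a])
  show ?thesis
    using arg_cong[OF eq, of Re] integral_Re[OF int, of j k] integral_Re[OF int, of k j] unfolding pd by simp
qed

text \<open>With \<open>p j k\<close> in the role of \<open>\<partial>\<^sub>j u\<^sub>k\<close> this is the pointwise form of the energy identity; the terms \<open>X\<close>
are those that integrate to zero.\<close>

lemma sum_norm_squares_curl_div:
  fixes p :: "3 \<Rightarrow> 3 \<Rightarrow> complex"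
  defines "X \<equiv> \<lambda>j k. Re (p j j * cnj (p k k)) - Re (p j k * cnj (p k j))"
  shows "(norm (p 2 3 - p 3 2))\<^sup>2 + (norm (p 3 1 - p 1 3))\<^sup>2 + (norm (p 1 2 - p 2 1))\<^sup>2
      + (norm (p 1 1 + p 2 2 + p 3 3))\<^sup>2
    = (\<Sum>j\<in>UNIV. \<Sum>k\<in>UNIV. (norm (p j k))\<^sup>2) + 2 * (X 1 2 + X 1 3 + X 2 3)"
  unfolding X_def sum_3 cmod_power2 by (simp add: power2_eq_square algebra_simps)

lemma gradient_energy_le_curl_div:
  fixes u :: "3 \<Rightarrow> real^3 \<Rightarrow> complex"
  assumes u: "\<And>k. test_function (u k)"
  defines "p \<equiv> \<lambda>j k. partial_deriv j (u k)"
  shows "(LINT x|lebesgue. (norm (p j k x))\<^sup>2)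
    \<le> (LINT x|lebesgue. (norm (p 2 3 x - p 3 2 x))\<^sup>2) + (LINT x|lebesgue. (norm (p 3 1 x - p 1 3 x))\<^sup>2)
      + (LINT x|lebesgue. (norm (p 1 2 x - p 2 1 x))\<^sup>2) + (LINT x|lebesgue. (norm (p 1 1 x + p 2 2 x + p 3 3 x))\<^sup>2)"
proof -
  define X where "X j k x = Re (p j j x * cnj (p k k x)) - Re (p j k x * cnj (p k j x))" for j k x
  have pt: "test_function (p j k)" for j k unfolding p_def by (intro test_function_partial_deriv u)
  have pp: "integrable lebesgue (\<lambda>x. Re (p i j x * cnj (p k l x)))" for i j k l
    by (intro integrable_Re test_function_integrable test_function_mult test_function_cnj pt test_function_smooth)
  have X_int: "integrable lebesgue (X j k)" for j k
    unfolding X_def by (intro Bochner_Integration.integrable_diff pp)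
  have X0: "(LINT x|lebesgue. X j k x) = 0" for j k
  proof -
    have "(LINT x|lebesgue. Re (p j k x * cnj (p k j x))) = (LINT x|lebesgue. Re (p k k x * cnj (p j j x)))"
      unfolding p_def by (rule integral_cross_derivatives[OF u u])
    also have "\<dots> = (LINT x|lebesgue. Re (p j j x * cnj (p k k x)))"
      by (intro Bochner_Integration.integral_cong) (auto simp: mult.commute)
    finally show ?thesis unfolding X_def using pp by simp
  qed
  have sq: "integrable lebesgue (\<lambda>x. (norm (f x))\<^sup>2)" if "test_function f" for f
    using square_integrable_test_function[OF that] by (simp add: square_integrable_def)
  note i = sq[OF pt] sq[OF test_function_diff[OF pt pt]] sq[OF test_function_add[OF test_function_add[OF pt pt] pt]]
  have "(LINT x|lebesgue. (norm (p j k x))\<^sup>2) \<le> (\<Sum>j\<in>UNIV. \<Sum>k\<in>UNIV. (LINT x|lebesgue. (norm (p j k x))\<^sup>2))"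
  proof -
    have nn: "0 \<le> (LINT x|lebesgue. (norm (p j k x))\<^sup>2)" for j k by (rule integral_nonneg_AE) simp
    have "(LINT x|lebesgue. (norm (p j k x))\<^sup>2) \<le> (\<Sum>k\<in>UNIV. (LINT x|lebesgue. (norm (p j k x))\<^sup>2))"
      by (rule member_le_sum) (auto simp: nn)
    also have "\<dots> \<le> (\<Sum>j\<in>UNIV. \<Sum>k\<in>UNIV. (LINT x|lebesgue. (norm (p j k x))\<^sup>2))"
      by (rule member_le_sum[where f = "\<lambda>j. \<Sum>k\<in>UNIV. (LINT x|lebesgue. (norm (p j k x))\<^sup>2)"]) (auto simp: nn sum_nonneg)
    finally show ?thesis .
  qed
  also have "\<dots> = (LINT x|lebesgue. (\<Sum>j\<in>UNIV. \<Sum>k\<in>UNIV. (norm (p j k x))\<^sup>2))"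
    using i(1) by (simp add: Bochner_Integration.integral_sum)
  also have "\<dots> = (LINT x|lebesgue. (\<Sum>j\<in>UNIV. \<Sum>k\<in>UNIV. (norm (p j k x))\<^sup>2)) + (LINT x|lebesgue. 2 * (X 1 2 x + X 1 3 x + X 2 3 x))"
    using X_int X0 by simp
  also have "\<dots> = (LINT x|lebesgue. (\<Sum>j\<in>UNIV. \<Sum>k\<in>UNIV. (norm (p j k x))\<^sup>2) + 2 * (X 1 2 x + X 1 3 x + X 2 3 x))"
    using i(1) X_int by (intro Bochner_Integration.integral_add[symmetric]) auto
  also have "\<dots> = (LINT x|lebesgue. (norm (p 2 3 x - p 3 2 x))\<^sup>2 + (norm (p 3 1 x - p 1 3 x))\<^sup>2
      + (norm (p 1 2 x - p 2 1 x))\<^sup>2 + (norm (p 1 1 x + p 2 2 x + p 3 3 x))\<^sup>2)"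
    unfolding X_def by (subst sum_norm_squares_curl_div[symmetric]) (rule refl)
  also have "\<dots> = (LINT x|lebesgue. (norm (p 2 3 x - p 3 2 x))\<^sup>2) + (LINT x|lebesgue. (norm (p 3 1 x - p 1 3 x))\<^sup>2)
      + (LINT x|lebesgue. (norm (p 1 2 x - p 2 1 x))\<^sup>2) + (LINT x|lebesgue. (norm (p 1 1 x + p 2 2 x + p 3 3 x))\<^sup>2)"
    using i by simp
  finally show ?thesis .
qed

text \<open>The inequality \<open>|\<phi> c| \<le> t |\<phi>|\<^sup>2 / 2 + |c|\<^sup>2 / (2 t)\<close> splits the error, with \<open>t\<close> chosen so that the first term integrates to less than \<open>e / 2\<close>.\<close>

lemma integral_mult_tendsto:
  assumes \<phi>: "test_function \<phi>" and a: "\<And>n. square_integrable (a n)" "square_integrable b"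
    and lim: "(\<lambda>n. LINT x|lebesgue. (norm (a n x - b x))\<^sup>2) \<longlonglongrightarrow> 0"
  shows "(\<lambda>n. LINT x|lebesgue. \<phi> x * a n x) \<longlonglongrightarrow> (LINT x|lebesgue. \<phi> x * b x)"
proof (rule LIMSEQ_I)
  fix e :: real assume e: "e > 0"
  define A where "A = (LINT x|lebesgue. (norm (\<phi> x))\<^sup>2) + 1"
  have nn: "0 \<le> (LINT x|lebesgue. (norm (\<phi> x))\<^sup>2)" by (rule integral_nonneg_AE) simp
  then have A: "A > 0" unfolding A_def by linarith
  define t where "t = e / A"
  have t: "t > 0" using e A by (simp add: t_def)
  have "\<forall>\<^sub>F n in sequentially. (LINT x|lebesgue. (norm (a n x - b x))\<^sup>2) < e * t"
    using lim by (rule order_tendstoD(2)) (use e t in simp)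
  then obtain N where N: "\<And>n. n \<ge> N \<Longrightarrow> (LINT x|lebesgue. (norm (a n x - b x))\<^sup>2) < e * t"
    unfolding eventually_sequentially by blast
  have "norm ((LINT x|lebesgue. \<phi> x * a n x) - (LINT x|lebesgue. \<phi> x * b x)) < e" if n: "n \<ge> N" for n
  proof -
    have i: "integrable lebesgue (\<lambda>x. \<phi> x * a n x)" "integrable lebesgue (\<lambda>x. \<phi> x * b x)"
      using test_function_mult_integrable[OF \<phi> square_integrable_imp_L1_loc] a by auto
    have s: "square_integrable (\<lambda>x. a n x - b x)" using a by (intro square_integrable_diff)
    have i\<phi>: "integrable lebesgue (\<lambda>x. (norm (\<phi> x))\<^sup>2)"
      using square_integrable_test_function[OF \<phi>] by (simp add: square_integrable_def)
    have ib: "integrable lebesgue (\<lambda>x. (norm (a n x - b x))\<^sup>2)" using s by (simp add: square_integrable_def)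
    have "(LINT x|lebesgue. \<phi> x * a n x) - (LINT x|lebesgue. \<phi> x * b x) = (LINT x|lebesgue. \<phi> x * (a n x - b x))"
      using i by (simp add: right_diff_distrib)
    also have "norm \<dots> \<le> (LINT x|lebesgue. t / 2 * (norm (\<phi> x))\<^sup>2 + 1 / (2 * t) * (norm (a n x - b x))\<^sup>2)"
    proof (rule norm_integral_le_integral)
      show "integrable lebesgue (\<lambda>x. \<phi> x * (a n x - b x))" using i by (simp add: right_diff_distrib)
      show "integrable lebesgue (\<lambda>x. t / 2 * (norm (\<phi> x))\<^sup>2 + 1 / (2 * t) * (norm (a n x - b x))\<^sup>2)"
        using i\<phi> ib by (intro Bochner_Integration.integrable_add integrable_mult_right)
      show "norm (\<phi> x * (a n x - b x)) \<le> t / 2 * (norm (\<phi> x))\<^sup>2 + 1 / (2 * t) * (norm (a n x - b x))\<^sup>2" for x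
      proof -
        have "2 * (t * norm (\<phi> x)) * norm (a n x - b x) \<le> (t * norm (\<phi> x))\<^sup>2 + (norm (a n x - b x))\<^sup>2"
          by (rule sum_squares_bound)
        then show ?thesis using t unfolding norm_mult by (simp add: field_simps power2_eq_square)
      qed
    qed
    also have "\<dots> = t / 2 * (LINT x|lebesgue. (norm (\<phi> x))\<^sup>2) + 1 / (2 * t) * (LINT x|lebesgue. (norm (a n x - b x))\<^sup>2)"
      using i\<phi> ib by (simp del: times_divide_eq_left)
    also have "\<dots> < t / 2 * A + 1 / (2 * t) * (e * t)"
    proof (rule add_le_less_mono)
      show "t / 2 * (LINT x|lebesgue. (norm (\<phi> x))\<^sup>2) \<le> t / 2 * A" using t by (intro mult_left_mono) (auto simp: A_def)
      show "1 / (2 * t) * (LINT x|lebesgue. (norm (a n x - b x))\<^sup>2) < 1 / (2 * t) * (e * t)"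
        using N[OF n] t by (intro mult_strict_left_mono) auto
    qed
    also have "\<dots> = e" using t A by (simp add: t_def field_simps)
    finally show ?thesis .
  qed
  then show "\<exists>N. \<forall>n\<ge>N. norm ((LINT x|lebesgue. \<phi> x * a n x) - (LINT x|lebesgue. \<phi> x * b x)) < e" by blast
qed

lemma conv_Cauchy:
  assumes \<rho>: "mollifier_seq \<rho>" and f: "square_integrable f" "supported_in R f" and e: "e > 0"
  shows "\<exists>N. \<forall>m\<ge>N. \<forall>n\<ge>N. (LINT x|lebesgue. (norm (conv (\<rho> m) f x - conv (\<rho> n) f x))\<^sup>2) < e"
proof -
  have "\<forall>\<^sub>F n in sequentially. (LINT x|lebesgue. (norm (conv (\<rho> n) f x - f x))\<^sup>2) < e / 4"
    using conv_tendsto_square_integrable[OF \<rho> f] by (rule order_tendstoD(2)) (use e in simp)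
  then obtain N where N: "\<And>n. n \<ge> N \<Longrightarrow> (LINT x|lebesgue. (norm (conv (\<rho> n) f x - f x))\<^sup>2) < e / 4"
    unfolding eventually_sequentially by blast
  have S: "square_integrable (conv (\<rho> n) f)" for n
    using \<rho> by (intro square_integral_conv_le(1)[OF _ f(1)]) (auto simp: mollifier_seq_def)
  have "(LINT x|lebesgue. (norm (conv (\<rho> m) f x - conv (\<rho> n) f x))\<^sup>2) < e" if "m \<ge> N" "n \<ge> N" for m n
    using square_integrable_dist_triangle[OF S f(1) S, of m n] N[OF that(1)] N[OF that(2)]
    by (simp add: norm_minus_commute)
  then show ?thesis by blast
qed

text \<open>For \<open>\<sigma> = \<rho> m - \<rho> n\<close>, the functions \<open>\<sigma> * G k\<close> are test functions whose curl and divergence are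
\<open>\<sigma> * C\<close> and \<open>\<sigma> * d\<close>. The energy estimate bounds their derivatives by differences of mollifications of
\<open>C\<close> and \<open>d\<close>, which are Cauchy. The limit of the derivatives represents the weak derivative, since both
sides of the integration by parts for \<open>\<rho> n * G k\<close> converge.\<close>

lemma weak_derivatives_of_compactly_supported_field:
  fixes G C :: "3 \<Rightarrow> real^3 \<Rightarrow> complex" and d :: "real^3 \<Rightarrow> complex"
  assumes G: "\<And>k. square_integrable (G k)" "\<And>k. supported_in R (G k)"
    and C: "\<And>k. square_integrable (C k)" "\<And>k. supported_in R (C k)"
    and d: "square_integrable d" "supported_in R d"
    and curl1: "\<And>\<phi>. test_function \<phi> \<Longrightarrow> weak_deriv 2 (G 3) \<phi> - weak_deriv 3 (G 2) \<phi> = (LINT x|lebesgue. \<phi> x * C 1 x)"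
    and curl2: "\<And>\<phi>. test_function \<phi> \<Longrightarrow> weak_deriv 3 (G 1) \<phi> - weak_deriv 1 (G 3) \<phi> = (LINT x|lebesgue. \<phi> x * C 2 x)"
    and curl3: "\<And>\<phi>. test_function \<phi> \<Longrightarrow> weak_deriv 1 (G 2) \<phi> - weak_deriv 2 (G 1) \<phi> = (LINT x|lebesgue. \<phi> x * C 3 x)"
    and div: "\<And>\<phi>. test_function \<phi> \<Longrightarrow> weak_deriv 1 (G 1) \<phi> + weak_deriv 2 (G 2) \<phi> + weak_deriv 3 (G 3) \<phi> = (LINT x|lebesgue. \<phi> x * d x)"
  shows "\<exists>v. square_integrable v \<and> (\<forall>\<phi>. test_function \<phi> \<longrightarrow> weak_deriv j (G k) \<phi> = (LINT x|lebesgue. \<phi> x * v x))"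
proof -
  obtain \<rho> where \<rho>: "mollifier_seq \<rho>" using mollifier_seq_exists by blast
  have mol: "mollifier (1 / real (Suc n)) (\<rho> n)" for n using \<rho> by (simp add: mollifier_seq_def)
  have test: "test_function (\<rho> n)" for n using mol by (rule mollifier_test_function)
  note GL = square_integrable_imp_L1_loc[OF G(1)]
  define F where "F n = partial_deriv j (conv (\<rho> n) (G k))" for n
  have F_test: "test_function (F n)" for n
    unfolding F_def by (intro test_function_partial_deriv test_function_conv[OF test GL G(2)])
  have F_S: "square_integrable (F n)" for n by (rule square_integrable_test_function[OF F_test])
  let ?D = "\<lambda>f m n. LINT x|lebesgue. (norm (conv (\<rho> m) f x - conv (\<rho> n) f x))\<^sup>2"
  have energy: "(LINT x|lebesgue. (norm (F m x - F n x))\<^sup>2) \<le> ?D (C 1) m n + ?D (C 2) m n + ?D (C 3) m n + ?D d m n" for m n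
  proof -
    define \<sigma> where "\<sigma> x = \<rho> m x - \<rho> n x" for x
    have \<sigma>: "test_function \<sigma>" unfolding \<sigma>_def by (rule test_function_diff[OF test test])
    have \<sigma>_conv: "conv \<sigma> f x = conv (\<rho> m) f x - conv (\<rho> n) f x" if "square_integrable f" for f x
      unfolding \<sigma>_def by (rule conv_diff_left[OF test test square_integrable_imp_L1_loc[OF that]])
    have \<sigma>_x: "test_function (\<lambda>y. \<sigma> (x - y))" for x by (rule test_function_reflect[OF \<sigma>])
    let ?u = "\<lambda>k. conv \<sigma> (G k)"
    have u: "test_function (?u k)" for k by (rule test_function_conv[OF \<sigma> GL G(2)])
    have pu: "partial_deriv j (?u k) x = weak_deriv j (G k) (\<lambda>y. \<sigma> (x - y))" for j k x
      unfolding partial_deriv_conv[OF \<sigma> GL] by (rule conv_partial_deriv_eq_weak_deriv[OF \<sigma>])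
    have C_conv: "partial_deriv 2 (?u 3) x - partial_deriv 3 (?u 2) x = conv \<sigma> (C 1) x"
        "partial_deriv 3 (?u 1) x - partial_deriv 1 (?u 3) x = conv \<sigma> (C 2) x"
        "partial_deriv 1 (?u 2) x - partial_deriv 2 (?u 1) x = conv \<sigma> (C 3) x"
        "partial_deriv 1 (?u 1) x + partial_deriv 2 (?u 2) x + partial_deriv 3 (?u 3) x = conv \<sigma> d x" for x
      unfolding pu conv_def using curl1[OF \<sigma>_x] curl2[OF \<sigma>_x] curl3[OF \<sigma>_x] div[OF \<sigma>_x] by simp_all
    have "F m x - F n x = partial_deriv j (?u k) x" for x
    proof -
      have "?u k = (\<lambda>x. conv (\<rho> m) (G k) x - conv (\<rho> n) (G k) x)"
        by (intro ext \<sigma>_conv G)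
      then have "partial_deriv j (?u k) x = F m x - F n x"
        unfolding F_def using smooth_differentiable[OF smooth_conv[OF test GL]] by (simp add: partial_deriv_diff)
      then show ?thesis by simp
    qed
    then show ?thesis
      using gradient_energy_le_curl_div[where u = ?u and j = j and k = k, OF u] unfolding C_conv by (simp add: \<sigma>_conv C d)
  qed
  have Cauchy: "\<exists>N. \<forall>m\<ge>N. \<forall>n\<ge>N. (LINT x|lebesgue. (norm (F m x - F n x))\<^sup>2) < e" if e: "e > 0" for e
  proof -
    have e4: "e / 4 > 0" using e by simp
    obtain N1 where N1: "\<And>m n. m \<ge> N1 \<Longrightarrow> n \<ge> N1 \<Longrightarrow> ?D (C 1) m n < e / 4"
      using conv_Cauchy[OF \<rho> C(1)[of 1] C(2)[of 1] e4] by blast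
    obtain N2 where N2: "\<And>m n. m \<ge> N2 \<Longrightarrow> n \<ge> N2 \<Longrightarrow> ?D (C 2) m n < e / 4"
      using conv_Cauchy[OF \<rho> C(1)[of 2] C(2)[of 2] e4] by blast
    obtain N3 where N3: "\<And>m n. m \<ge> N3 \<Longrightarrow> n \<ge> N3 \<Longrightarrow> ?D (C 3) m n < e / 4"
      using conv_Cauchy[OF \<rho> C(1)[of 3] C(2)[of 3] e4] by blast
    obtain N4 where N4: "\<And>m n. m \<ge> N4 \<Longrightarrow> n \<ge> N4 \<Longrightarrow> ?D d m n < e / 4"
      using conv_Cauchy[OF \<rho> d e4] by blast
    define N where "N = max (max N1 N2) (max N3 N4)"
    have "(LINT x|lebesgue. (norm (F m x - F n x))\<^sup>2) < e" if "m \<ge> N" "n \<ge> N" for m n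
    proof -
      have "?D (C 1) m n < e / 4" "?D (C 2) m n < e / 4" "?D (C 3) m n < e / 4" "?D d m n < e / 4"
        using that N1[of m n] N2[of m n] N3[of m n] N4[of m n] unfolding N_def by simp_all
      with energy[of m n] show ?thesis by linarith
    qed
    then show ?thesis by blast
  qed
  obtain v where v: "square_integrable v" "(\<lambda>n. LINT x|lebesgue. (norm (F n x - v x))\<^sup>2) \<longlonglongrightarrow> 0"
    using square_integrable_complete[OF F_S Cauchy] by blast
  have "weak_deriv j (G k) \<phi> = (LINT x|lebesgue. \<phi> x * v x)" if \<phi>: "test_function \<phi>" for \<phi>
  proof -
    have conv_S: "square_integrable (conv (\<rho> n) (G k))" for n
      by (rule square_integral_conv_le(1)[OF mol G(1)])
    have "(\<lambda>n. LINT x|lebesgue. partial_deriv j \<phi> x * conv (\<rho> n) (G k) x) \<longlonglongrightarrow> (LINT x|lebesgue. partial_deriv j \<phi> x * G k x)"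
      by (rule integral_mult_tendsto[OF test_function_partial_deriv[OF \<phi>] conv_S G(1) conv_tendsto_square_integrable[OF \<rho> G]])
    moreover have "(LINT x|lebesgue. partial_deriv j \<phi> x * conv (\<rho> n) (G k) x) = - (LINT x|lebesgue. \<phi> x * F n x)" for n
      unfolding F_def by (rule integration_by_parts[OF \<phi> smooth_conv[OF test GL]])
    ultimately have "(\<lambda>n. - (LINT x|lebesgue. \<phi> x * F n x)) \<longlonglongrightarrow> - weak_deriv j (G k) \<phi>"
      by (simp add: weak_deriv_def)
    then have "(\<lambda>n. LINT x|lebesgue. \<phi> x * F n x) \<longlonglongrightarrow> weak_deriv j (G k) \<phi>"
      by (simp only: tendsto_minus_cancel_left[symmetric] minus_minus)
    moreover have "(\<lambda>n. LINT x|lebesgue. \<phi> x * F n x) \<longlonglongrightarrow> (LINT x|lebesgue. \<phi> x * v x)"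
      by (rule integral_mult_tendsto[OF \<phi> F_S v])
    ultimately show ?thesis by (rule LIMSEQ_unique)
  qed
  with v(1) show ?thesis by blast
qed


section \<open>Localization and gluing\<close>

lemma weak_deriv_smooth_mult:
  assumes \<eta>: "smooth \<eta>" and f: "L1_loc f" and \<phi>: "test_function \<phi>"
  shows "weak_deriv j (\<lambda>x. \<eta> x * f x) \<phi>
    = weak_deriv j f (\<lambda>x. \<eta> x * \<phi> x) + (LINT x|lebesgue. \<phi> x * (partial_deriv j \<eta> x * f x))"
proof -
  have pd: "partial_deriv j (\<lambda>x. \<eta> x * \<phi> x) x = \<eta> x * partial_deriv j \<phi> x + partial_deriv j \<eta> x * \<phi> x" for x
    by (intro partial_deriv_mult smooth_differentiable \<eta> test_function_smooth \<phi>)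
  have i: "integrable lebesgue (\<lambda>x. (\<eta> x * partial_deriv j \<phi> x) * f x)"
      "integrable lebesgue (\<lambda>x. (partial_deriv j \<eta> x * \<phi> x) * f x)"
    by (intro test_function_mult_integrable[OF test_function_mult f] test_function_partial_deriv smooth_partial_deriv \<phi> \<eta>)+
  have "(LINT x|lebesgue. partial_deriv j (\<lambda>x. \<eta> x * \<phi> x) x * f x)
      = (LINT x|lebesgue. (\<eta> x * partial_deriv j \<phi> x) * f x) + (LINT x|lebesgue. (partial_deriv j \<eta> x * \<phi> x) * f x)"
    unfolding pd distrib_right using i by (rule Bochner_Integration.integral_add)
  then show ?thesis by (simp add: weak_deriv_def mult_ac)
qed

lemma test_function_mult_L2_loc:
  assumes \<eta>: "test_function \<eta>" "supported_in R \<eta>" and f: "L2_loc f"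
  shows "square_integrable (\<lambda>x. \<eta> x * f x)" and "supported_in R (\<lambda>x. \<eta> x * f x)"
proof -
  show supp: "supported_in R (\<lambda>x. \<eta> x * f x)" using \<eta>(2) by (simp add: supported_in_def)
  have cont: "continuous_on UNIV \<eta>" using \<eta>(1) by (rule test_function_continuous)
  obtain B where B: "B \<ge> 0" "\<And>x. norm (\<eta> x) \<le> B"
    using bounded_continuous_supported[OF cont \<eta>(2)] by blast
  have [measurable]: "f \<in> borel_measurable lebesgue" "\<eta> \<in> borel_measurable lebesgue"
    using f cont by (auto simp: L2_loc_def continuous_on_imp_borel_measurable_lebesgue)
  have "set_integrable lebesgue (cball 0 R) (\<lambda>x. (norm (f x))\<^sup>2)"
    using f by (simp add: L2_loc_def)
  then have i: "integrable lebesgue (\<lambda>x. B\<^sup>2 * (indicat_real (cball 0 R) x * (norm (f x))\<^sup>2))"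
    unfolding set_integrable_def by simp
  show "square_integrable (\<lambda>x. \<eta> x * f x)"
  proof (rule square_integrableI_bound[OF _ i])
    show "AE x in lebesgue. (norm (\<eta> x * f x))\<^sup>2 \<le> B\<^sup>2 * (indicat_real (cball 0 R) x * (norm (f x))\<^sup>2)"
    proof (rule AE_I2)
      fix x
      show "(norm (\<eta> x * f x))\<^sup>2 \<le> B\<^sup>2 * (indicat_real (cball 0 R) x * (norm (f x))\<^sup>2)"
      proof (cases "norm x \<le> R")
        case True
        have "(norm (\<eta> x))\<^sup>2 \<le> B\<^sup>2" using B(2) by (rule power_mono) simp
        with True show ?thesis by (simp add: norm_mult power_mult_distrib mult_right_mono)
      next
        case False with \<eta>(2) show ?thesis by (simp add: supported_in_def)
      qed
    qed
  qed measurable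
qed

lemma L2_locI_cball:
  fixes f :: "real^3 \<Rightarrow> 'b::euclidean_space"
  assumes "f \<in> borel_measurable lebesgue"
    and "\<And>m :: nat. integrable lebesgue (\<lambda>x. indicat_real (cball 0 (real m)) x * (norm (f x))\<^sup>2)"
  shows "L2_loc f"
  unfolding L2_loc_def
proof (intro conjI allI impI)
  show "f \<in> borel_measurable lebesgue" by fact
  fix K :: "(real^3) set" assume K: "compact K"
  obtain r where r: "\<And>x. x \<in> K \<Longrightarrow> norm x \<le> r" using K compact_imp_bounded bounded_iff by metis
  obtain m :: nat where m: "r \<le> real m" using real_arch_simple by blast
  have "set_integrable lebesgue (cball 0 (real m)) (\<lambda>x. (norm (f x))\<^sup>2)"
    using assms(2)[of m] by (simp add: set_integrable_def)
  then show "set_integrable lebesgue K (\<lambda>x. (norm (f x))\<^sup>2)"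
  proof (rule set_integrable_subset)
    show "K \<in> sets lebesgue" using K by (simp add: lmeasurable_compact fmeasurableD)
    show "K \<subseteq> cball 0 (real m)" using r m by force
  qed
qed

text \<open>If each \<open>V m\<close> represents the weak derivative against test functions supported in the ball of radius
\<open>m + 2\<close>, then \<open>V m\<close> and \<open>V m'\<close> agree almost everywhere on the ball of radius \<open>m\<close> for \<open>m \<le> m'\<close>: multiply
by a cutoff that is \<open>1\<close> there and has its support in the larger ball, and use the fundamental lemma.
So the sequence \<open>V\<close> is eventually constant at almost every point, and its pointwise limit is
measurable and locally equal to some \<open>V m\<close>.\<close>

lemma glue_weak_derivatives:
  assumes V: "\<And>m :: nat. square_integrable (V m)"
    and weak: "\<And>m \<phi>. test_function \<phi> \<Longrightarrow> supported_in (real m + 2) \<phi> \<Longrightarrow> weak_deriv j f \<phi> = (LINT x|lebesgue. \<phi> x * V m x)"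
  shows "\<exists>v. L2_loc v \<and> (\<forall>\<phi>. test_function \<phi> \<longrightarrow> weak_deriv j f \<phi> = (LINT x|lebesgue. \<phi> x * v x))"
proof -
  have Vm[measurable]: "V m \<in> borel_measurable lebesgue" for m using V by (simp add: square_integrable_def)
  note VL = square_integrable_imp_L1_loc[OF V]
  have consistent: "AE x in lebesgue. norm x \<le> real m \<longrightarrow> V m' x = V m x" if le: "m \<le> m'" for m m'
  proof -
    obtain \<eta> where \<eta>: "test_function \<eta>" "supported_in (real m + 2) \<eta>" "\<And>x. norm x \<le> real m \<Longrightarrow> \<eta> x = 1"
      using cutoff_exists[of "real m"] by auto
    have S: "square_integrable (\<lambda>x. \<eta> x * V k x)" for k
      by (rule test_function_mult_L2_loc(1)[OF \<eta>(1,2) square_integrable_imp_L2_loc[OF V]])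
    have "AE x in lebesgue. \<eta> x * V m' x - \<eta> x * V m x = 0"
    proof (rule fundamental_lemma)
      show "L1_loc (\<lambda>x. \<eta> x * V m' x - \<eta> x * V m x)"
        by (intro square_integrable_imp_L1_loc square_integrable_diff S)
      fix \<phi> assume \<phi>: "test_function \<phi>"
      have \<psi>: "test_function (\<lambda>x. \<phi> x * \<eta> x)" by (intro test_function_mult \<eta> test_function_smooth \<phi>)
      have \<psi>_supp: "supported_in (real m + 2) (\<lambda>x. \<phi> x * \<eta> x)" using \<eta>(2) by (simp add: supported_in_def)
      then have \<psi>_supp': "supported_in (real m' + 2) (\<lambda>x. \<phi> x * \<eta> x)" by (rule supported_in_mono) (use le in simp)
      have i: "integrable lebesgue (\<lambda>x. \<phi> x * \<eta> x * V k x)" for k by (rule test_function_mult_integrable[OF \<psi> VL])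
      have "(LINT x|lebesgue. \<phi> x * (\<eta> x * V m' x - \<eta> x * V m x))
          = (LINT x|lebesgue. \<phi> x * \<eta> x * V m' x) - (LINT x|lebesgue. \<phi> x * \<eta> x * V m x)"
        using i by (simp add: right_diff_distrib mult.assoc)
      then show "(LINT x|lebesgue. \<phi> x * (\<eta> x * V m' x - \<eta> x * V m x)) = 0"
        using weak[OF \<psi> \<psi>_supp] weak[OF \<psi> \<psi>_supp'] by simp
    qed
    then show ?thesis by eventually_elim (use \<eta>(3) in force)
  qed
  have "AE x in lebesgue. \<forall>m m'. m \<le> m' \<longrightarrow> norm x \<le> real m \<longrightarrow> V m' x = V m x"
    unfolding AE_all_countable using consistent by auto
  then have local: "AE x in lebesgue. \<forall>m. norm x \<le> real m \<longrightarrow> lim (\<lambda>n. V n x) = V m x"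
  proof eventually_elim
    case (elim x)
    have "lim (\<lambda>n. V n x) = V m x" if "norm x \<le> real m" for m
    proof (rule limI, rule tendsto_eventually)
      show "\<forall>\<^sub>F n in sequentially. V n x = V m x"
        using eventually_ge_at_top[of m] by eventually_elim (use elim that in blast)
    qed
    then show ?case by blast
  qed
  define v where "v x = lim (\<lambda>n. V n x)" for x
  have vm[measurable]: "v \<in> borel_measurable lebesgue" unfolding v_def by (intro borel_measurable_lim_metric Vm)
  have v: "AE x in lebesgue. norm x \<le> real m \<longrightarrow> v x = V m x" for m
    using local by eventually_elim (simp add: v_def)
  have "L2_loc v"
  proof (rule L2_locI_cball[OF vm])
    fix m :: nat
    have cb: "cball (0 :: real^3) (real m) \<in> sets lebesgue" by simp
    have "integrable lebesgue (\<lambda>x. indicat_real (cball 0 (real m)) x * (norm (V m x))\<^sup>2)"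
      using integrable_mult_indicator[OF cb, of "\<lambda>x. (norm (V m x))\<^sup>2"] V[of m] by (simp add: square_integrable_def)
    moreover have "AE x in lebesgue. indicat_real (cball 0 (real m)) x * (norm (V m x))\<^sup>2 = indicat_real (cball 0 (real m)) x * (norm (v x))\<^sup>2"
      using v[of m] by eventually_elim (auto simp: indicator_def)
    ultimately show "integrable lebesgue (\<lambda>x. indicat_real (cball 0 (real m)) x * (norm (v x))\<^sup>2)"
      using cb by (subst integrable_cong_AE[symmetric]) (auto intro!: borel_measurable_times borel_measurable_indicator)
  qed
  moreover have "weak_deriv j f \<phi> = (LINT x|lebesgue. \<phi> x * v x)" if \<phi>: "test_function \<phi>" for \<phi>
  proof -
    obtain R where R: "supported_in R \<phi>" using \<phi> by (rule test_function_supported)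
    obtain m :: nat where m: "R \<le> real m" using real_arch_simple by blast
    have supp: "supported_in (real m) \<phi>" using R m by (rule supported_in_mono)
    then have supp2: "supported_in (real m + 2) \<phi>" by (rule supported_in_mono) simp
    have [measurable]: "\<phi> \<in> borel_measurable lebesgue"
      using test_function_continuous[OF \<phi>] by (rule continuous_on_imp_borel_measurable_lebesgue)
    have "(LINT x|lebesgue. \<phi> x * V m x) = (LINT x|lebesgue. \<phi> x * v x)"
    proof (rule integral_cong_AE)
      show "AE x in lebesgue. \<phi> x * V m x = \<phi> x * v x"
        using v[of m]
      proof eventually_elim
        case (elim x)
        then show ?case using supp by (cases "norm x \<le> real m") (auto simp: supported_in_def)
      qed
    qed measurable
    with weak[OF \<phi> supp2] show ?thesis by simp
  qed
  ultimately show ?thesis by blast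
qed

text \<open>Apply the compactly supported case to \<open>\<eta> H\<close> with a cutoff \<open>\<eta>\<close> that is \<open>1\<close> on the ball of radius \<open>m + 2\<close>.
In the proof, \<open>d i l\<close> is \<open>\<partial>\<^sub>i \<eta> H\<^sub>l\<close>, so that \<open>curl (\<eta> H) = \<eta> C + r\<close> with \<open>r = grad \<eta> \<times> H\<close>, and
\<open>div (\<eta> H) = grad \<eta> \<cdot> H\<close>.\<close>

lemma weak_derivatives_of_field:
  fixes H C :: "3 \<Rightarrow> real^3 \<Rightarrow> complex"
  assumes H: "\<And>k. L2_loc (H k)" and C: "\<And>k. L2_loc (C k)"
    and curl1: "\<And>\<phi>. test_function \<phi> \<Longrightarrow> weak_deriv 2 (H 3) \<phi> - weak_deriv 3 (H 2) \<phi> = (LINT x|lebesgue. \<phi> x * C 1 x)"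
    and curl2: "\<And>\<phi>. test_function \<phi> \<Longrightarrow> weak_deriv 3 (H 1) \<phi> - weak_deriv 1 (H 3) \<phi> = (LINT x|lebesgue. \<phi> x * C 2 x)"
    and curl3: "\<And>\<phi>. test_function \<phi> \<Longrightarrow> weak_deriv 1 (H 2) \<phi> - weak_deriv 2 (H 1) \<phi> = (LINT x|lebesgue. \<phi> x * C 3 x)"
    and div: "\<And>\<phi>. test_function \<phi> \<Longrightarrow> weak_deriv 1 (H 1) \<phi> + weak_deriv 2 (H 2) \<phi> + weak_deriv 3 (H 3) \<phi> = 0"
  shows "\<exists>v. L2_loc v \<and> (\<forall>\<phi>. test_function \<phi> \<longrightarrow> weak_deriv j (H k) \<phi> = (LINT x|lebesgue. \<phi> x * v x))"
proof -
  have "\<exists>v. square_integrable v \<and> (\<forall>\<phi>. test_function \<phi> \<longrightarrow> supported_in (real m + 2) \<phi> \<longrightarrow>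
      weak_deriv j (H k) \<phi> = (LINT x|lebesgue. \<phi> x * v x))" for m :: nat
  proof -
    obtain \<eta> where \<eta>: "test_function \<eta>" "supported_in (real m + 2 + 2) \<eta>" "\<And>x. norm x \<le> real m + 2 \<Longrightarrow> \<eta> x = 1"
      using cutoff_exists[of "real m + 2"] by auto
    have \<eta>': "test_function (partial_deriv i \<eta>)" "supported_in (real m + 2 + 2) (partial_deriv i \<eta>)" for i
      using \<eta> by (auto intro: test_function_partial_deriv supported_in_partial_deriv)
    let ?R = "real m + 2 + 2"
    define d where "d i l x = partial_deriv i \<eta> x * H l x" for i l x
    have d: "square_integrable (d i l)" "supported_in ?R (d i l)" for i l
      unfolding d_def by (rule test_function_mult_L2_loc[OF \<eta>' H])+
    define G where "G l x = \<eta> x * H l x" for l x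
    have G: "square_integrable (G l)" "supported_in ?R (G l)" for l
      unfolding G_def by (rule test_function_mult_L2_loc[OF \<eta>(1,2) H])+
    define e where "e l x = \<eta> x * C l x" for l x
    have e: "square_integrable (e l)" "supported_in ?R (e l)" for l
      unfolding e_def by (rule test_function_mult_L2_loc[OF \<eta>(1,2) C])+
    define r where "r l = (if l = 1 then (\<lambda>x. d 2 3 x - d 3 2 x) else if l = 2 then (\<lambda>x. d 3 1 x - d 1 3 x) else (\<lambda>x. d 1 2 x - d 2 1 x))" for l :: 3
    have r: "square_integrable (r l)" "supported_in ?R (r l)" for l
      using d by (auto simp: r_def supported_in_def intro!: square_integrable_diff)
    have r_eq: "r 1 = (\<lambda>x. d 2 3 x - d 3 2 x)" "r 2 = (\<lambda>x. d 3 1 x - d 1 3 x)" "r 3 = (\<lambda>x. d 1 2 x - d 2 1 x)"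
      by (auto simp: r_def)
    have weakG: "weak_deriv i (G l) \<phi> = weak_deriv i (H l) (\<lambda>x. \<eta> x * \<phi> x) + (LINT x|lebesgue. \<phi> x * d i l x)"
      if "test_function \<phi>" for i l \<phi>
      unfolding G_def d_def
      by (rule weak_deriv_smooth_mult[OF test_function_smooth[OF \<eta>(1)] L2_loc_imp_L1_loc[OF H] that])
    have test: "test_function (\<lambda>x. \<eta> x * \<phi> x)" if "test_function \<phi>" for \<phi>
      using that by (intro test_function_mult test_function_smooth[OF \<eta>(1)])
    have e_eq: "(LINT x|lebesgue. \<eta> x * \<phi> x * C l x) = (LINT x|lebesgue. \<phi> x * e l x)" for l \<phi>
      by (simp add: e_def mult_ac)
    have int: "integrable lebesgue (\<lambda>x. \<phi> x * f x)" if "test_function \<phi>" "square_integrable f" for \<phi> f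
      by (rule test_function_mult_integrable[OF that(1) square_integrable_imp_L1_loc[OF that(2)]])
    have "\<exists>v. square_integrable v \<and> (\<forall>\<phi>. test_function \<phi> \<longrightarrow> weak_deriv j (G k) \<phi> = (LINT x|lebesgue. \<phi> x * v x))"
    proof (rule weak_derivatives_of_compactly_supported_field[OF G, where C = "\<lambda>l x. e l x + r l x" and d = "\<lambda>x. d 1 1 x + d 2 2 x + d 3 3 x"])
      show "square_integrable (\<lambda>x. e l x + r l x)" for l using e r by (intro square_integrable_add)
      show "supported_in ?R (\<lambda>x. e l x + r l x)" for l using e(2)[of l] r(2)[of l] by (simp add: supported_in_def)
      show "square_integrable (\<lambda>x. d 1 1 x + d 2 2 x + d 3 3 x)" using d by (intro square_integrable_add)
      show "supported_in ?R (\<lambda>x. d 1 1 x + d 2 2 x + d 3 3 x)"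
        using d(2)[of 1 1] d(2)[of 2 2] d(2)[of 3 3] by (simp add: supported_in_def)
      fix \<phi> assume \<phi>: "test_function \<phi>"
      note i = int[OF \<phi> d(1)] int[OF \<phi> e(1)] int[OF \<phi> r(1)]
      show "weak_deriv 2 (G 3) \<phi> - weak_deriv 3 (G 2) \<phi> = (LINT x|lebesgue. \<phi> x * (e 1 x + r 1 x))"
        using curl1[OF test[OF \<phi>]] i by (simp add: weakG[OF \<phi>] e_eq r_eq distrib_left right_diff_distrib)
      show "weak_deriv 3 (G 1) \<phi> - weak_deriv 1 (G 3) \<phi> = (LINT x|lebesgue. \<phi> x * (e 2 x + r 2 x))"
        using curl2[OF test[OF \<phi>]] i by (simp add: weakG[OF \<phi>] e_eq r_eq distrib_left right_diff_distrib)
      show "weak_deriv 1 (G 2) \<phi> - weak_deriv 2 (G 1) \<phi> = (LINT x|lebesgue. \<phi> x * (e 3 x + r 3 x))"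
        using curl3[OF test[OF \<phi>]] i by (simp add: weakG[OF \<phi>] e_eq r_eq distrib_left right_diff_distrib)
      show "weak_deriv 1 (G 1) \<phi> + weak_deriv 2 (G 2) \<phi> + weak_deriv 3 (G 3) \<phi>
          = (LINT x|lebesgue. \<phi> x * (d 1 1 x + d 2 2 x + d 3 3 x))"
        using div[OF test[OF \<phi>]] i by (simp add: weakG[OF \<phi>] distrib_left add.assoc)
    qed
    then obtain v where v: "square_integrable v"
      "\<And>\<phi>. test_function \<phi> \<Longrightarrow> weak_deriv j (G k) \<phi> = (LINT x|lebesgue. \<phi> x * v x)" by blast
    have "weak_deriv j (H k) \<phi> = weak_deriv j (G k) \<phi>" if "supported_in (real m + 2) \<phi>" for \<phi>
    proof -
      have "partial_deriv j \<phi> x * H k x = partial_deriv j \<phi> x * G k x" for x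
        using supported_in_partial_deriv[OF that, of j] \<eta>(3)[of x]
        by (cases "norm x \<le> real m + 2") (auto simp: supported_in_def G_def)
      then show ?thesis by (simp only: weak_deriv_def)
    qed
    with v show ?thesis by auto
  qed
  then obtain V where "\<And>m :: nat. square_integrable (V m)"
    "\<And>m \<phi>. test_function \<phi> \<Longrightarrow> supported_in (real m + 2) \<phi> \<Longrightarrow> weak_deriv j (H k) \<phi> = (LINT x|lebesgue. \<phi> x * V m x)"
    by metis
  then show ?thesis by (rule glue_weak_derivatives)
qed


section \<open>Vector fields as distributions\<close>

lemma norm_vector_scalar_mult: "norm (a *s b) = norm a * norm b" for a :: complex and b :: "complex^3"
  by (simp add: norm_vec_def norm_mult L2_set_right_distrib)

lemma bounded_bilinear_vector_scalar_mult: "bounded_bilinear ((*s) :: complex \<Rightarrow> complex^3 \<Rightarrow> complex^3)"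
proof
  show "\<exists>K. \<forall>a (b :: complex^3). norm (a *s b) \<le> norm a * norm b * K"
    by (intro exI[of _ 1]) (simp add: norm_vector_scalar_mult)
qed (simp_all add: vec_eq_iff algebra_simps)

lemma borel_measurable_nth:
  fixes u :: "real^3 \<Rightarrow> complex^3"
  assumes "u \<in> borel_measurable lebesgue"
  shows "(\<lambda>x. u x $ k) \<in> borel_measurable lebesgue"
  using assms by (rule measurable_compose) (intro borel_measurable_continuous_onI continuous_intros)

lemma L1_loc_nth:
  fixes u :: "real^3 \<Rightarrow> complex^3"
  assumes "L1_loc u"
  shows "L1_loc (\<lambda>x. u x $ k)"
  unfolding L1_loc_def
proof (intro conjI allI impI)
  show "(\<lambda>x. u x $ k) \<in> borel_measurable lebesgue"
    using assms by (intro borel_measurable_nth) (simp add: L1_loc_def)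
  fix K :: "(real^3) set" assume "compact K"
  with assms have "integrable lebesgue (\<lambda>x. indicator K x *\<^sub>R u x)" by (auto simp: L1_loc_def set_integrable_def)
  from integrable_bounded_linear[OF bounded_linear_vec_nth this, of k]
  show "set_integrable lebesgue K (\<lambda>x. u x $ k)" by (simp add: set_integrable_def)
qed

lemma L2_loc_bound:
  fixes u :: "real^3 \<Rightarrow> 'a::euclidean_space" and v :: "real^3 \<Rightarrow> 'b::euclidean_space"
  assumes u: "L2_loc u" and v: "v \<in> borel_measurable lebesgue"
    and le: "\<And>K. compact K \<Longrightarrow> \<exists>B. AE x in lebesgue. x \<in> K \<longrightarrow> norm (v x) \<le> B * norm (u x)"
  shows "L2_loc v"
  unfolding L2_loc_def
proof (intro conjI allI impI v)
  fix K :: "(real^3) set" assume K: "compact K"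
  obtain B where B: "AE x in lebesgue. x \<in> K \<longrightarrow> norm (v x) \<le> B * norm (u x)" using le[OF K] by blast
  have [measurable]: "v \<in> borel_measurable lebesgue" by fact
  have [measurable]: "K \<in> sets lebesgue" using K by (simp add: lmeasurable_compact fmeasurableD)
  have "integrable lebesgue (\<lambda>x. indicator K x *\<^sub>R (norm (u x))\<^sup>2)"
    using u K by (simp add: L2_loc_def set_integrable_def)
  then have "integrable lebesgue (\<lambda>x. B\<^sup>2 * (indicator K x *\<^sub>R (norm (u x))\<^sup>2))" by (rule integrable_mult_right)
  then show "set_integrable lebesgue K (\<lambda>x. (norm (v x))\<^sup>2)"
    unfolding set_integrable_def
  proof (rule Bochner_Integration.integrable_bound)
    show "AE x in lebesgue. norm (indicat_real K x *\<^sub>R (norm (v x))\<^sup>2) \<le> norm (B\<^sup>2 * (indicator K x *\<^sub>R (norm (u x))\<^sup>2))"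
      using B
    proof eventually_elim
      case (elim x)
      show ?case
      proof (cases "x \<in> K")
        case True
        with elim have "(norm (v x))\<^sup>2 \<le> (B * norm (u x))\<^sup>2" by (intro power_mono) auto
        with True show ?thesis by (simp add: power_mult_distrib)
      qed simp
    qed
  qed measurable
qed

lemma L2_loc_nth:
  fixes u :: "real^3 \<Rightarrow> complex^3"
  assumes "L2_loc u"
  shows "L2_loc (\<lambda>x. u x $ k)"
proof (rule L2_loc_bound[OF assms])
  show "(\<lambda>x. u x $ k) \<in> borel_measurable lebesgue"
    using assms by (intro borel_measurable_nth) (simp add: L2_loc_def)
  show "\<exists>B. AE x in lebesgue. x \<in> K \<longrightarrow> norm (u x $ k) \<le> B * norm (u x)" for K
    by (intro exI[of _ 1]) (simp add: Finite_Cartesian_Product.norm_nth_le)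
qed

lemma L2_loc_vec:
  fixes v :: "3 \<Rightarrow> real^3 \<Rightarrow> complex"
  assumes "\<And>k. L2_loc (v k)"
  shows "L2_loc (\<lambda>x. \<chi> k. v k x)"
  unfolding L2_loc_def
proof (intro conjI allI impI)
  have [measurable]: "v k \<in> borel_measurable lebesgue" for k using assms by (simp add: L2_loc_def)
  have eq: "(\<lambda>x. \<chi> k. v k x) = (\<lambda>x. \<Sum>k\<in>UNIV. v k x *s axis k 1)"
    by (simp add: fun_eq_iff vec_eq_iff axis_def if_distrib cong: if_cong)
  have "(\<lambda>x. v k x *s (axis k 1 :: complex^3)) \<in> borel_measurable lebesgue" for k
  proof -
    have "bounded_linear (\<lambda>a. a *s (axis k 1 :: complex^3))"
      by (rule bounded_bilinear.bounded_linear_left[OF bounded_bilinear_vector_scalar_mult])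
    from borel_measurable_continuous_onI[OF linear_continuous_on[OF this]]
    show ?thesis by (rule measurable_compose[rotated]) measurable
  qed
  then show "(\<lambda>x. \<chi> k. v k x) \<in> borel_measurable lebesgue"
    unfolding eq by (intro borel_measurable_sum)
  fix K :: "(real^3) set" assume K: "compact K"
  have "(norm (\<chi> k. v k x))\<^sup>2 = (\<Sum>k\<in>UNIV. (norm (v k x))\<^sup>2)" for x
    by (simp add: norm_vec_def L2_set_def sum_nonneg)
  moreover have "set_integrable lebesgue K (\<lambda>x. \<Sum>k\<in>UNIV. (norm (v k x))\<^sup>2)"
    using assms K unfolding set_integrable_def L2_loc_def scaleR_sum_right
    by (intro Bochner_Integration.integrable_sum) auto
  ultimately show "set_integrable lebesgue K (\<lambda>x. (norm (\<chi> k. v k x))\<^sup>2)" by simp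
qed

lemma distr_of_nth:
  assumes \<phi>: "test_function \<phi>" and u: "L1_loc u"
  shows "distr_of u \<phi> $ k = (LINT x|lebesgue. \<phi> x * u x $ k)"
proof -
  obtain R where R: "supported_in R \<phi>" using \<phi> by (rule test_function_supported)
  have "integrable lebesgue (\<lambda>x. \<phi> x *s u x)"
    by (rule integrable_mult_L1_loc[OF test_function_continuous[OF \<phi>] R u bounded_bilinear_vector_scalar_mult])
  from integral_bounded_linear[OF bounded_linear_vec_nth this, of k]
  show ?thesis by (simp add: distr_of_def)
qed

lemma distr_deriv_nth:
  assumes "test_function \<phi>" "L1_loc u"
  shows "distr_deriv j (distr_of u) \<phi> $ k = weak_deriv j (\<lambda>x. u x $ k) \<phi>"
  using assms by (simp add: distr_deriv_def weak_deriv_def distr_of_nth test_function_partial_deriv)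

lemma H1_loc_of_curl_div:
  assumes H: "L2_loc H" and C: "L2_loc C"
    and curl: "distr_eq (distr_curl (distr_of H)) (distr_of C)"
    and div: "\<And>\<phi>. test_function \<phi> \<Longrightarrow> distr_div (distr_of H) \<phi> = 0"
  shows "H1_loc H"
  unfolding H1_loc_def
proof (intro conjI allI H)
  fix j
  note HL = L2_loc_imp_L1_loc[OF H] and CL = L2_loc_imp_L1_loc[OF C]
  have "\<exists>v. L2_loc v \<and> (\<forall>\<phi>. test_function \<phi> \<longrightarrow> weak_deriv j (\<lambda>x. H x $ k) \<phi> = (LINT x|lebesgue. \<phi> x * v x))" for k
  proof (rule weak_derivatives_of_field[where H = "\<lambda>k x. H x $ k" and C = "\<lambda>k x. C x $ k"])
    fix \<phi> assume \<phi>: "test_function \<phi>"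
    have eq: "distr_curl (distr_of H) \<phi> $ i = (LINT x|lebesgue. \<phi> x * C x $ i)" for i
      using curl \<phi> distr_of_nth[OF \<phi> CL] by (simp add: distr_eq_def)
    note comp = distr_curl_def vector_3 distr_deriv_nth[OF \<phi> HL]
    show "weak_deriv 2 (\<lambda>x. H x $ 3) \<phi> - weak_deriv 3 (\<lambda>x. H x $ 2) \<phi> = (LINT x|lebesgue. \<phi> x * C x $ 1)"
      using eq[of 1] by (simp add: comp)
    show "weak_deriv 3 (\<lambda>x. H x $ 1) \<phi> - weak_deriv 1 (\<lambda>x. H x $ 3) \<phi> = (LINT x|lebesgue. \<phi> x * C x $ 2)"
      using eq[of 2] by (simp add: comp)
    show "weak_deriv 1 (\<lambda>x. H x $ 2) \<phi> - weak_deriv 2 (\<lambda>x. H x $ 1) \<phi> = (LINT x|lebesgue. \<phi> x * C x $ 3)"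
      using eq[of 3] by (simp add: comp)
    show "weak_deriv 1 (\<lambda>x. H x $ 1) \<phi> + weak_deriv 2 (\<lambda>x. H x $ 2) \<phi> + weak_deriv 3 (\<lambda>x. H x $ 3) \<phi> = 0"
      using div[OF \<phi>] by (simp add: distr_div_def sum_3 distr_deriv_nth[OF \<phi> HL])
  qed (intro L2_loc_nth H C)+
  then obtain v where v: "\<And>k. L2_loc (v k)"
    "\<And>k \<phi>. test_function \<phi> \<Longrightarrow> weak_deriv j (\<lambda>x. H x $ k) \<phi> = (LINT x|lebesgue. \<phi> x * v k x)" by metis
  let ?v = "\<lambda>x. \<chi> k. v k x"
  have vS: "L2_loc ?v" by (rule L2_loc_vec[OF v(1)])
  have "distr_eq (distr_deriv j (distr_of H)) (distr_of ?v)"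
    unfolding distr_eq_def vec_eq_iff
    using v(2) by (simp add: distr_deriv_nth HL distr_of_nth L2_loc_imp_L1_loc[OF vS])
  with vS show "\<exists>v. L2_loc v \<and> distr_eq (distr_deriv j (distr_of H)) (distr_of v)" by blast
qed

text \<open>Both fields represent the same distribution, and the fundamental lemma applies to each component of
their difference.\<close>

lemma has_curl_unique:
  assumes "has_curl u v" "has_curl u w"
  shows "AE x in lebesgue. v x = w x"
proof -
  have L: "L1_loc v" "L1_loc w" using assms by (auto simp: has_curl_def)
  have "AE x in lebesgue. v x $ k - w x $ k = 0" for k
  proof (rule fundamental_lemma)
    have "set_integrable lebesgue K (\<lambda>x. v x $ k - w x $ k)" if "compact K" for K
      using L1_loc_nth[OF L(1), of k] L1_loc_nth[OF L(2), of k] that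
      unfolding L1_loc_def by (intro set_integral_diff) auto
    moreover have "(\<lambda>x. v x $ k - w x $ k) \<in> borel_measurable lebesgue"
      using L1_loc_nth[OF L(1), of k] L1_loc_nth[OF L(2), of k] unfolding L1_loc_def by auto
    ultimately show "L1_loc (\<lambda>x. v x $ k - w x $ k)" by (simp add: L1_loc_def)
    fix \<phi> assume \<phi>: "test_function \<phi>"
    have "distr_of v \<phi> = distr_of w \<phi>" using assms \<phi> by (simp add: has_curl_def distr_eq_def)
    then have "(LINT x|lebesgue. \<phi> x * v x $ k) = (LINT x|lebesgue. \<phi> x * w x $ k)"
      by (simp flip: distr_of_nth[OF \<phi> L(1)] distr_of_nth[OF \<phi> L(2)])
    then show "(LINT x|lebesgue. \<phi> x * (v x $ k - w x $ k)) = 0"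
      using test_function_mult_integrable[OF \<phi> L1_loc_nth[OF L(1)], of k]
        test_function_mult_integrable[OF \<phi> L1_loc_nth[OF L(2)], of k]
      by (simp add: right_diff_distrib)
  qed
  then have "AE x in lebesgue. \<forall>k\<in>UNIV. v x $ k - w x $ k = 0"
    by (intro AE_finite_allI) auto
  then show ?thesis by eventually_elim (simp add: vec_eq_iff)
qed

lemma div_curl_eq_0:
  assumes \<phi>: "test_function \<phi>"
  shows "distr_div (distr_curl (distr_of E)) \<phi> = 0"
proof -
  have c: "partial_deriv i (partial_deriv j \<phi>) = partial_deriv j (partial_deriv i \<phi>)" for i j
    using partial_deriv_commute[OF test_function_smooth[OF \<phi>]] by blast
  show ?thesis
    unfolding distr_div_def sum_3 distr_deriv_def[of _ "distr_curl _"] distr_curl_def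
    by (simp add: distr_deriv_def c[of 2 1] c[of 3 1] c[of 3 2])
qed

text \<open>Completeness of Lebesgue measure in the form needed to change representatives of fields.\<close>

lemma borel_measurable_lebesgue_cong_AE:
  fixes u v :: "real^3 \<Rightarrow> 'b::euclidean_space"
  assumes "u \<in> borel_measurable lebesgue" "AE x in lebesgue. u x = v x"
  shows "v \<in> borel_measurable lebesgue"
proof -
  obtain N where N: "N \<in> null_sets lebesgue" "{x. u x \<noteq> v x} \<subseteq> N"
    using assms(2) by (auto simp: eventually_ae_filter)
  have "u measurable_on UNIV"
    using assms(1) by (simp add: measurable_on_iff_borel_measurable lebesgue_on_UNIV_eq)
  moreover have "v x = u x" if "x \<in> UNIV - N" for x using N(2) that by force
  ultimately have "v measurable_on UNIV"
    using N(1) by (intro measurable_on_spike[of u UNIV N v]) (auto simp: negligible_iff_null_sets)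
  then show ?thesis by (simp add: measurable_on_iff_borel_measurable lebesgue_on_UNIV_eq)
qed

lemma L1_loc_cong_AE:
  fixes u v :: "real^3 \<Rightarrow> 'b::euclidean_space"
  assumes u: "L1_loc u" and eq: "AE x in lebesgue. u x = v x"
  shows "L1_loc v"
  unfolding L1_loc_def
proof (intro conjI allI impI)
  have um[measurable]: "u \<in> borel_measurable lebesgue" using u by (simp add: L1_loc_def)
  show vm[measurable]: "v \<in> borel_measurable lebesgue" by (rule borel_measurable_lebesgue_cong_AE[OF um eq])
  fix K :: "(real^3) set" assume K: "compact K"
  have [measurable]: "K \<in> sets lebesgue" using K by (simp add: lmeasurable_compact fmeasurableD)
  have "integrable lebesgue (\<lambda>x. indicator K x *\<^sub>R u x)" using u K by (simp add: L1_loc_def set_integrable_def)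
  then show "set_integrable lebesgue K v"
    unfolding set_integrable_def
    by (rule integrable_cong_AE_imp) (measurable, use eq in eventually_elim, simp)
qed

lemma distr_of_cong_AE:
  assumes u: "L1_loc u" and eq: "AE x in lebesgue. u x = v x" and \<phi>: "test_function \<phi>"
  shows "distr_of u \<phi> = distr_of v \<phi>"
proof -
  have v: "L1_loc v" by (rule L1_loc_cong_AE[OF u eq])
  have "(LINT x|lebesgue. \<phi> x * u x $ k) = (LINT x|lebesgue. \<phi> x * v x $ k)" for k
  proof (rule integral_cong_AE)
    show "AE x in lebesgue. \<phi> x * u x $ k = \<phi> x * v x $ k" using eq by eventually_elim simp
  qed (use test_function_mult_integrable[OF \<phi> L1_loc_nth] u v in auto)
  then show ?thesis by (simp add: vec_eq_iff distr_of_nth[OF \<phi>] u v)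
qed

lemma L1_loc_cmult:
  fixes u :: "real^3 \<Rightarrow> complex^3"
  assumes "L1_loc u"
  shows "L1_loc (\<lambda>x. c *s u x)"
  unfolding L1_loc_def
proof (intro conjI allI impI)
  have lin: "bounded_linear ((*s) c :: complex^3 \<Rightarrow> complex^3)"
    by (rule bounded_bilinear.bounded_linear_right[OF bounded_bilinear_vector_scalar_mult])
  have um: "u \<in> borel_measurable lebesgue" using assms by (simp add: L1_loc_def)
  show "(\<lambda>x. c *s u x) \<in> borel_measurable lebesgue"
    by (rule measurable_compose[OF um borel_measurable_continuous_onI[OF linear_continuous_on[OF lin]]])
  fix K :: "(real^3) set" assume "compact K"
  with assms have "integrable lebesgue (\<lambda>x. indicator K x *\<^sub>R u x)" by (auto simp: L1_loc_def set_integrable_def)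
  from integrable_bounded_linear[OF lin this]
  show "set_integrable lebesgue K (\<lambda>x. c *s u x)"
    by (simp add: set_integrable_def linear_cmul[OF bounded_linear.linear[OF lin]])
qed

lemma L2_loc_cmult:
  fixes u :: "real^3 \<Rightarrow> complex^3"
  assumes "L2_loc u"
  shows "L2_loc (\<lambda>x. c *s u x)"
proof (rule L2_loc_bound[OF assms])
  show "(\<lambda>x. c *s u x) \<in> borel_measurable lebesgue"
    using L1_loc_cmult[OF L2_loc_imp_L1_loc[OF assms], of c] by (simp add: L1_loc_def)
  show "\<exists>B. AE x in lebesgue. x \<in> K \<longrightarrow> norm (c *s u x) \<le> B * norm (u x)" for K
    by (intro exI[of _ "norm c"]) (simp add: norm_vector_scalar_mult)
qed

lemma L2_loc_Linfty_loc_mult: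
  fixes u :: "real^3 \<Rightarrow> complex^3" and a :: "real^3 \<Rightarrow> real"
  assumes u: "L2_loc u" and a: "Linfty_loc a"
  shows "L2_loc (\<lambda>x. a x *\<^sub>R u x)"
proof (rule L2_loc_bound[OF u])
  show "(\<lambda>x. a x *\<^sub>R u x) \<in> borel_measurable lebesgue"
    using u a by (auto simp: L2_loc_def Linfty_loc_def)
  fix K :: "(real^3) set" assume "compact K"
  with a obtain B where "AE x in lebesgue. x \<in> K \<longrightarrow> norm (a x) \<le> B" by (auto simp: Linfty_loc_def)
  then have "AE x in lebesgue. x \<in> K \<longrightarrow> norm (a x *\<^sub>R u x) \<le> B * norm (u x)"
    by eventually_elim (auto intro: mult_right_mono)
  then show "\<exists>B. AE x in lebesgue. x \<in> K \<longrightarrow> norm (a x *\<^sub>R u x) \<le> B * norm (u x)" by blast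
qed

lemma distr_of_cmult:
  assumes "test_function \<phi>" "L1_loc u"
  shows "distr_of (\<lambda>x. c *s u x) \<phi> = c *s distr_of u \<phi>"
  using assms by (simp add: vec_eq_iff distr_of_nth L1_loc_cmult mult.left_commute)

text \<open>A distribution is only determined on test functions, so equations between distributions have to be
transported through the curl in this form.\<close>

lemma distr_curl_cong:
  assumes "\<And>\<phi>. test_function \<phi> \<Longrightarrow> S \<phi> = T \<phi>" "test_function \<phi>"
  shows "distr_curl S \<phi> = distr_curl T \<phi>"
  using assms by (simp add: distr_curl_def distr_deriv_def test_function_partial_deriv)

lemma distr_curl_cmult: "distr_curl (\<lambda>\<phi>. c *s T \<phi>) \<phi> = c *s distr_curl T \<phi>"
  by (simp add: distr_curl_def distr_deriv_def vec_eq_iff forall_3 algebra_simps)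

lemma distr_curl_of_cmult_AE:
  assumes u: "L1_loc u" and eq: "AE x in lebesgue. c *s u x = v x" and \<phi>: "test_function \<phi>"
  shows "distr_curl (distr_of v) \<phi> = c *s distr_curl (distr_of u) \<phi>"
proof -
  have "distr_of v \<psi> = c *s distr_of u \<psi>" if "test_function \<psi>" for \<psi>
    using distr_of_cong_AE[OF L1_loc_cmult[OF u] eq that] distr_of_cmult[OF that u] by simp
  then show ?thesis using distr_curl_cong[OF _ \<phi>] distr_curl_cmult by metis
qed

lemma scaleR_eq_smult: "r *\<^sub>R v = complex_of_real r *s v" for v :: "complex^3"
  by (simp only: vec_eq_iff vector_scaleR_component vector_smult_component) (simp add: scaleR_conv_of_real)

section \<open>Equivalence of the two systems\<close>

text \<open>With \<open>C = - \<i>\<omega>\<epsilon>E\<close> in the first part, \<open>(1 / n\<^sup>2) C = - \<i>\<omega>\<epsilon>\<^sub>0 E\<close> almost everywhere, and its curl is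
\<open>\<epsilon>\<^sub>0\<mu>\<^sub>0\<omega>\<^sup>2 H\<close> by the first equation of (A). In the second part \<open>E\<close> is almost everywhere the multiple
\<open>\<i> / (\<omega>\<epsilon>\<^sub>0)\<close> of \<open>(1 / n\<^sup>2) C\<close>, and the computation is read backwards.\<close>

theorem theorem2p1:
  fixes \<epsilon> \<mu> n :: "real^3 \<Rightarrow> real" and \<epsilon>\<^sub>0 \<mu>\<^sub>0 \<omega> \<kappa> :: real
  assumes "\<mu>\<^sub>0 > 0" and "\<And>x. \<mu> x = \<mu>\<^sub>0"
    and "AE x in lebesgue. \<epsilon> x > 0"
    and "Linfty_loc \<epsilon>" and "Linfty_loc (\<lambda>x. inverse (\<epsilon> x))"
    and "\<epsilon>\<^sub>0 > 0" and "AE x in lebesgue. \<epsilon> x = \<epsilon>\<^sub>0 * (n x)\<^sup>2"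
    and "\<omega> \<noteq> 0" and "\<kappa>\<^sup>2 = \<epsilon>\<^sub>0 * \<mu>\<^sub>0 * \<omega>\<^sup>2"
  shows "(\<forall>E H. L2_loc E \<and> L2_loc H \<and> solves_A \<omega> \<mu> \<epsilon> E H \<longrightarrow> solves_B n \<kappa> H \<and> H1_loc H) \<and>
    (\<forall>H curl_H. L2_loc H \<and> L2_loc curl_H \<and> has_curl H curl_H \<and> solves_B n \<kappa> H \<longrightarrow>
       H1_loc H \<and>
       solves_A \<omega> \<mu> \<epsilon> (\<lambda>x. (\<i> / complex_of_real (\<omega> * \<epsilon> x)) *s curl_H x) H)"
proof -
  have index_ratio: "AE x in lebesgue. \<epsilon> x > 0 \<and> 1 / (n x)\<^sup>2 = \<epsilon>\<^sub>0 / \<epsilon> x"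
    using assms(3,7) by eventually_elim (use assms(6) in \<open>auto simp: field_simps zero_less_mult_iff\<close>)
  have \<mu>_eq: "\<mu> x *\<^sub>R H x = complex_of_real \<mu>\<^sub>0 *s H x" for H :: "real^3 \<Rightarrow> complex^3" and x
    unfolding assms(2) by (rule scaleR_eq_smult)
  show ?thesis
  proof (intro conjI allI impI)
    fix E H
    assume asm: "L2_loc E \<and> L2_loc H \<and> solves_A \<omega> \<mu> \<epsilon> E H"
    then have E: "L2_loc E" and H: "L2_loc H" and A: "solves_A \<omega> \<mu> \<epsilon> E H" by auto
    note EL = L2_loc_imp_L1_loc[OF E] and HL = L2_loc_imp_L1_loc[OF H]
    let ?c = "\<i> * complex_of_real \<omega>"
    define C where "C x = (- ?c) *s (\<epsilon> x *\<^sub>R E x)" for x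
    have \<epsilon>E: "L2_loc (\<lambda>x. \<epsilon> x *\<^sub>R E x)" by (rule L2_loc_Linfty_loc_mult[OF E assms(4)])
    have C: "L2_loc C" unfolding C_def by (rule L2_loc_cmult[OF \<epsilon>E])
    have curlE: "distr_curl (distr_of E) \<phi> = (?c * complex_of_real \<mu>\<^sub>0) *s distr_of H \<phi>" if "test_function \<phi>" for \<phi>
      using A that unfolding solves_A_def distr_eq_def \<mu>_eq by (simp add: distr_of_cmult HL vector_smult_assoc)
    have curlH: "distr_curl (distr_of H) \<phi> = distr_of C \<phi>" if "test_function \<phi>" for \<phi>
    proof -
      let ?D = "distr_of (\<lambda>x. \<epsilon> x *\<^sub>R E x) \<phi>"
      have "distr_of C \<phi> = (- ?c) *s ?D"
        unfolding C_def[abs_def] by (rule distr_of_cmult[OF that L2_loc_imp_L1_loc[OF \<epsilon>E]])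
      then have "distr_of C \<phi> + ?c *s ?D = 0" by simp
      moreover have "distr_curl (distr_of H) \<phi> + ?c *s ?D = 0"
        using A that unfolding solves_A_def distr_eq_def by blast
      ultimately show ?thesis by (metis add_right_cancel)
    qed
    have has_curl: "has_curl H C"
      using curlH HL L2_loc_imp_L1_loc[OF C] by (simp add: has_curl_def distr_eq_def)
    have q: "AE x in lebesgue. (- ?c * complex_of_real \<epsilon>\<^sub>0) *s E x = (1 / (n x)\<^sup>2) *\<^sub>R C x"
      using index_ratio
    proof eventually_elim
      case (elim x)
      then have e: "1 / (n x)\<^sup>2 = \<epsilon>\<^sub>0 / \<epsilon> x" "\<epsilon> x \<noteq> 0" by auto
      show ?case unfolding C_def e(1) using e(2) by (simp add: vec_eq_iff scaleR_eq_smult)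
    qed
    have div: "distr_div (distr_of H) \<phi> = 0" if \<phi>: "test_function \<phi>" for \<phi>
    proof -
      have "distr_div (distr_curl (distr_of E)) \<phi> = (?c * complex_of_real \<mu>\<^sub>0) * distr_div (distr_of H) \<phi>"
        unfolding distr_div_def distr_deriv_def using curlE[OF test_function_partial_deriv[OF \<phi>]]
        by (simp add: sum_distrib_left)
      with div_curl_eq_0[OF \<phi>, of E] assms(1,8) show ?thesis by simp
    qed
    have "solves_B n \<kappa> H"
      unfolding solves_B_def
    proof (intro conjI exI[of _ C] allI impI has_curl div)
      show "L1_loc (\<lambda>x. (1 / (n x)\<^sup>2) *\<^sub>R C x)" by (rule L1_loc_cong_AE[OF L1_loc_cmult[OF EL] q])
      show "distr_eq (distr_curl (distr_of (\<lambda>x. (1 / (n x)\<^sup>2) *\<^sub>R C x))) (\<lambda>\<phi>. \<kappa>\<^sup>2 *\<^sub>R distr_of H \<phi>)"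
        unfolding distr_eq_def
      proof (intro allI impI)
        fix \<phi> assume \<phi>: "test_function \<phi>"
        have "distr_curl (distr_of (\<lambda>x. (1 / (n x)\<^sup>2) *\<^sub>R C x)) \<phi> = (- ?c * complex_of_real \<epsilon>\<^sub>0) *s distr_curl (distr_of E) \<phi>"
          by (rule distr_curl_of_cmult_AE[OF EL q \<phi>])
        also have "\<dots> = \<kappa>\<^sup>2 *\<^sub>R distr_of H \<phi>"
          unfolding curlE[OF \<phi>] assms(9)
          by (simp add: vec_eq_iff scaleR_eq_smult power2_eq_square algebra_simps)
        finally show "distr_curl (distr_of (\<lambda>x. (1 / (n x)\<^sup>2) *\<^sub>R C x)) \<phi> = \<kappa>\<^sup>2 *\<^sub>R distr_of H \<phi>" .
      qed
    qed
    moreover have "H1_loc H"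
      using H1_loc_of_curl_div[OF H C _ div] curlH by (simp add: distr_eq_def)
    ultimately show "solves_B n \<kappa> H" "H1_loc H" by auto
  next
    fix H curl_H
    assume asm: "L2_loc H \<and> L2_loc curl_H \<and> has_curl H curl_H \<and> solves_B n \<kappa> H"
    then have H: "L2_loc H" and cH: "L2_loc curl_H" and curl: "has_curl H curl_H" and B: "solves_B n \<kappa> H" by auto
    note HL = L2_loc_imp_L1_loc[OF H] and cHL = L2_loc_imp_L1_loc[OF cH]
    show "H1_loc H"
      using H1_loc_of_curl_div[OF H cH] curl B by (simp add: has_curl_def solves_B_def)
    obtain C where C: "has_curl H C" "L1_loc (\<lambda>x. (1 / (n x)\<^sup>2) *\<^sub>R C x)"
      "distr_eq (distr_curl (distr_of (\<lambda>x. (1 / (n x)\<^sup>2) *\<^sub>R C x))) (\<lambda>\<phi>. \<kappa>\<^sup>2 *\<^sub>R distr_of H \<phi>)"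
      using B by (auto simp: solves_B_def)
    define E where "E x = (\<i> / complex_of_real (\<omega> * \<epsilon> x)) *s curl_H x" for x
    \<comment> \<open>This holds at every point: where \<open>\<epsilon> x = 0\<close>, both sides vanish since division by \<open>0\<close> gives \<open>0\<close>.\<close>
    have E_eq: "E = (\<lambda>x. (\<i> / complex_of_real \<omega>) *s (inverse (\<epsilon> x) *\<^sub>R curl_H x))"
      by (simp add: E_def fun_eq_iff vec_eq_iff scaleR_eq_smult field_simps)
    have E: "L2_loc E"
      unfolding E_eq by (intro L2_loc_cmult L2_loc_Linfty_loc_mult cH assms(5))
    have \<epsilon>E: "AE x in lebesgue. (\<i> / complex_of_real \<omega>) *s curl_H x = \<epsilon> x *\<^sub>R E x"
      using index_ratio
    proof (rule eventually_mono)
      fix x assume "\<epsilon> x > 0 \<and> 1 / (n x)\<^sup>2 = \<epsilon>\<^sub>0 / \<epsilon> x"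
      then have "\<epsilon> x \<noteq> 0" by simp
      then show "(\<i> / complex_of_real \<omega>) *s curl_H x = \<epsilon> x *\<^sub>R E x"
        by (simp add: E_def vec_eq_iff scaleR_eq_smult field_simps)
    qed
    have q: "AE x in lebesgue. (\<i> / complex_of_real (\<omega> * \<epsilon>\<^sub>0)) *s ((1 / (n x)\<^sup>2) *\<^sub>R C x) = E x"
      using index_ratio has_curl_unique[OF curl C(1)]
    proof eventually_elim
      case (elim x)
      then have e: "1 / (n x)\<^sup>2 = \<epsilon>\<^sub>0 / \<epsilon> x" "\<epsilon> x \<noteq> 0" "C x = curl_H x" by auto
      show ?case unfolding e(1,3) E_def using e(2) assms(6) by (simp add: vec_eq_iff scaleR_eq_smult field_simps)
    qed
    have "solves_A \<omega> \<mu> \<epsilon> E H"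
      unfolding solves_A_def distr_eq_def \<mu>_eq
    proof (intro conjI allI impI)
      show "L1_loc E" by (rule L2_loc_imp_L1_loc[OF E])
      show "L1_loc H" by (rule HL)
      show "L1_loc (\<lambda>x. complex_of_real \<mu>\<^sub>0 *s H x)" by (rule L1_loc_cmult[OF HL])
      show "L1_loc (\<lambda>x. \<epsilon> x *\<^sub>R E x)" by (rule L1_loc_cong_AE[OF L1_loc_cmult[OF cHL] \<epsilon>E])
      fix \<phi> assume \<phi>: "test_function \<phi>"
      have "distr_curl (distr_of E) \<phi> = (\<i> / complex_of_real (\<omega> * \<epsilon>\<^sub>0)) *s (\<kappa>\<^sup>2 *\<^sub>R distr_of H \<phi>)"
        using distr_curl_of_cmult_AE[OF C(2) q \<phi>] C(3) \<phi> by (simp add: distr_eq_def)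
      also have "\<dots> = (\<i> * complex_of_real \<omega>) *s (complex_of_real \<mu>\<^sub>0 *s distr_of H \<phi>)"
        unfolding assms(9) using assms(6,8) by (simp add: vec_eq_iff scaleR_eq_smult power2_eq_square)
      finally show "distr_curl (distr_of E) \<phi> - (\<i> * complex_of_real \<omega>) *s distr_of (\<lambda>x. complex_of_real \<mu>\<^sub>0 *s H x) \<phi> = 0"
        by (simp add: distr_of_cmult[OF \<phi> HL])
      have "distr_of (\<lambda>x. \<epsilon> x *\<^sub>R E x) \<phi> = (\<i> / complex_of_real \<omega>) *s distr_of curl_H \<phi>"
        using distr_of_cong_AE[OF L1_loc_cmult[OF cHL] \<epsilon>E \<phi>] distr_of_cmult[OF \<phi> cHL] by simp
      moreover have "distr_curl (distr_of H) \<phi> = distr_of curl_H \<phi>"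
        using curl \<phi> by (simp add: has_curl_def distr_eq_def)
      ultimately show "distr_curl (distr_of H) \<phi> + (\<i> * complex_of_real \<omega>) *s distr_of (\<lambda>x. \<epsilon> x *\<^sub>R E x) \<phi> = 0"
        using assms(8) by (simp add: vec_eq_iff)
    qed
    then show "solves_A \<omega> \<mu> \<epsilon> (\<lambda>x. (\<i> / complex_of_real (\<omega> * \<epsilon> x)) *s curl_H x) H"
      by (simp add: E_def[abs_def])
  qed
qed

end
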